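(* Let $q\in(0,1)$, $x\in\mathbb C$ with $|x|=1$, $s,t>0$, $\nu\in\{-1,t\}$, and $m,n\in\mathbb N$. For $k\in\mathbb N$, $$\begin{aligned}\int_{-q^{-n}}^{sq^{-n}}& p_n\big(\mu_x;\tfrac1\nu\sqrt{qst},-\tfrac1\nu\sqrt{qt/s},-\nu y\sqrt{q/st};q\big)\,U_m^{(-s)}(-yq^n;q)\\ &\times P_k\big(y;-\nu x\sqrt{q/st},-\tfrac{\nu}{x}\sqrt{q/st};q\big)\,\frac{(-yq^{1+n},yq^{1+n}/s;q)_\infty}{(-y\nu x^{\pm1}\sqrt{q/st};q)_\infty}\,d_qy\\ =&\,(1-q)(-1)^m\nu^{m+k}(q/st)^{k/2}(s/qt)^{m/2}q^{-n}q^{m(m-n)}q^{-\frac12k(k-1)}\\ &\times\frac{(tq^{n-m+1}/\nu,-q^{n-m+1}/\nu;q)_m\,(q^{m-n+k+1},-\nu^2q^{m-n+k+1}/t;q)_\infty}{(-\nu x^{\pm1}\sqrt{qs/t},\nu x^{\pm1}\sqrt{q/st};q)_\infty}\\ &\times q_{m-n+k}\big(\mu_x;-\nu\sqrt{qs/t},\nu\sqrt{q/st};q\big)\,L_m\big(q^{k+1};tq^{n-m}/\nu,-q^{n-m}/\nu;q\big),\end{aligned}$$ and for $k\in\mathbb Z$, $$\begin{aligned}\int_{-q^{-n}}^{sq^{-n}}& p_n\big(\mu_x;-\nu\sqrt{qs/t},\nu\sqrt{q/st},\tfrac y\nu\sqrt{qt/s};q\big)\,U_m^{(-s)}(-yq^n;q)\\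 &\times Q_k\big(y;\tfrac x\nu\sqrt{qt/s},\tfrac1{\nu x}\sqrt{qt/s};-1,s;q\big)\,\frac{(-yq^{1+n},yq^{1+n}/s;q)_\infty}{(\tfrac{yx^{\pm1}}{\nu}\sqrt{qt/s};q)_\infty}\,d_qy\\ =&\,(1-q)\nu^{-m-k}(t/qs)^{k/2}(st/q)^{m/2}q^{-n}q^{m(m-n)}q^{-\frac12k(k-1)}\\ &\times\frac{(-\nu q^{n-m+1},\nu q^{n-m+1}/t;q)_m\,(q^{m-n+k+1},-\nu^2q^{m-n+k+1}/t;q)_\infty}{(-\nu^2q^{k+1}/t;q)_\infty}\\ &\times q_{m-n+k}\big(\mu_x;-\nu\sqrt{qs/t},\nu\sqrt{q/st};q\big)\,L_m\big(-\nu^2q^{k+1}/t;-\nu q^{n-m},\nu q^{n-m}/t;q\big).\end{aligned}$$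
   Context: $\mathbb N=\{0,1,\dots\}$, $\mu_x=\frac12(x+x^{-1})$. $(a;q)_\infty=\prod_{j\ge0}(1-aq^j)$, $(a;q)_n=(a;q)_\infty/(aq^n;q)_\infty$, $(a_1,\dots,a_r;q)_n=\prod_i(a_i;q)_n$, $(ax^{\pm1};q)_n=(ax,a/x;q)_n$, $\theta(a;q)=(a;q)_\infty(q/a;q)_\infty$, $\theta(a,b;q)=\theta(a;q)\theta(b;q)$; ${}_r\varphi_s(a_1,\dots,a_r;b_1,\dots,b_s;q,z)=\sum_{n\ge0}\frac{(a_1,\dots,a_r;q)_n}{(q,b_1,\dots,b_s;q)_n}((-1)^nq^{n(n-1)/2})^{1+s-r}z^n$. Jackson $q$-integral: $\int_0^\alpha f(y)\,d_qy=(1-q)\sum_{j\ge0}f(\alpha q^j)\alpha q^j$, $\int_\beta^\alpha=\int_0^\alpha-\int_0^\beta$. Continuous dual $q$-Hahn polynomials: $p_n(\mu_x;a,b,c;q)=a^{-n}(ab,ac;q)_n\,{}_3\varphi_2(q^{-n},ax,a/x;ab,ac;q,q)$. Al-Salam–Chihara polynomials: $q_n(\mu_x;a,b;q)=p_n(\mu_x;a,b,0;q)$. Al-Salam–Carlitz polynomials: $U_n^{(a)}(x;q)=(-a)^nq^{n(n-1)/2}{}_2\varphi_1(q^{-n},x^{-1};0;q,qx/a)$. Big $q$-Laguerre polynomials: $L_n(x;a,b;q)={}_3\varphi_2(q^{-n},0,x;aq,bq;q,q)$. Al-Salam–Carlitz II polynomials: $P_n(x;c,d;q)=(-c)^nq^{-n(n-1)/2}{}_2\varphi_0(q^{-n},cx;-;q,dq^n/c)$,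 $n\in\mathbb N$. Related functions: $Q_n(x;c,d;z_-,z_+;q)=(-d)^nq^{-n(n+1)/2}\dfrac{(cx;q)_\infty\theta(dz_-,dz_+;q)}{(q/(dx),q^{n+1}x/(dz_-z_+);q)_\infty}\,{}_1\varphi_1\big(q/(cx);dz_-z_+q^{-n}/x;q,cz_-z_+q^{-n}/x\big)$, $n\in\mathbb Z$.
   Formalization: The right-hand sides gain the missing factors (q;q)_k θ(-s;q) (first identity) and (-1)^k (q;q)_∞ θ(-s;q) (second); each identity is asserted when the denominators in its integrand do not vanish (automatic for x≠±1), and 0·∞ products are read as polynomials. *)

theory Defs
  imports "HOL-Analysis.Analysis"
begin

section \<open>Basic hypergeometric notation\<close>

definition qpoch_inf :: "complex \<Rightarrow> complex \<Rightarrow> complex" where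
  "qpoch_inf a q = prodinf (\<lambda>j. 1 - a * q ^ j)"

text \<open>For natural \<open>n\<close> the quotient \<open>(a;q)\<^sub>\<infinity> / (a q\<^sup>n;q)\<^sub>\<infinity>\<close> is the finite product below; the
  product also covers the case that the quotient is \<open>0/0\<close>, which occurs for \<open>a = q\<close> to a negative
  power. See \<open>qpoch_eq_quotient\<close>.\<close>

definition qpoch :: "complex \<Rightarrow> complex \<Rightarrow> nat \<Rightarrow> complex" where
  "qpoch a q n = (\<Prod>j<n. 1 - a * q ^ j)"

text \<open>\<open>(a x\<^sup>\<plusminus>\<^sup>1; q)\<^sub>\<infinity>\<close>\<close>

definition qpoch_inf_pm :: "complex \<Rightarrow> complex \<Rightarrow> complex \<Rightarrow> complex" where
  "qpoch_inf_pm a x q = qpoch_inf (a * x) q * qpoch_inf (a / x) q"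

definition qtheta :: "complex \<Rightarrow> complex \<Rightarrow> complex" where
  "qtheta a q = qpoch_inf a q * qpoch_inf (q / a) q"

definition qhyp :: "complex list \<Rightarrow> complex list \<Rightarrow> complex \<Rightarrow> complex \<Rightarrow> complex" where
  "qhyp as bs q z =
     (\<Sum>n. (\<Prod>a\<leftarrow>as. qpoch a q n) / (qpoch q q n * (\<Prod>b\<leftarrow>bs. qpoch b q n))
          * ((-1) ^ n * q ^ (n * (n - 1) div 2)) powi (1 + int (length bs) - int (length as))
          * z ^ n)"

definition jackson0 :: "(complex \<Rightarrow> complex) \<Rightarrow> complex \<Rightarrow> complex \<Rightarrow> complex" where
  "jackson0 f \<alpha> q = (1 - q) * (\<Sum>j. f (\<alpha> * q ^ j) * (\<alpha> * q ^ j))"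

text \<open>\<open>jackson f \<beta> \<alpha> q\<close> is the integral from \<open>\<beta>\<close> to \<open>\<alpha>\<close>.\<close>

definition jackson :: "(complex \<Rightarrow> complex) \<Rightarrow> complex \<Rightarrow> complex \<Rightarrow> complex \<Rightarrow> complex" where
  "jackson f \<beta> \<alpha> q = jackson0 f \<alpha> q - jackson0 f \<beta> q"

definition jackson_nodes :: "complex \<Rightarrow> complex \<Rightarrow> complex \<Rightarrow> complex set" where
  "jackson_nodes \<beta> \<alpha> q = range (\<lambda>j::nat. \<beta> * q ^ j) \<union> range (\<lambda>j::nat. \<alpha> * q ^ j)"


section \<open>Orthogonal polynomials and related functions\<close>

text \<open>Continuous dual \<open>q\<close>-Hahn polynomials \<open>p\<^sub>n(\<mu>\<^sub>x;a,b,c;q)\<close>; the argument of the function is \<open>x\<close>,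
  where \<open>\<mu>\<^sub>x = (x + 1/x)/2\<close>. The expression \<open>a\<^sup>-\<^sup>n (ab,ac;q)\<^sub>n \<^sub>3\<phi>\<^sub>2(q\<^sup>-\<^sup>n,ax,a/x;ab,ac;q,q)\<close> is a
  polynomial in \<open>b\<close> and \<open>c\<close>, but read literally it is \<open>0 \<cdot> \<infinity>\<close> when \<open>(ab,ac;q)\<^sub>n = 0\<close>. Such values
  do occur below (\<open>ac = q\<^sup>-\<^sup>i\<close> with \<open>0 \<le> i < n\<close> at nodes of the \<open>q\<close>-integral), so the prefactor is
  cancelled against the denominators of the series; see \<open>cdqHahn_eq_qhyp\<close>.\<close>

definition cdqHahn :: "nat \<Rightarrow> complex \<Rightarrow> complex \<Rightarrow> complex \<Rightarrow> complex \<Rightarrow> complex \<Rightarrow> complex" where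
  "cdqHahn n x a b c q =
     a powi (- int n) *
     (\<Sum>j\<le>n. qpoch (q powi (- int n)) q j * qpoch (a * x) q j * qpoch (a / x) q j / qpoch q q j * q ^ j
          * (qpoch (a * b * q ^ j) q (n - j) * qpoch (a * c * q ^ j) q (n - j)))"

text \<open>Al-Salam--Chihara polynomials \<open>q\<^sub>i(\<mu>\<^sub>x;a,b;q)\<close>, with the usual convention that
  polynomials of negative degree are \<open>0\<close>.\<close>

definition alSalamChihara :: "int \<Rightarrow> complex \<Rightarrow> complex \<Rightarrow> complex \<Rightarrow> complex \<Rightarrow> complex" where
  "alSalamChihara i x a b q = (if i < 0 then 0 else cdqHahn (nat i) x a b 0 q)"

text \<open>\<open>alSalamCarlitz n a x q\<close> is \<open>U\<^sub>n\<^sup>(\<^sup>a\<^sup>)(x;q)\<close>.\<close>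

definition alSalamCarlitz :: "nat \<Rightarrow> complex \<Rightarrow> complex \<Rightarrow> complex \<Rightarrow> complex" where
  "alSalamCarlitz n a x q =
     (- a) ^ n * q ^ (n * (n - 1) div 2)
     * qhyp [q powi (- int n), inverse x] [0] q (q * x / a)"

definition bigqLaguerre :: "nat \<Rightarrow> complex \<Rightarrow> complex \<Rightarrow> complex \<Rightarrow> complex \<Rightarrow> complex" where
  "bigqLaguerre n x a b q = qhyp [q powi (- int n), 0, x] [a * q, b * q] q q"

text \<open>The product \<open>(aq,bq;q)\<^sub>n L\<^sub>n(x;a,b;q)\<close> with the factors of the prefactor cancelled against the
  denominators of the series; see \<open>bigqLaguerre_norm_eq\<close>. It is a polynomial in \<open>a\<close> and \<open>b\<close>, and so
  is meaningful for \<open>aq\<close> or \<open>bq\<close> in \<open>{q\<^sup>-\<^sup>i. 0 \<le> i < n}\<close>, where the product is \<open>0 \<cdot> \<infinity>\<close>.\<close>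

definition bigqLaguerre_norm :: "nat \<Rightarrow> complex \<Rightarrow> complex \<Rightarrow> complex \<Rightarrow> complex \<Rightarrow> complex" where
  "bigqLaguerre_norm n x a b q =
     (\<Sum>j\<le>n. qpoch (q powi (- int n)) q j * qpoch x q j / qpoch q q j * q ^ j
          * (qpoch (a * q * q ^ j) q (n - j) * qpoch (b * q * q ^ j) q (n - j)))"

text \<open>Al-Salam--Carlitz II polynomials \<open>P\<^sub>n(x;c,d;q)\<close>\<close>

definition alSalamCarlitz2 :: "nat \<Rightarrow> complex \<Rightarrow> complex \<Rightarrow> complex \<Rightarrow> complex \<Rightarrow> complex" where
  "alSalamCarlitz2 n x c d q =
     (- c) ^ n * q powi (- int (n * (n - 1) div 2))
     * qhyp [q powi (- int n), c * x] [] q (d * q ^ n / c)"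

text \<open>The functions \<open>Q\<^sub>n(x;c,d;z\<^sub>-,z\<^sub>+;q)\<close>\<close>

definition Qfun :: "int \<Rightarrow> complex \<Rightarrow> complex \<Rightarrow> complex \<Rightarrow> complex \<Rightarrow> complex \<Rightarrow> complex \<Rightarrow> complex" where
  "Qfun n x c d zm zp q =
     (- d) powi n * q powi (- (n * (n + 1) div 2))
     * (qpoch_inf (c * x) q * (qtheta (d * zm) q * qtheta (d * zp) q)
        / (qpoch_inf (q / (d * x)) q * qpoch_inf (q powi (n + 1) * x / (d * zm * zp)) q))
     * qhyp [q / (c * x)] [d * zm * zp * q powi (- n) / x] q (c * zm * zp * q powi (- n) / x)"


section \<open>Agreement with the literal formulas\<close>

lemma convergent_prod_qpoch:
  assumes "norm q < 1"
  shows "convergent_prod (\<lambda>j. 1 - a * q ^ j :: complex)"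
proof -
  have "summable (\<lambda>j. norm (1 - a * q ^ j - 1))"
    using assms by (simp add: norm_mult norm_power summable_mult summable_geometric)
  then show ?thesis
    by (intro abs_convergent_prod_imp_convergent_prod summable_imp_abs_convergent_prod)
qed

lemma qpoch_inf_split:
  assumes "norm q < 1"
  shows "qpoch_inf a q = qpoch a q n * qpoch_inf (a * q ^ n) q"
proof -
  let ?f = "\<lambda>b j. 1 - b * q ^ j"
  have lim: "(\<lambda>N. \<Prod>j\<le>N. ?f b j) \<longlonglongrightarrow> qpoch_inf b q" for b
    unfolding qpoch_inf_def by (intro convergent_prod_LIMSEQ convergent_prod_qpoch assms)
  have split: "(\<Prod>j\<le>N + n. ?f a j) = qpoch a q n * (\<Prod>j\<le>N. ?f (a * q ^ n) j)" for N
  proof -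
    have "(\<Prod>j\<le>N + n. ?f a j) = (\<Prod>j\<in>{..<n} \<union> {n..N + n}. ?f a j)"
      by (intro prod.cong) auto
    also have "\<dots> = qpoch a q n * (\<Prod>j=n..N + n. ?f a j)"
      unfolding qpoch_def by (subst prod.union_disjoint) auto
    also have "(\<Prod>j=n..N + n. ?f a j) = (\<Prod>j\<le>N. ?f a (j + n))"
      by (intro prod.reindex_bij_witness[of _ "\<lambda>i. i + n" "\<lambda>i. i - n"]) auto
    finally show ?thesis by (simp add: power_add mult_ac)
  qed
  have "(\<lambda>N. \<Prod>j\<le>N + n. ?f a j) \<longlonglongrightarrow> qpoch a q n * qpoch_inf (a * q ^ n) q"
    unfolding split by (intro tendsto_intros lim)
  moreover have "(\<lambda>N. \<Prod>j\<le>N + n. ?f a j) \<longlonglongrightarrow> qpoch_inf a q"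
    by (rule LIMSEQ_ignore_initial_segment[OF lim])
  ultimately show ?thesis by (rule LIMSEQ_unique[symmetric])
qed

lemma qpoch_eq_quotient:
  assumes "norm q < 1" and "qpoch_inf (a * q ^ n) q \<noteq> 0"
  shows "qpoch a q n = qpoch_inf a q / qpoch_inf (a * q ^ n) q"
  using qpoch_inf_split[OF assms(1), of a n] assms(2) by simp

lemma qpoch_split:
  assumes "j \<le> n"
  shows "qpoch a q n = qpoch a q j * qpoch (a * q ^ j) q (n - j)"
proof -
  have "qpoch a q n = (\<Prod>i\<in>{..<j} \<union> {j..<n}. 1 - a * q ^ i)"
    unfolding qpoch_def using assms by (intro prod.cong) auto
  also have "\<dots> = qpoch a q j * (\<Prod>i=j..<n. 1 - a * q ^ i)"
    unfolding qpoch_def by (subst prod.union_disjoint) auto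
  also have "(\<Prod>i=j..<n. 1 - a * q ^ i) = (\<Prod>i<n-j. 1 - a * q ^ (i + j))"
    using assms
    by (intro prod.reindex_bij_witness[of _ "\<lambda>i. i + j" "\<lambda>i. i - j"]) auto
  also have "\<dots> = qpoch (a * q ^ j) q (n - j)"
    unfolding qpoch_def by (simp add: power_add mult_ac)
  finally show ?thesis .
qed

lemma qpoch_terminates:
  assumes "q \<noteq> 0" and "n < j"
  shows "qpoch (q powi (- int n)) q j = 0"
proof -
  have "1 - q powi (- int n) * q ^ n = 0"
    using assms(1) by (simp add: power_int_minus)
  then show ?thesis
    unfolding qpoch_def using assms(2) by (auto intro!: prod_zero)
qed

lemma cdqHahn_eq_qhyp:
  assumes "q \<noteq> 0" and "qpoch (a * b) q n \<noteq> 0" and "qpoch (a * c) q n \<noteq> 0"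
  shows "cdqHahn n x a b c q =
           a powi (- int n) * (qpoch (a * b) q n * qpoch (a * c) q n)
           * qhyp [q powi (- int n), a * x, a / x] [a * b, a * c] q q"
proof -
  let ?f = "\<lambda>j. qpoch (q powi (- int n)) q j * (qpoch (a * x) q j * qpoch (a / x) q j)
              / (qpoch q q j * (qpoch (a * b) q j * qpoch (a * c) q j)) * q ^ j"
  have "qhyp [q powi (- int n), a * x, a / x] [a * b, a * c] q q = (\<Sum>j. ?f j)"
    by (simp add: qhyp_def)
  also have "\<dots> = (\<Sum>j\<le>n. ?f j)"
    by (rule suminf_finite) (auto simp: qpoch_terminates[OF assms(1)])
  finally have eq: "qhyp [q powi (- int n), a * x, a / x] [a * b, a * c] q q = (\<Sum>j\<le>n. ?f j)" .
  show ?thesis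
    unfolding cdqHahn_def eq mult.assoc[of "a powi (- int n)"] sum_distrib_left
  proof (rule sum.cong[OF refl], goal_cases)
    case (1 j)
    then have "j \<le> n" by simp
    from qpoch_split[OF this, of "a * b" q] qpoch_split[OF this, of "a * c" q] assms(2,3)
    show ?case by (simp add: mult_ac)
  qed
qed

lemma bigqLaguerre_norm_eq:
  assumes "q \<noteq> 0" and "qpoch (a * q) q n \<noteq> 0" and "qpoch (b * q) q n \<noteq> 0"
  shows "bigqLaguerre_norm n x a b q =
           qpoch (a * q) q n * qpoch (b * q) q n * bigqLaguerre n x a b q"
proof -
  let ?f = "\<lambda>j. qpoch (q powi (- int n)) q j * qpoch x q j
              / (qpoch q q j * (qpoch (a * q) q j * qpoch (b * q) q j)) * q ^ j"
  have "qpoch 0 q j = 1" for j by (simp add: qpoch_def)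
  then have "bigqLaguerre n x a b q = (\<Sum>j. ?f j)"
    by (simp add: bigqLaguerre_def qhyp_def)
  also have "\<dots> = (\<Sum>j\<le>n. ?f j)"
    by (rule suminf_finite) (auto simp: qpoch_terminates[OF assms(1)])
  finally have eq: "bigqLaguerre n x a b q = (\<Sum>j\<le>n. ?f j)" .
  show ?thesis
    unfolding bigqLaguerre_norm_def eq sum_distrib_left
  proof (rule sum.cong[OF refl], goal_cases)
    case (1 j)
    then have "j \<le> n" by simp
    from qpoch_split[OF this, of "a * q" q] qpoch_split[OF this, of "b * q" q] assms(2,3)
    show ?case by (simp add: mult_ac)
  qed
qed

section \<open>Conventions for the integral identities\<close>

text \<open>Normalisation. The identities are stated with the factors \<open>(q;q)\<^sub>k \<theta>(-s;q)\<close> (first) and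
  \<open>(-1)\<^sup>k (q;q)\<^sub>\<infinity> \<theta>(-s;q)\<close> (second) in front of the right-hand sides; the original formulas
  omit these factors. They are forced by the definitions above: for \<open>m = n = k = 0\<close> the first identity is
  the classical evaluation of the \<open>q\<close>-integral from \<open>a\<close> to \<open>b\<close> of
  \<open>(qy/a,qy/b;q)\<^sub>\<infinity> / (cy,dy;q)\<^sub>\<infinity>\<close> as
  \<open>b(1-q) (q,a/b,qb/a,abcd;q)\<^sub>\<infinity> / (ac,ad,bc,bd;q)\<^sub>\<infinity>\<close>, where for \<open>a = -1\<close>, \<open>b = s\<close> one has
  \<open>b (a/b,qb/a;q)\<^sub>\<infinity> = \<theta>(-s;q)\<close>.

  Nonvanishing denominators. If \<open>x = 1\<close> or \<open>x = -1\<close>, denominators in the integrands can vanish for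
  special \<open>s\<close>, \<open>t\<close>. In the first identity the zeros of the right-hand denominators are also
  zeros of the denominators at the nodes of the integral, so it is enough that the latter are nonzero. In the
  second identity all the denominators (those of \<open>Q\<^sub>k\<close>, including the ones in its series, and of the
  weight, at all the nodes) are nonzero if and only if \<open>\<theta>(d z\<^sub>-, d z\<^sub>+; q) \<noteq> 0\<close>.\<close>

end

theory Submission
  imports Defs "HOL-Complex_Analysis.Complex_Analysis"
begin

text \<open>Put \<open>w\<^sub>i(y) = \<alpha>\<^sup>i p\<^sub>i(\<mu>\<^sub>x; -q/\<alpha>, q/(s\<alpha>), \<alpha>y) (-yq\<^bsup>i+1\<^esup>, yq\<^bsup>i+1\<^esup>/s)\<^sub>\<infinity> / (\<alpha>yx\<^sup>\<plusminus>\<^sup>1)\<^sub>\<infinity>\<close>. A raising relation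
  for the continuous dual \<open>q\<close>-Hahn polynomials says that \<open>w\<^bsub>i+1\<^esub>\<close> is the \<open>q\<close>-derivative of \<open>w\<^sub>i\<close>, so
  both integrands are \<open>w\<^sub>n U\<^sub>m Q\<^sub>k\<close> with a family \<open>Q\<^sub>k\<close> on which the \<open>q\<close>-derivative lowers \<open>k\<close> and, after
  division by \<open>(\<alpha>yx\<^sup>\<plusminus>\<^sup>1)\<^sub>\<infinity>\<close>, raises \<open>k\<close>. Integrating by parts \<open>n\<close> times expresses the integral for
  \<open>(n,m,k)\<close> through those for \<open>(n-1,m,k-1)\<close> and \<open>(n-1,m-1,k)\<close>; the contiguous relation of the big
  \<open>q\<close>-Laguerre polynomials has the same shape. For \<open>n = 0\<close> the raising relation removes \<open>U\<^sub>m\<close>, and what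
  remains is the integral of the weight against \<open>Q\<^bsub>m+k\<^esub>\<close>.

  For \<open>P\<^sub>k\<close> that last integral satisfies the three-term recurrence of the Al-Salam--Chihara polynomials.
  On the lattice \<open>Q\<^sub>k(y) / (\<alpha>yx\<^sup>\<plusminus>\<^sup>1)\<^sub>\<infinity>\<close> is, up to a factor, the constant term in \<open>T\<close> of
  \<open>T\<^bsup>-k\<^esup> \<theta>(-1/T) \<theta>(s/T) / ((y/T)\<^sub>\<infinity> (\<alpha>Tx\<^sup>\<plusminus>\<^sup>1)\<^sub>\<infinity>)\<close>. The lowering relation is the invariance of this
  constant term under \<open>T \<rightarrow> qT\<close>, and integrating in \<open>y\<close> first leaves the generating function of the
  Al-Salam--Chihara polynomials.\<close>

text \<open>The parameter \<open>\<alpha>\<close> is kept free so that both integrals run through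
  the same weight: \<open>\<alpha> = -\<nu> sqrt(q/(st))\<close> gives the first,
  \<open>\<alpha> = sqrt(qt/s)/\<nu>\<close> the second. The induction on \<open>n\<close> ends with
  Laguerre parameters \<open>q^(n-m)\<close> and \<open>-q/(\<alpha>^2 s) q^(n-m)\<close>; the
  choice \<open>\<nu> = -1\<close> or \<open>\<nu> = t\<close> is what makes this pair, in one order
  or the other, the stated one. Vanishing denominators shape the formulation. Polynomial identities
  are proved for the forms with cancelled prefactors, and statements about \<open>Q_k\<close> are
  made at lattice points only, because there the theta functions cancel the poles of the integrand
  in \<open>T\<close>. For \<open>P_k\<close> the index starts at 0, so a three-term recurrence has
  initial values. For \<open>Q_k\<close> the index runs over all integers and a recurrence alone
  determines nothing. The constant term supplies the missing start: it ends as a Taylor coefficient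
  of a function holomorphic at 0, hence is 0 for negative index.\<close>

lemma qpoch_0 [simp]: "qpoch a q 0 = 1"
  by (simp add: qpoch_def)

lemma qpoch_Suc: "qpoch a q (Suc n) = qpoch a q n * (1 - a * q ^ n)"
  by (simp add: qpoch_def)

lemma qpoch_Suc_left: "qpoch a q (Suc n) = (1 - a) * qpoch (a * q) q n"
  using qpoch_split[of 1 "Suc n" a q] by (simp add: qpoch_def)

lemma one_minus_power_neq_0:
  fixes q :: complex
  assumes "norm q < 1"
  shows "1 - q * q ^ n \<noteq> 0"
proof
  assume "1 - q * q ^ n = 0"
  then have "norm q ^ Suc n = 1" by (metis eq_iff_diff_eq_0 norm_one norm_power power_Suc)
  moreover have "norm q ^ Suc n < 1"
    using assms power_Suc_le_self[of "norm q" n] by simp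
  ultimately show False by simp
qed

lemma qpoch_q_neq_0: "norm q < 1 \<Longrightarrow> qpoch q q n \<noteq> 0"
  using one_minus_power_neq_0[of q] by (auto simp: qpoch_def)

text \<open>The coefficient shared by all terminating series here. For nonzero \<open>q\<close> it
  vanishes when \<open>j > n\<close>, so such sums may be extended past their natural end.\<close>

definition qbin_coeff :: "complex \<Rightarrow> nat \<Rightarrow> nat \<Rightarrow> complex" where
  "qbin_coeff q n j = qpoch (q powi (- int n)) q j / qpoch q q j"

lemma qbin_coeff_0 [simp]: "qbin_coeff q n 0 = 1"
  by (simp add: qbin_coeff_def)

lemma qbin_coeff_Suc:
  assumes "norm q < 1" "q \<noteq> 0"
  shows "qbin_coeff q n (Suc j) = qbin_coeff q n j * ((1 - q ^ j / q ^ n) / (1 - q * q ^ j))"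
  using one_minus_power_neq_0[OF assms(1), of j]
  by (simp add: qbin_coeff_def qpoch_Suc power_int_minus field_simps)

lemma qbin_coeff_Suc_Suc:
  assumes "norm q < 1" "q \<noteq> 0"
  shows "qbin_coeff q (Suc n) (Suc j) = qbin_coeff q n j * ((1 - 1 / q ^ Suc n) / (1 - q * q ^ j))"
proof -
  have "q powi (- int (Suc n)) * q = q powi (- int n)"
    using assms unfolding power_int_minus power_int_of_nat by simp
  moreover have "q powi (- int (Suc n)) = 1 / q ^ Suc n"
    unfolding power_int_minus power_int_of_nat by (simp add: divide_inverse)
  ultimately show ?thesis
    unfolding qbin_coeff_def qpoch_Suc_left[of "q powi (- int (Suc n))"] qpoch_Suc[of q]
    by (simp only: times_divide_times_eq mult_ac)
qed

lemma qbin_coeff_Suc_left: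
  assumes "norm q < 1" "q \<noteq> 0" "j \<le> n"
  shows "qbin_coeff q (Suc n) j * (1 - q ^ j / q ^ Suc n) = qbin_coeff q n j * (1 - 1 / q ^ Suc n)"
  using qbin_coeff_Suc[OF assms(1,2), of "Suc n" j] qbin_coeff_Suc_Suc[OF assms(1,2), of n j]
    one_minus_power_neq_0[OF assms(1), of j]
  by simp

section \<open>The contiguous relation of the big q-Laguerre polynomials\<close>

lemma qpoch_shift_down:
  assumes "q \<noteq> 0"
  shows "qpoch (\<xi> / q) q (Suc j) = qpoch \<xi> q (Suc j) / q ^ Suc j + (1 - 1 / q ^ Suc j) * qpoch \<xi> q j"
proof -
  have "qpoch (\<xi> / q) q (Suc j) = (1 - \<xi> / q) * qpoch \<xi> q j"
    using assms by (simp add: qpoch_Suc_left)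
  then show ?thesis
    using assms unfolding qpoch_Suc[of \<xi>] by (simp only:) (simp add: field_simps)
qed

text \<open>Comparison of coefficients in the basis \<open>(\<xi>;q)_j\<close>. All three series
  share the factor \<open>f j\<close>; what remains is an identity of polynomials in
  \<open>q^j\<close> and \<open>q^M\<close>. This is the recursion that integration by parts will
  produce, with \<open>\<xi>\<close> tracking \<open>k\<close> and the common power of
  \<open>q\<close> in \<open>a\<close>, \<open>b\<close> tracking \<open>n - m\<close>.\<close>

lemma bigqLaguerre_norm_contiguous:
  assumes q: "norm q < 1" "q \<noteq> 0"
  shows "bigqLaguerre_norm (Suc m) \<xi> a b q =
     q ^ Suc m * bigqLaguerre_norm (Suc m) (\<xi> / q) (a / q) (b / q) q
     - (1 - q ^ Suc m) * q ^ Suc m * a * b * bigqLaguerre_norm m \<xi> a b q"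
proof -
  define M where "M = Suc m"
  define v where "v = qbin_coeff q M"
  define f where "f = (\<lambda>j. qpoch (a * q ^ Suc j) q (m - j) * qpoch (b * q ^ Suc j) q (m - j))"
  let ?X = "qpoch \<xi> q"
  have up: "qpoch (c * q * q ^ j) q (M - j) = qpoch (c * q ^ Suc j) q (m - j) * (1 - c * q ^ M)"
    if "j \<le> m" for c j
  proof -
    have "q ^ M = q ^ Suc j * q ^ (m - j)"
      using that by (simp add: M_def flip: power_add)
    moreover have "M - j = Suc (m - j)" using that by (simp add: M_def)
    ultimately show ?thesis by (simp add: qpoch_Suc mult_ac)
  qed
  have down: "qpoch (c * q ^ j) q (M - j) = (1 - c * q ^ j) * qpoch (c * q ^ Suc j) q (m - j)"
    if "j \<le> m" for c j
  proof -
    have "M - j = Suc (m - j)" using that by (simp add: M_def)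
    then show ?thesis by (simp add: qpoch_Suc_left mult_ac)
  qed
  have L: "bigqLaguerre_norm M \<xi> a b q =
      (\<Sum>j\<le>m. v j * ?X j * q ^ j * ((1 - a * q ^ M) * (1 - b * q ^ M) * f j)) + v M * ?X M * q ^ M"
  proof -
    have "bigqLaguerre_norm M \<xi> a b q =
       (\<Sum>j\<le>m. v j * ?X j * q ^ j * (qpoch (a * q * q ^ j) q (M - j) * qpoch (b * q * q ^ j) q (M - j)))
         + v M * ?X M * q ^ M"
      by (simp add: bigqLaguerre_norm_def v_def qbin_coeff_def M_def mult_ac)
    also have "(\<Sum>j\<le>m. v j * ?X j * q ^ j * (qpoch (a * q * q ^ j) q (M - j) * qpoch (b * q * q ^ j) q (M - j)))
      = (\<Sum>j\<le>m. v j * ?X j * q ^ j * ((1 - a * q ^ M) * (1 - b * q ^ M) * f j))"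
      by (intro sum.cong refl) (simp add: up f_def)
    finally show ?thesis .
  qed
  have Lm: "bigqLaguerre_norm m \<xi> a b q =
      (\<Sum>j\<le>m. qbin_coeff q m j * ?X j * q ^ j * f j)"
    by (simp add: bigqLaguerre_norm_def qbin_coeff_def f_def mult_ac)
  let ?A = "\<lambda>j. qpoch (a * q ^ j) q (M - j) * qpoch (b * q ^ j) q (M - j)"
  have "bigqLaguerre_norm M (\<xi> / q) (a / q) (b / q) q =
      (\<Sum>j\<le>M. v j * qpoch (\<xi> / q) q j * q ^ j * ?A j)"
    using q by (simp add: bigqLaguerre_norm_def v_def qbin_coeff_def mult_ac)
  also have "\<dots> = ?A 0 + (\<Sum>j\<le>m. v (Suc j) * qpoch (\<xi> / q) q (Suc j) * q ^ Suc j * ?A (Suc j))"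
    unfolding M_def by (subst sum.atMost_Suc_shift) (simp add: v_def)
  \<comment> \<open>Re-expansion of \<open>(\<xi>/q;q)\<close> splits each term in two. The first
    halves join \<open>?A 0\<close> to a full sum over \<open>j \<le> M\<close>; the second halves
    already carry index \<open>j\<close>.\<close>
  also have "(\<Sum>j\<le>m. v (Suc j) * qpoch (\<xi> / q) q (Suc j) * q ^ Suc j * ?A (Suc j)) =
     (\<Sum>j\<le>m. v (Suc j) * ?X (Suc j) * ?A (Suc j) + v (Suc j) * (q ^ Suc j - 1) * ?X j * ?A (Suc j))"
    using q by (intro sum.cong refl) (simp add: qpoch_shift_down field_simps)
  also have "?A 0 + \<dots> = (\<Sum>j\<le>M. v j * ?X j * ?A j)
      + (\<Sum>j\<le>m. v (Suc j) * (q ^ Suc j - 1) * ?X j * ?A (Suc j))"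
    unfolding M_def by (subst sum.atMost_Suc_shift) (simp add: v_def sum.distrib)
  also have "(\<Sum>j\<le>M. v j * ?X j * ?A j) = (\<Sum>j\<le>m. v j * ?X j * ?A j) + v M * ?X M"
    by (simp add: M_def)
  also have "(\<Sum>j\<le>m. v j * ?X j * ?A j) = (\<Sum>j\<le>m. v j * ?X j * ((1 - a * q ^ j) * (1 - b * q ^ j) * f j))"
    by (intro sum.cong refl) (simp add: down f_def)
  also have "(\<Sum>j\<le>m. v (Suc j) * (q ^ Suc j - 1) * ?X j * ?A (Suc j)) =
       (\<Sum>j\<le>m. - v j * (1 - q ^ j / q ^ M) * ?X j * f j)"
  proof (intro sum.cong refl)
    fix j assume "j \<in> {..m}"
    have "v (Suc j) * (q ^ Suc j - 1) = - v j * (1 - q ^ j / q ^ M)"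
      unfolding v_def qbin_coeff_Suc[OF q] using one_minus_power_neq_0[OF q(1), of j]
      by (simp add: divide_simps) (simp add: algebra_simps)
    then show "v (Suc j) * (q ^ Suc j - 1) * ?X j * ?A (Suc j) = - v j * (1 - q ^ j / q ^ M) * ?X j * f j"
      by (simp add: f_def M_def)
  qed
  finally have R: "bigqLaguerre_norm M (\<xi> / q) (a / q) (b / q) q =
     (\<Sum>j\<le>m. v j * ?X j * ((1 - a * q ^ j) * (1 - b * q ^ j) * f j)) + v M * ?X M
     + (\<Sum>j\<le>m. - v j * (1 - q ^ j / q ^ M) * ?X j * f j)" .
  have vm: "(1 - q ^ M) * qbin_coeff q m j = - (v j * (q ^ M - q ^ j))" if "j \<le> m" for j
    using qbin_coeff_Suc_left[OF q that] q unfolding v_def M_def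
    by (simp add: field_simps)
  have "q ^ M * bigqLaguerre_norm M (\<xi> / q) (a / q) (b / q) q
     - (1 - q ^ M) * q ^ M * a * b * bigqLaguerre_norm m \<xi> a b q =
     (\<Sum>j\<le>m. q ^ M * (v j * ?X j * ((1 - a * q ^ j) * (1 - b * q ^ j) * f j))
         + q ^ M * (- v j * (1 - q ^ j / q ^ M) * ?X j * f j)
         - q ^ M * a * b * (((1 - q ^ M) * qbin_coeff q m j) * ?X j * q ^ j * f j)) + v M * ?X M * q ^ M"
    unfolding R Lm by (simp add: sum.distrib sum_subtractf sum_distrib_left algebra_simps)
  also have "(\<Sum>j\<le>m. q ^ M * (v j * ?X j * ((1 - a * q ^ j) * (1 - b * q ^ j) * f j))
         + q ^ M * (- v j * (1 - q ^ j / q ^ M) * ?X j * f j)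
         - q ^ M * a * b * (((1 - q ^ M) * qbin_coeff q m j) * ?X j * q ^ j * f j)) =
     (\<Sum>j\<le>m. v j * ?X j * q ^ j * ((1 - a * q ^ M) * (1 - b * q ^ M) * f j))"
  proof (intro sum.cong refl)
    fix j assume j: "j \<in> {..m}"
    then have vm': "(1 - q ^ M) * qbin_coeff q m j = - (v j * (q ^ M - q ^ j))" by (simp add: vm)
    have e: "q ^ M * (1 - q ^ j / q ^ M) = q ^ M - q ^ j" using q by (simp add: field_simps)
    have "q ^ M * (- v j * (1 - q ^ j / q ^ M) * ?X j * f j) = - v j * (q ^ M - q ^ j) * ?X j * f j"
      unfolding e[symmetric] by (simp add: mult_ac)
    then show "q ^ M * (v j * ?X j * ((1 - a * q ^ j) * (1 - b * q ^ j) * f j))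
         + q ^ M * (- v j * (1 - q ^ j / q ^ M) * ?X j * f j)
         - q ^ M * a * b * (((1 - q ^ M) * qbin_coeff q m j) * ?X j * q ^ j * f j)
       = v j * ?X j * q ^ j * ((1 - a * q ^ M) * (1 - b * q ^ M) * f j)"
      unfolding vm' by (simp only:) (simp add: algebra_simps)
  qed
  finally show ?thesis unfolding L[unfolded M_def] M_def by simp
qed

lemma qbin_coeff_self:
  assumes "norm q < 1" "q \<noteq> 0"
  shows "qbin_coeff q m m * q ^ (m * (m + 1) div 2) = (-1) ^ m"
proof (induction m)
  case (Suc m)
  have e: "Suc m * (Suc m + 1) div 2 = m * (m + 1) div 2 + Suc m"
    by (simp add: algebra_simps)
  show ?case
    unfolding e qbin_coeff_Suc_Suc[OF assms] power_add using Suc assms one_minus_power_neq_0[OF assms(1), of m]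
    by (simp add: divide_simps) (simp add: algebra_simps)
qed simp

text \<open>For \<open>j < m\<close> the product starting at \<open>q^(1-m+j)\<close> contains the
  factor \<open>1 - q^0\<close>, so only the last term survives. This is the case
  \<open>n = 0\<close> of the integrals.\<close>

lemma bigqLaguerre_norm_base:
  assumes "norm q < 1" "q \<noteq> 0"
  shows "bigqLaguerre_norm m \<xi> (q powi (- int m)) b q = qbin_coeff q m m * q ^ m * qpoch \<xi> q m"
proof -
  have "qpoch (q powi (- int m) * q * q ^ j) q (m - j) = 0" if "j < m" for j
  proof -
    have "q powi (- int m) * q * q ^ j = q powi (- int (m - Suc j))"
      using that assms by (simp add: of_nat_diff power_int_diff power_int_minus field_simps power_int_add)
    then show ?thesis using qpoch_terminates[of q "m - Suc j" "m - j"] that assms by simp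
  qed
  then have "bigqLaguerre_norm m \<xi> (q powi (- int m)) b q =
     (\<Sum>j\<le>m. if j = m then qbin_coeff q m m * q ^ m * qpoch \<xi> q m else 0)"
    unfolding bigqLaguerre_norm_def qbin_coeff_def by (intro sum.cong refl) auto
  then show ?thesis by simp
qed

section \<open>Raising, lowering and recurrence for the continuous dual q-Hahn polynomials\<close>

lemma cdqHahn_eq_sum:
  "cdqHahn n x a b c q = a powi (- int n) *
     (\<Sum>j\<le>n. qbin_coeff q n j * q ^ j * (qpoch (a * x) q j * qpoch (a / x) q j)
        * (qpoch (a * b * q ^ j) q (n - j) * qpoch (a * c * q ^ j) q (n - j)))"
  by (simp add: cdqHahn_def qbin_coeff_def mult_ac)

text \<open>The factor \<open>(1 - cx)(1 - c/x)\<close> is rewritten as a combination of \<open>1\<close> and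
  \<open>(1 - axq\<^sup>j)(1 - aq\<^sup>j/x)\<close>, so that both sides can be compared coefficientwise in the basis
  \<open>(ax, a/x; q)\<^sub>j\<close>.\<close>

lemma cdqHahn_raise:
  assumes q: "norm q < 1" "q \<noteq> 0" and "a \<noteq> 0" "x \<noteq> 0"
  shows "cdqHahn n x a b c q * ((1 - a * c * q ^ n) * (1 - b * c * q ^ n))
      - cdqHahn n x a b (c * q) q * ((1 - c * x) * (1 - c / x)) = c * cdqHahn (Suc n) x a b c q"
proof -
  define Z where "Z = (\<lambda>j. qpoch (a * x) q j * qpoch (a / x) q j)"
  define v where "v = qbin_coeff q n"
  define B where "B = (\<lambda>j. qpoch (a * b * q ^ j) q (n - j))"
  define D where "D = (\<lambda>j. qpoch (a * c * q ^ j) q (Suc n - j))"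
  have split: "(1 - c * x) * (1 - c / x) * Z j =
      c / (a * q ^ j) * Z (Suc j) + (1 - c / (a * q ^ j)) * (1 - a * c * q ^ j) * Z j" for j
    using assms unfolding Z_def qpoch_Suc by (simp add: field_simps)
  have D1: "D j = qpoch (a * c * q ^ j) q (n - j) * (1 - a * c * q ^ n)" if "j \<le> n" for j
  proof -
    have "q ^ n = q ^ j * q ^ (n - j)" using that by (simp flip: power_add)
    moreover have "Suc n - j = Suc (n - j)" using that by simp
    ultimately show ?thesis by (simp add: D_def qpoch_Suc mult_ac)
  qed
  have D2: "D j = (1 - a * c * q ^ j) * D (Suc j)" if "j \<le> n" for j
  proof -
    have "Suc n - j = Suc (n - j)" using that by simp
    then show ?thesis by (simp add: D_def qpoch_Suc_left mult_ac)
  qed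
  have p1: "cdqHahn n x a b c q * (1 - a * c * q ^ n) = a powi (- int n) *
      (\<Sum>j\<le>n. v j * q ^ j * Z j * (B j * D j))"
    unfolding cdqHahn_eq_sum mult.assoc[of "a powi (- int n)"] sum_distrib_right v_def B_def Z_def
    by (rule arg_cong2[where f = "(*)"], simp, intro sum.cong refl) (simp add: D1)
  have p2: "cdqHahn n x a b (c * q) q = a powi (- int n) *
      (\<Sum>j\<le>n. v j * q ^ j * Z j * (B j * D (Suc j)))"
    unfolding cdqHahn_eq_sum v_def B_def Z_def D_def
    by (rule arg_cong2[where f = "(*)"], simp, intro sum.cong refl) (simp add: mult_ac)
  have "a ^ n * (cdqHahn n x a b c q * ((1 - a * c * q ^ n) * (1 - b * c * q ^ n))
      - cdqHahn n x a b (c * q) q * ((1 - c * x) * (1 - c / x))) =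
     (\<Sum>j\<le>n. v j * q ^ j * Z j * (B j * D j)) * (1 - b * c * q ^ n)
       - (\<Sum>j\<le>n. v j * q ^ j * (((1 - c * x) * (1 - c / x)) * Z j) * (B j * D (Suc j)))"
  proof -
    have an: "a ^ n * (a powi (- int n) * u) = u" for u
      using assms(3) by (simp add: power_int_minus field_simps)
    have "a ^ n * (cdqHahn n x a b c q * ((1 - a * c * q ^ n) * (1 - b * c * q ^ n))
        - cdqHahn n x a b (c * q) q * ((1 - c * x) * (1 - c / x))) =
      a ^ n * (cdqHahn n x a b c q * (1 - a * c * q ^ n)) * (1 - b * c * q ^ n)
        - a ^ n * cdqHahn n x a b (c * q) q * ((1 - c * x) * (1 - c / x))"
      by (simp add: right_diff_distrib mult.assoc)
    then show ?thesis unfolding p1 p2 an by (simp add: sum_distrib_left sum_distrib_right mult_ac)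
  qed
  also have "\<dots> = (\<Sum>j\<le>n. v j * q ^ j * Z j * (B j * D j) * (1 - b * c * q ^ n)
      - v j * q ^ j * (((1 - c * x) * (1 - c / x)) * Z j) * (B j * D (Suc j)))"
    by (simp add: sum_distrib_right sum_subtractf)
  also have "\<dots> = (\<Sum>j\<le>n. v j * q ^ j * (B j * D j) * Z j * (c / (a * q ^ j) - b * c * q ^ n)
      - v j * q ^ j * (c / (a * q ^ j)) * (B j * D (Suc j)) * Z (Suc j))"
  proof (intro sum.cong refl)
    fix j assume "j \<in> {..n}"
    then have D: "D j = (1 - a * c * q ^ j) * D (Suc j)" by (simp add: D2)
    show "v j * q ^ j * Z j * (B j * D j) * (1 - b * c * q ^ n)
      - v j * q ^ j * (((1 - c * x) * (1 - c / x)) * Z j) * (B j * D (Suc j)) =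
      v j * q ^ j * (B j * D j) * Z j * (c / (a * q ^ j) - b * c * q ^ n)
      - v j * q ^ j * (c / (a * q ^ j)) * (B j * D (Suc j)) * Z (Suc j)"
      unfolding split D by (simp add: algebra_simps)
  qed
  also have "\<dots> = (\<Sum>j\<le>n. v j * q ^ j * (B j * D j) * Z j * (c / (a * q ^ j) - b * c * q ^ n))
      - (\<Sum>j\<le>n. v j * q ^ j * (c / (a * q ^ j)) * (B j * D (Suc j)) * Z (Suc j))"
    by (simp add: sum_subtractf)
  also have "(\<Sum>j\<le>n. v j * q ^ j * (B j * D j) * Z j * (c / (a * q ^ j) - b * c * q ^ n)) =
     B 0 * D 0 * (c / a - b * c * q ^ n) +
     (\<Sum>j\<le>n. v (Suc j) * q ^ Suc j * (B (Suc j) * D (Suc j)) * Z (Suc j) * (c / (a * q ^ Suc j) - b * c * q ^ n))"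
  proof -
    \<comment> \<open>The extra top term is 0, so the sum can be shifted by one and compared with
      the terms in \<open>Z (Suc j)\<close>.\<close>
    have "v (Suc n) = 0"
      unfolding v_def qbin_coeff_def using q(2) by (simp add: qpoch_terminates)
    then have "(\<Sum>j\<le>n. v j * q ^ j * (B j * D j) * Z j * (c / (a * q ^ j) - b * c * q ^ n)) =
       (\<Sum>j\<le>Suc n. v j * q ^ j * (B j * D j) * Z j * (c / (a * q ^ j) - b * c * q ^ n))"
      by simp
    also have "\<dots> = B 0 * D 0 * (c / a - b * c * q ^ n) +
     (\<Sum>j\<le>n. v (Suc j) * q ^ Suc j * (B (Suc j) * D (Suc j)) * Z (Suc j) * (c / (a * q ^ Suc j) - b * c * q ^ n))"
      by (subst sum.atMost_Suc_shift) (simp add: v_def Z_def)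
    finally show ?thesis .
  qed
  also have "\<dots> - (\<Sum>j\<le>n. v j * q ^ j * (c / (a * q ^ j)) * (B j * D (Suc j)) * Z (Suc j))
    = B 0 * D 0 * (c / a - b * c * q ^ n) + (\<Sum>j\<le>n. Z (Suc j) * D (Suc j) *
      (v (Suc j) * q ^ Suc j * B (Suc j) * (c / (a * q ^ Suc j) - b * c * q ^ n) - v j * q ^ j * (c / (a * q ^ j)) * B j))"
    unfolding add_diff_eq[symmetric] sum_subtractf[symmetric]
    by (intro arg_cong2[where f = "(+)"] refl sum.cong) (simp only: right_diff_distrib mult_ac)
  also have "(\<Sum>j\<le>n. Z (Suc j) * D (Suc j) *
      (v (Suc j) * q ^ Suc j * B (Suc j) * (c / (a * q ^ Suc j) - b * c * q ^ n) - v j * q ^ j * (c / (a * q ^ j)) * B j))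
    = (\<Sum>j\<le>n. Z (Suc j) * D (Suc j) * (c / a * (qbin_coeff q (Suc n) (Suc j) * q ^ Suc j
          * qpoch (a * b * q ^ Suc j) q (Suc n - Suc j))))"
  proof (intro sum.cong refl arg_cong2[where f = "(*)"])
    fix j assume j: "j \<in> {..n}"
    have nz: "1 - q * q ^ j \<noteq> 0" by (rule one_minus_power_neq_0[OF q(1)])
    have vS: "v (Suc j) = v j * ((1 - q ^ j / q ^ n) / (1 - q * q ^ j))"
      unfolding v_def by (rule qbin_coeff_Suc[OF q])
    have vSS: "qbin_coeff q (Suc n) (Suc j) = v j * ((1 - 1 / q ^ Suc n) / (1 - q * q ^ j))"
      unfolding v_def by (rule qbin_coeff_Suc_Suc[OF q])
    show "v (Suc j) * q ^ Suc j * B (Suc j) * (c / (a * q ^ Suc j) - b * c * q ^ n) - v j * q ^ j * (c / (a * q ^ j)) * B j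
       = c / a * (qbin_coeff q (Suc n) (Suc j) * q ^ Suc j * qpoch (a * b * q ^ Suc j) q (Suc n - Suc j))"
    \<comment> \<open>For \<open>j = n\<close> truncated subtraction breaks the recursion between
      \<open>B j\<close> and \<open>B (Suc j)\<close>, but then the factor
      \<open>1 - q^j / q^n\<close> of \<open>v (Suc j)\<close> vanishes.\<close>
    proof (cases "j = n")
      case True
      then show ?thesis unfolding vS vSS using assms nz
        by (simp add: B_def divide_simps) (simp add: algebra_simps)
    next
      case False
      with j obtain i where i: "n = Suc (j + i)"
        by (metis atMost_iff le_neq_implies_less less_imp_Suc_add)
      define Y where "Y = B (Suc j)"
      have B1: "B j = (1 - a * b * q ^ j) * Y"
        unfolding Y_def B_def i by (simp add: Suc_diff_le qpoch_Suc_left mult_ac)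
      have B2: "qpoch (a * b * q ^ Suc j) q (Suc n - Suc j) = Y * (1 - a * b * q ^ n)"
        unfolding Y_def B_def i by (simp add: Suc_diff_le qpoch_Suc power_add mult_ac)
      show ?thesis
        unfolding vS vSS B1 B2 Y_def[symmetric] using assms nz
        by (simp add: divide_simps) (simp add: algebra_simps)
    qed
  qed
  also have "B 0 * D 0 * (c / a - b * c * q ^ n) = c / a * (qpoch (a * b) q (Suc n) * D 0)"
    using assms(3) by (simp add: B_def qpoch_Suc field_simps)
  also have "c / a * (qpoch (a * b) q (Suc n) * D 0) + (\<Sum>j\<le>n. Z (Suc j) * D (Suc j) * (c / a * (qbin_coeff q (Suc n) (Suc j) * q ^ Suc j
          * qpoch (a * b * q ^ Suc j) q (Suc n - Suc j)))) =
     c / a * (\<Sum>j\<le>Suc n. qbin_coeff q (Suc n) j * q ^ j * Z j *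
        (qpoch (a * b * q ^ j) q (Suc n - j) * D j))"
    unfolding sum.atMost_Suc_shift by (simp add: Z_def algebra_simps sum_distrib_left)
  also have "\<dots> = a ^ n * (c * cdqHahn (Suc n) x a b c q)"
  proof -
    have "a ^ n * a powi (- int (Suc n)) = 1 / a"
      using assms(3) unfolding power_int_minus power_int_of_nat by (simp add: field_simps)
    then have "a ^ n * (c * (a powi (- int (Suc n)) * S)) = c / a * S" for S
      by (metis (no_types, opaque_lifting) mult.assoc mult.commute mult.right_neutral times_divide_eq_right)
    then show ?thesis unfolding cdqHahn_eq_sum D_def Z_def by simp
  qed
  finally show ?thesis using assms(3) by simp
qed

text \<open>Only the last product in each term depends on \<open>c\<close>. Between \<open>c\<close>
  and \<open>c q\<close> it changes by \<open>a c (q^j - q^(n+1))\<close> times a common factor;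
  this kills the top term and turns the coefficients of degree \<open>n+1\<close> into those of
  degree \<open>n\<close>.\<close>

lemma cdqHahn_lower:
  assumes q: "norm q < 1" "q \<noteq> 0" and "a \<noteq> 0"
  shows "cdqHahn (Suc n) x a b c q = cdqHahn (Suc n) x a b (c * q) q
     - c * (1 - q ^ Suc n) * (1 - a * b * q ^ n) * cdqHahn n x a b (c * q) q"
proof -
  define N where "N = Suc n"
  define Z where "Z = (\<lambda>j. qpoch (a * x) q j * qpoch (a / x) q j)"
  define f where "f = (\<lambda>j. qpoch (a * b * q ^ j) q (N - j))"
  define g where "g = (\<lambda>j. qpoch (a * c * q * q ^ j) q (n - j))"
  define h where "h = (\<lambda>j. qpoch (a * b * q ^ j) q (n - j))"
  have c1: "qpoch (a * c * q ^ j) q (N - j) = (1 - a * c * q ^ j) * g j"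
    and c2: "qpoch (a * (c * q) * q ^ j) q (N - j) = g j * (1 - a * c * q ^ N)"
    and f: "f j = h j * (1 - a * b * q ^ n)" if "j \<le> n" for j
  proof -
    obtain i where i: "n = j + i" using \<open>j \<le> n\<close> le_Suc_ex by blast
    show "qpoch (a * c * q ^ j) q (N - j) = (1 - a * c * q ^ j) * g j"
      unfolding g_def N_def i by (simp add: Suc_diff_le qpoch_Suc_left mult_ac)
    show "qpoch (a * (c * q) * q ^ j) q (N - j) = g j * (1 - a * c * q ^ N)"
      unfolding g_def N_def i by (simp add: Suc_diff_le qpoch_Suc power_add mult_ac)
    show "f j = h j * (1 - a * b * q ^ n)"
      unfolding f_def h_def N_def i by (simp add: Suc_diff_le qpoch_Suc power_add mult_ac)
  qed
  have t: "qbin_coeff q N j * q ^ j * Z j * (f j * qpoch (a * (c * q) * q ^ j) q (N - j))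
      - qbin_coeff q N j * q ^ j * Z j * (f j * qpoch (a * c * q ^ j) q (N - j))
      = a * c * (1 - q ^ N) * (1 - a * b * q ^ n) * (qbin_coeff q n j * q ^ j * Z j * (h j * g j))"
    if "j \<le> n" for j
  proof -
    have "qbin_coeff q N j * (q ^ j - q ^ N) = qbin_coeff q n j * (1 - q ^ N)"
      using qbin_coeff_Suc_left[OF q that] q(2) unfolding N_def
      by (simp add: field_simps)
    then have "q ^ j * Z j * f j * g j * (a * c) * (qbin_coeff q N j * (q ^ j - q ^ N)) =
        q ^ j * Z j * f j * g j * (a * c) * (qbin_coeff q n j * (1 - q ^ N))" by simp
    then show ?thesis unfolding c1[OF that] c2[OF that] f[OF that] by (simp add: algebra_simps)
  qed
  have "(\<Sum>j\<le>N. qbin_coeff q N j * q ^ j * Z j * (f j * qpoch (a * (c * q) * q ^ j) q (N - j)))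
    - (\<Sum>j\<le>N. qbin_coeff q N j * q ^ j * Z j * (f j * qpoch (a * c * q ^ j) q (N - j)))
    = (\<Sum>j\<le>n. qbin_coeff q N j * q ^ j * Z j * (f j * qpoch (a * (c * q) * q ^ j) q (N - j))
        - qbin_coeff q N j * q ^ j * Z j * (f j * qpoch (a * c * q ^ j) q (N - j)))"
    unfolding sum_subtractf[symmetric] by (simp add: N_def)
  also have "\<dots> = a * c * (1 - q ^ N) * (1 - a * b * q ^ n) * (\<Sum>j\<le>n. qbin_coeff q n j * q ^ j * Z j * (h j * g j))"
    unfolding sum_distrib_left by (intro sum.cong refl) (simp add: t)
  finally have "a powi (- int N) * (\<Sum>j\<le>N. qbin_coeff q N j * q ^ j * Z j * (f j * qpoch (a * (c * q) * q ^ j) q (N - j)))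
    - a powi (- int N) * (\<Sum>j\<le>N. qbin_coeff q N j * q ^ j * Z j * (f j * qpoch (a * c * q ^ j) q (N - j)))
    = a powi (- int N) * (a * c * (1 - q ^ N) * (1 - a * b * q ^ n) * (\<Sum>j\<le>n. qbin_coeff q n j * q ^ j * Z j * (h j * g j)))"
    by (simp flip: right_diff_distrib)
  also have "a powi (- int N) * (a * c * (1 - q ^ N) * (1 - a * b * q ^ n) * (\<Sum>j\<le>n. qbin_coeff q n j * q ^ j * Z j * (h j * g j)))
    = c * (1 - q ^ N) * (1 - a * b * q ^ n) * (a powi (- int n) * (\<Sum>j\<le>n. qbin_coeff q n j * q ^ j * Z j * (h j * g j)))"
  proof -
    have "a powi (- int N) * a = a powi (- int n)"
      using assms(3) unfolding power_int_minus power_int_of_nat by (simp add: N_def)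
    then show ?thesis unfolding \<open>a powi (- int N) * a = a powi (- int n)\<close>[symmetric] by (simp only: mult_ac)
  qed
  also have "a powi (- int n) * (\<Sum>j\<le>n. qbin_coeff q n j * q ^ j * Z j * (h j * g j)) = cdqHahn n x a b (c * q) q"
    unfolding cdqHahn_eq_sum Z_def h_def g_def by (simp add: mult_ac)
  moreover have "cdqHahn N x a b d q = a powi (- int N) *
      (\<Sum>j\<le>N. qbin_coeff q N j * q ^ j * Z j * (f j * qpoch (a * d * q ^ j) q (N - j)))" for d
    unfolding cdqHahn_eq_sum Z_def f_def ..
  ultimately have "cdqHahn N x a b (c * q) q - cdqHahn N x a b c q =
      c * (1 - q ^ N) * (1 - a * b * q ^ n) * cdqHahn n x a b (c * q) q"
    by simp
  then show ?thesis unfolding N_def by (simp add: algebra_simps)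
qed

lemma cdqHahn_0 [simp]: "cdqHahn 0 x a b c q = 1"
  by (simp add: cdqHahn_def)

lemma continuous_cdqHahn [continuous_intros]:
  assumes "continuous F c"
  shows "continuous F (\<lambda>t. cdqHahn n x a b (c t) q)"
  unfolding cdqHahn_def qpoch_def by (intro continuous_intros assms)

text \<open>Combining \<open>cdqHahn_raise\<close> and \<open>cdqHahn_lower\<close> requires a division by the third parameter \<open>c\<close>,
  hence the passage to the limit \<open>c \<rightarrow> 0\<close>.\<close>

lemma cdqHahn_recurrence:
  assumes q: "norm q < 1" "q \<noteq> 0" and "a \<noteq> 0" "x \<noteq> 0"
  shows "cdqHahn (Suc (Suc n)) x a b 0 q = (x + 1 / x - (a + b) * q ^ Suc n) * cdqHahn (Suc n) x a b 0 q
     - (1 - q ^ Suc n) * (1 - a * b * q ^ n) * cdqHahn n x a b 0 q"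
    and "cdqHahn (Suc 0) x a b 0 q = x + 1 / x - (a + b)"
proof -
  define p where "p = (\<lambda>n c. cdqHahn n x a b c q)"
  have lim: "((\<lambda>c. p n (f c)) \<longlongrightarrow> p n (f 0)) (at 0)" if "isCont f 0" for n f
  proof -
    have "isCont (\<lambda>c. p n (f c)) 0" unfolding p_def by (intro continuous_intros that)
    then show ?thesis by (simp add: isCont_def)
  qed
  \<comment> \<open>The raising relation divided by \<open>c\<close>, after the lowering relation
    has replaced \<open>p (Suc n) c - p (Suc n) (c q)\<close>. Unlike the quotient, this expression
    is continuous at \<open>c = 0\<close>.\<close>
  define F where "F = (\<lambda>c. - (1 - q ^ Suc n) * (1 - a * b * q ^ n) * p n (c * q) - (a + b) * q ^ Suc n * p (Suc n) c
      + a * b * c * q ^ Suc n * q ^ Suc n * p (Suc n) c + (x + 1 / x) * p (Suc n) (c * q) - c * p (Suc n) (c * q))"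
  have eq: "F c = p (Suc (Suc n)) c" if "c \<noteq> 0" for c
  proof -
    have 1: "p (Suc n) c * ((1 - a * c * q ^ Suc n) * (1 - b * c * q ^ Suc n))
      - p (Suc n) (c * q) * ((1 - c * x) * (1 - c / x)) = c * p (Suc (Suc n)) c"
      unfolding p_def by (rule cdqHahn_raise[OF assms])
    have 2: "p (Suc n) c = p (Suc n) (c * q)
     - c * (1 - q ^ Suc n) * (1 - a * b * q ^ n) * p n (c * q)"
      unfolding p_def by (rule cdqHahn_lower[OF assms(1-3)])
    have 3: "(1 - c * x) * (1 - c / x) = 1 - c * (x + 1 / x) + c * c"
      using assms(4) by (simp add: field_simps)
    have "c * p (Suc (Suc n)) c = (p (Suc n) c - p (Suc n) (c * q)) + c * (F c + (1 - q ^ Suc n) * (1 - a * b * q ^ n) * p n (c * q))"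
      unfolding 1[symmetric] 3 F_def by (simp add: algebra_simps)
    also have "\<dots> = c * F c" unfolding 2 by (simp add: algebra_simps)
    finally show ?thesis using that by simp
  qed
  have "isCont F 0"
    unfolding F_def p_def by (intro continuous_intros)
  then have "(F \<longlongrightarrow> F 0) (at 0)" by (simp add: isCont_def)
  then have "(p (Suc (Suc n)) \<longlongrightarrow> F 0) (at 0)"
    by (rule Lim_transform_eventually) (auto simp: eventually_at eq intro!: exI[of _ 1])
  moreover have "(p (Suc (Suc n)) \<longlongrightarrow> p (Suc (Suc n)) 0) (at 0)" using lim[of "\<lambda>c. c"] by simp
  ultimately have "p (Suc (Suc n)) 0 = F 0" using tendsto_unique trivial_limit_at by blast
  then show "cdqHahn (Suc (Suc n)) x a b 0 q = (x + 1 / x - (a + b) * q ^ Suc n) * cdqHahn (Suc n) x a b 0 q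
     - (1 - q ^ Suc n) * (1 - a * b * q ^ n) * cdqHahn n x a b 0 q"
    by (simp add: F_def p_def algebra_simps)
  have nz: "1 - q \<noteq> 0" using q by auto
  show "cdqHahn (Suc 0) x a b 0 q = x + 1 / x - (a + b)"
    unfolding cdqHahn_def using assms nz
    by (simp add: qpoch_Suc power_int_minus field_simps)
qed

section \<open>Infinite products as entire functions\<close>

lemma qpoch_inf_0 [simp]: "qpoch_inf 0 q = 1"
  by (simp add: qpoch_inf_def)

lemma qpoch_inf_rec: "norm q < 1 \<Longrightarrow> qpoch_inf a q = (1 - a) * qpoch_inf (a * q) q"
  using qpoch_inf_split[of q a 1] by (simp add: qpoch_def)

lemma qpoch_inf_eq_0_iff:
  assumes "norm q < 1"
  shows "qpoch_inf a q = 0 \<longleftrightarrow> (\<exists>j. a * q ^ j = 1)"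
proof -
  have "(\<lambda>j. 1 - a * q ^ j) has_prod qpoch_inf a q"
    unfolding qpoch_inf_def by (intro convergent_prod_has_prod convergent_prod_qpoch assms)
  then have "qpoch_inf a q = 0 \<longleftrightarrow> 0 \<in> range (\<lambda>j. 1 - a * q ^ j)"
    by (rule has_prod_eq_0_iff)
  then show ?thesis by (auto simp: image_iff)
qed

text \<open>On a disc the deviations of the factors from 1 are dominated by a geometric series.
  Local uniformity is what makes the product holomorphic in \<open>a\<close>.\<close>

lemma uniform_limit_qpoch_inf:
  assumes "norm q < 1"
  shows "uniform_limit (cball z r) (\<lambda>n a. \<Prod>j<n. 1 - a * q ^ j) (\<lambda>a. qpoch_inf a q) sequentially"
proof -
  have "uniformly_convergent_on (cball z r) (\<lambda>N a. \<Prod>j<N. 1 - a * q ^ j)"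
  proof (rule uniformly_convergent_on_prod')
    show "uniformly_convergent_on (cball z r) (\<lambda>N a. \<Sum>n<N. norm (1 - a * q ^ n - 1))"
    proof (rule Weierstrass_m_test')
      show "norm (norm (1 - a * q ^ n - 1)) \<le> (norm z + \<bar>r\<bar>) * norm q ^ n" if "a \<in> cball z r" for n a
      proof -
        have "norm a \<le> norm z + \<bar>r\<bar>"
          using that norm_triangle_ineq2[of a z] by (simp add: dist_norm norm_minus_commute)
        then show ?thesis by (simp add: norm_mult norm_power mult_right_mono)
      qed
      show "summable (\<lambda>n. (norm z + \<bar>r\<bar>) * norm q ^ n)"
        using assms by (intro summable_mult summable_geometric) auto
    qed
  qed (auto intro!: continuous_intros)
  then have *: "uniform_limit (cball z r) (\<lambda>n a. \<Prod>j<n. 1 - a * q ^ j)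
      (\<lambda>a. lim (\<lambda>n. \<Prod>j<n. 1 - a * q ^ j)) sequentially"
    using uniformly_convergent_uniform_limit_iff by blast
  have "lim (\<lambda>n. \<Prod>j<n. 1 - a * q ^ j) = qpoch_inf a q" for a
  proof (rule limI)
    have "(\<lambda>N. \<Prod>j\<le>N. 1 - a * q ^ j) \<longlonglongrightarrow> qpoch_inf a q"
      unfolding qpoch_inf_def by (intro convergent_prod_LIMSEQ convergent_prod_qpoch assms)
    then show "(\<lambda>N. \<Prod>j<N. 1 - a * q ^ j) \<longlonglongrightarrow> qpoch_inf a q"
      using LIMSEQ_lessThan_iff_atMost by blast
  qed
  with * show ?thesis by simp
qed

lemma qpoch_tendsto:
  assumes "norm q < 1"
  shows "qpoch a q \<longlonglongrightarrow> qpoch_inf a q"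
  using tendsto_uniform_limitI[OF uniform_limit_qpoch_inf[OF assms, of a 1], of a] unfolding qpoch_def[abs_def] by simp

lemma holomorphic_qpoch_inf:
  assumes "norm q < 1"
  shows "(\<lambda>a. qpoch_inf a q) holomorphic_on A"
proof (rule holomorphic_on_subset[OF _ subset_UNIV], rule holomorphic_uniform_sequence)
  show "\<exists>d>0. cball x d \<subseteq> UNIV \<and> uniform_limit (cball x d) (\<lambda>n a. \<Prod>j<n. 1 - a * q ^ j) (\<lambda>a. qpoch_inf a q) sequentially" for x
    using uniform_limit_qpoch_inf[OF assms, of x 1] by (intro exI[of _ 1]) auto
qed (auto intro!: holomorphic_intros)

lemma holomorphic_qpoch_inf' [holomorphic_intros]:
  assumes "norm q < 1" "f holomorphic_on A"
  shows "(\<lambda>z. qpoch_inf (f z) q) holomorphic_on A"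
  using holomorphic_on_compose[OF assms(2) holomorphic_qpoch_inf[OF assms(1)]] by (simp add: o_def)

lemma isCont_qpoch_inf: "norm q < 1 \<Longrightarrow> isCont (\<lambda>a. qpoch_inf a q) z"
  using holomorphic_on_imp_continuous_on[OF holomorphic_qpoch_inf[of q UNIV]] by (simp add: continuous_on_eq_continuous_at)

lemma continuous_qpoch_inf [continuous_intros]:
  fixes f :: "'a :: t2_space \<Rightarrow> complex"
  assumes "norm q < 1" "continuous F f"
  shows "continuous F (\<lambda>z. qpoch_inf (f z) q)"
  using isCont_tendsto_compose[OF isCont_qpoch_inf[OF assms(1)] assms(2)[unfolded continuous_def]]
  by (simp add: continuous_def)

lemma continuous_on_qpoch_inf [continuous_intros]:
  fixes f :: "'a :: t2_space \<Rightarrow> complex"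
  assumes "norm q < 1" "continuous_on A f"
  shows "continuous_on A (\<lambda>z. qpoch_inf (f z) q)"
  using assms(2) unfolding continuous_on_def
  by (auto intro: isCont_tendsto_compose[OF isCont_qpoch_inf[OF assms(1)]])

text \<open>Iterating \<open>y -> q y\<close> drives \<open>y\<close> to 0. The lemma replaces
  coefficient comparison below: once the defect of an identity is \<open>q\<close>-invariant, the
  identity has to be checked at a single point.\<close>

lemma q_invariant_eq:
  fixes f :: "complex \<Rightarrow> complex"
  assumes "norm q < 1" "isCont f 0" "\<And>y. f (q * y) = f y"
  shows "f y = f 0"
proof -
  have *: "f (q ^ n * y) = f y" for n
    by (induction n) (simp_all add: mult.assoc assms(3))
  have "(\<lambda>n. q ^ n * y) \<longlonglongrightarrow> 0 * y"
    using assms(1) by (intro tendsto_mult LIMSEQ_power_zero tendsto_const)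
  then have "(\<lambda>n. f (q ^ n * y)) \<longlonglongrightarrow> f 0"
    using isCont_tendsto_compose[OF assms(2)] by simp
  then show ?thesis unfolding * by (simp add: LIMSEQ_const_iff)
qed

lemma triangular_Suc: "Suc n * (Suc n - 1) div 2 = n * (n - 1) div 2 + n"
  by (cases n) (auto simp: algebra_simps)

section \<open>Al-Salam--Carlitz polynomials of both kinds\<close>

text \<open>Agrees with \<open>alSalamCarlitz\<close> except at \<open>X = 0\<close>, where the latter has the junk value coming from
  \<open>inverse 0 = 0\<close>.\<close>

definition ascPoly :: "complex \<Rightarrow> complex \<Rightarrow> nat \<Rightarrow> complex \<Rightarrow> complex" where
  "ascPoly q a m X = (- a) ^ m * q ^ (m * (m - 1) div 2)
     * (\<Sum>j\<le>m. qbin_coeff q m j * (q / a) ^ j * (\<Prod>i<j. X - q ^ i))"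

text \<open>The power \<open>X^j\<close> in the argument clears the inverses:
  \<open>X^j (1/X;q)_j\<close> is the product of the \<open>X - q^i\<close>.\<close>

lemma alSalamCarlitz_eq_ascPoly:
  assumes "q \<noteq> 0" "X \<noteq> 0"
  shows "alSalamCarlitz m a X q = ascPoly q a m X"
proof -
  have P: "qpoch (inverse X) q j * X ^ j = (\<Prod>i<j. X - q ^ i)" for j
    by (induction j) (use assms in \<open>simp_all add: qpoch_Suc field_simps\<close>)
  have 0: "qpoch 0 q j = 1" for j by (simp add: qpoch_def)
  have "qhyp [q powi (- int m), inverse X] [0] q (q * X / a) =
     (\<Sum>j. qbin_coeff q m j * (q / a) ^ j * (qpoch (inverse X) q j * X ^ j))"
    unfolding qhyp_def by (intro suminf_cong) (simp add: 0 qbin_coeff_def field_simps power_mult_distrib power_divide)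
  also have "\<dots> = (\<Sum>j\<le>m. qbin_coeff q m j * (q / a) ^ j * (qpoch (inverse X) q j * X ^ j))"
    by (rule suminf_finite) (auto simp: qbin_coeff_def qpoch_terminates[OF assms(1)])
  finally show ?thesis unfolding alSalamCarlitz_def ascPoly_def P by simp
qed

lemma ascPoly_0 [simp]: "ascPoly q a 0 X = 1"
  by (simp add: ascPoly_def)

lemma continuous_ascPoly [continuous_intros]:
  fixes f :: "'a :: t2_space \<Rightarrow> complex"
  assumes "continuous F f"
  shows "continuous F (\<lambda>t. ascPoly q a m (f t))"
  unfolding ascPoly_def by (intro continuous_intros assms)

text \<open>In the basis of products of \<open>X - q^i\<close> the difference between
  \<open>X = q Y\<close> and \<open>X = Y\<close> lowers the degree by one and contributes a factor
  \<open>Y (q^(j+1) - 1)\<close>.\<close>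

lemma ascPoly_lower:
  assumes q: "norm q < 1" "q \<noteq> 0" and "a \<noteq> 0"
  shows "ascPoly q a (Suc m) (q * Y) = ascPoly q a (Suc m) Y - Y * (1 - q ^ Suc m) * ascPoly q a m Y"
proof -
  let ?P = "\<lambda>j X. \<Prod>i<j. X - q ^ i"
  have P: "?P (Suc j) (q * Y) - ?P (Suc j) Y = Y * (q ^ Suc j - 1) * ?P j Y" for j
  proof -
    have "?P (Suc j) (q * Y) = (q * Y - 1) * (\<Prod>i<j. q * Y - q ^ Suc i)"
      by (subst prod.lessThan_Suc_shift) simp
    also have "(\<Prod>i<j. q * Y - q ^ Suc i) = q ^ j * ?P j Y"
      by (induction j) (simp_all add: algebra_simps)
    finally show ?thesis by (simp add: algebra_simps)
  qed
  let ?c = "(- a) ^ m * q ^ (m * (m - 1) div 2)"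
  have "ascPoly q a (Suc m) (q * Y) - ascPoly q a (Suc m) Y =
     (- a) * q ^ m * ?c * (\<Sum>j\<le>Suc m. qbin_coeff q (Suc m) j * (q / a) ^ j * (?P j (q * Y) - ?P j Y))"
    unfolding ascPoly_def triangular_Suc power_add right_diff_distrib sum_subtractf by (simp add: algebra_simps)
  also have "(\<Sum>j\<le>Suc m. qbin_coeff q (Suc m) j * (q / a) ^ j * (?P j (q * Y) - ?P j Y)) =
     (\<Sum>j\<le>m. qbin_coeff q (Suc m) (Suc j) * (q / a) ^ Suc j * (Y * (q ^ Suc j - 1) * ?P j Y))"
    unfolding P[symmetric] by (subst sum.atMost_Suc_shift) simp
  also have "\<dots> = (\<Sum>j\<le>m. Y * (1 / q ^ Suc m - 1) * q / a * (qbin_coeff q m j * (q / a) ^ j * ?P j Y))"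
  proof (intro sum.cong refl)
    fix j
    have "qbin_coeff q (Suc m) (Suc j) * (q ^ Suc j - 1) = qbin_coeff q m j * (1 / q ^ Suc m - 1)"
      unfolding qbin_coeff_Suc_Suc[OF q] using one_minus_power_neq_0[OF q(1), of j]
      by (simp add: divide_simps) (simp add: algebra_simps)
    then have "(qbin_coeff q (Suc m) (Suc j) * (q ^ Suc j - 1)) * ((q / a) ^ Suc j * Y * ?P j Y) =
       (qbin_coeff q m j * (1 / q ^ Suc m - 1)) * ((q / a) ^ Suc j * Y * ?P j Y)" by simp
    then show "qbin_coeff q (Suc m) (Suc j) * (q / a) ^ Suc j * (Y * (q ^ Suc j - 1) * ?P j Y) =
      Y * (1 / q ^ Suc m - 1) * q / a * (qbin_coeff q m j * (q / a) ^ j * ?P j Y)"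
      by (simp add: mult_ac)
  qed
  also have "(- a) * q ^ m * ?c * \<dots> = - Y * (1 - q ^ Suc m) * ascPoly q a m Y"
    unfolding sum_distrib_left[symmetric] ascPoly_def using q assms(3) by (simp add: field_simps)
  finally show ?thesis by (simp add: algebra_simps)
qed

lemma ascPoly_1:
  assumes "q \<noteq> 0" "norm q < 1" "a \<noteq> 0"
  shows "ascPoly q a (Suc 0) X = X - (1 + a)"
proof -
  have "1 - q \<noteq> 0" using assms by auto
  then show ?thesis using assms
    by (simp add: ascPoly_def qbin_coeff_Suc divide_simps) (simp add: algebra_simps)
qed

lemma ascPoly_at_1: "ascPoly q a m 1 = (- a) ^ m * q ^ (m * (m - 1) div 2)"
proof -
  have "(\<Sum>j\<le>m. qbin_coeff q m j * (q / a) ^ j * (\<Prod>i<j. 1 - q ^ i)) = (\<Sum>j\<le>m. if j = 0 then 1 else 0)"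
    by (intro sum.cong refl) (auto intro!: prod_zero bexI[of _ 0])
  then show ?thesis by (simp add: ascPoly_def)
qed

text \<open>By the lowering relation the \<open>q\<close>-difference of the defect \<open>T\<close>
  for \<open>m+1\<close> is a multiple of the defect for \<open>m\<close>. Inductively each defect
  is \<open>q\<close>-invariant, hence constant, and it vanishes at \<open>X = 1\<close>, where only
  the term \<open>j = 0\<close> of each polynomial survives.\<close>

lemma ascPoly_recurrence:
  assumes q: "norm q < 1" "q \<noteq> 0" and a: "a \<noteq> 0"
  shows "ascPoly q a (Suc (Suc m)) X = (X - q ^ Suc m * (1 + a)) * ascPoly q a (Suc m) X
    + a * q ^ m * (1 - q ^ Suc m) * ascPoly q a m X"
proof -
  define T where "T = (\<lambda>m X. ascPoly q a (Suc (Suc m)) X - (X - q ^ Suc m * (1 + a)) * ascPoly q a (Suc m) X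
    - a * q ^ m * (1 - q ^ Suc m) * ascPoly q a m X)"
  have "T m X = 0" for X
  proof (induction m arbitrary: X)
    case 0
    have inv: "T 0 (q * Y) = T 0 Y" for Y
      unfolding T_def ascPoly_lower[OF assms] ascPoly_0 ascPoly_1[OF q(2,1) a]
      by (simp add: algebra_simps)
    have "T 0 X = T 0 0" "T 0 1 = T 0 0"
      by (rule q_invariant_eq[where f = "T 0", OF q(1) _ inv]; unfold T_def; intro continuous_intros)+
    moreover have "T 0 1 = 0"
      unfolding T_def ascPoly_at_1 by (simp add: algebra_simps triangular_Suc numeral_2_eq_2)
    ultimately show ?case by simp
  next
    case (Suc m)
    have inv: "T (Suc m) (q * Y) = T (Suc m) Y" for Y
    proof -
      have "T (Suc m) (q * Y) - T (Suc m) Y = - q * Y * (1 - q ^ Suc (Suc m)) * T m Y"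
        unfolding T_def ascPoly_lower[OF assms] by (simp add: algebra_simps)
      then show ?thesis using Suc.IH[of Y] by simp
    qed
    have "T (Suc m) X = T (Suc m) 0" "T (Suc m) 1 = T (Suc m) 0"
      by (rule q_invariant_eq[where f = "T (Suc m)", OF q(1) _ inv]; unfold T_def; intro continuous_intros)+
    moreover have "T (Suc m) 1 = 0"
      unfolding T_def ascPoly_at_1 triangular_Suc power_add by (simp add: algebra_simps)
    ultimately show ?case by simp
  qed
  from this[of X] show ?thesis unfolding T_def by (simp add: algebra_simps)
qed

text \<open>Lowering relation and recurrence eliminate the values at \<open>q Y\<close>; the
  recurrence needs two lower degrees, so \<open>m = 0\<close> is separate. With
  \<open>a = -s\<close> and \<open>Y = -y/q\<close> the factor \<open>(1 - qY)(1 - qY/a)\<close> is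
  the quotient \<open>W (y/q) / W y\<close>, so the weight times the next polynomial is a
  \<open>q\<close>-difference.\<close>

lemma ascPoly_raise:
  assumes q: "norm q < 1" "q \<noteq> 0" and a: "a \<noteq> 0"
  shows "q * Y * ascPoly q a (Suc m) (q * Y) =
    - a * q ^ m * (ascPoly q a m (q * Y) - (1 - q * Y) * (1 - q * Y / a) * ascPoly q a m Y)"
proof (cases m)
  case 0
  then show ?thesis unfolding 0 ascPoly_0 ascPoly_1[OF q(2,1) a] using a by (simp add: field_simps)
next
  case (Suc n)
  show ?thesis
    unfolding Suc ascPoly_lower[OF assms] ascPoly_recurrence[OF assms]
    using a by (simp add: field_simps)
qed

text \<open>The Gaussian binomial coefficient, expressed through \<open>qbin_coeff\<close> so that
  its recursions can be reused.\<close>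

definition qbinom :: "complex \<Rightarrow> nat \<Rightarrow> nat \<Rightarrow> complex" where
  "qbinom q k j = qbin_coeff q k j * (-1) ^ j * q ^ (k * j) / q ^ (j * (j - 1) div 2)"

lemma qbinom_Suc_Suc:
  assumes q: "norm q < 1" "q \<noteq> 0"
  shows "qbinom q (Suc k) (Suc j) * (1 - q ^ Suc j) = (1 - q ^ Suc k) * qbinom q k j"
proof -
  have "qbin_coeff q (Suc k) (Suc j) * (1 - q ^ Suc j) = qbin_coeff q k j * (1 - 1 / q ^ Suc k)"
    unfolding qbin_coeff_Suc_Suc[OF q] using one_minus_power_neq_0[OF q(1), of j] by simp
  then have "(qbin_coeff q (Suc k) (Suc j) * (1 - q ^ Suc j)) * ((-1) ^ Suc j * q ^ (Suc k * Suc j) / q ^ (Suc j * (Suc j - 1) div 2)) =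
     (qbin_coeff q k j * (1 - 1 / q ^ Suc k)) * ((-1) ^ Suc j * q ^ (Suc k * Suc j) / q ^ (Suc j * (Suc j - 1) div 2))"
    by simp
  also have "\<dots> = (1 - q ^ Suc k) * qbinom q k j"
  proof -
    have e: "q ^ (Suc k * Suc j) = q ^ (k * j) * q ^ k * q ^ j * q"
      by (simp add: power_add)
    show ?thesis unfolding qbinom_def e triangular_Suc power_add using q by (simp add: divide_simps) (simp add: algebra_simps)
  qed
  finally show ?thesis unfolding qbinom_def by (simp add: mult_ac)
qed

text \<open>The polynomial \<open>(-1)\<^sup>k q\<^bsup>k(k-1)/2\<^esup> P\<^sub>k(y;c,d;q)\<close>, which is symmetric in \<open>c\<close> and \<open>d\<close>.\<close>

definition asc2Poly :: "complex \<Rightarrow> complex \<Rightarrow> complex \<Rightarrow> nat \<Rightarrow> complex \<Rightarrow> complex" where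
  "asc2Poly q c d k y = (\<Sum>j\<le>k. qbinom q k j * c ^ (k - j) * d ^ j * qpoch (c * y) q j)"

lemma alSalamCarlitz2_eq_asc2Poly:
  assumes "q \<noteq> 0" "c \<noteq> 0"
  shows "alSalamCarlitz2 k y c d q = (-1) ^ k * asc2Poly q c d k y / q ^ (k * (k - 1) div 2)"
proof -
  have "qhyp [q powi (- int k), c * y] [] q (d * q ^ k / c) =
     (\<Sum>j. qbinom q k j * (d / c) ^ j * qpoch (c * y) q j)"
    unfolding qhyp_def by (intro suminf_cong)
      (simp add: qbinom_def qbin_coeff_def power_int_minus uminus_power_if divide_inverse mult_ac power_mult_distrib flip: power_mult)
  also have "\<dots> = (\<Sum>j\<le>k. qbinom q k j * (d / c) ^ j * qpoch (c * y) q j)"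
    by (rule suminf_finite) (auto simp: qbinom_def qbin_coeff_def qpoch_terminates[OF assms(1)])
  finally have e: "qhyp [q powi (- int k), c * y] [] q (d * q ^ k / c) =
     (\<Sum>j\<le>k. qbinom q k j * (d / c) ^ j * qpoch (c * y) q j)" .
  have "c ^ k * (\<Sum>j\<le>k. qbinom q k j * (d / c) ^ j * qpoch (c * y) q j) = asc2Poly q c d k y"
    unfolding asc2Poly_def sum_distrib_left
  proof (intro sum.cong refl)
    fix j assume "j \<in> {..k}"
    then have "c ^ k = c ^ (k - j) * c ^ j" by (simp flip: power_add)
    then show "c ^ k * (qbinom q k j * (d / c) ^ j * qpoch (c * y) q j) =
        qbinom q k j * c ^ (k - j) * d ^ j * qpoch (c * y) q j"
      using assms by (simp add: power_divide)
  qed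
  then show ?thesis
    unfolding alSalamCarlitz2_def e unfolding power_minus[of c] power_int_minus power_int_of_nat
    by (simp add: divide_inverse mult_ac)
qed

lemma asc2Poly_0 [simp]: "asc2Poly q c d 0 y = 1"
  by (simp add: asc2Poly_def qbinom_def)

lemma continuous_asc2Poly [continuous_intros]:
  fixes f :: "'a :: t2_space \<Rightarrow> complex"
  assumes "continuous F f"
  shows "continuous F (\<lambda>t. asc2Poly q c d k (f t))"
  unfolding asc2Poly_def qpoch_def by (intro continuous_intros assms)

lemma asc2Poly_1:
  assumes "q \<noteq> 0" "norm q < 1"
  shows "asc2Poly q c d (Suc 0) y = c + d - c * d * y"
proof -
  have "qbinom q (Suc 0) (Suc 0) = 1"
  proof -
    have "1 - q \<noteq> 0" using assms by auto
    moreover have "qbinom q (Suc 0) (Suc 0) * (1 - q) = 1 - q"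
      using qbinom_Suc_Suc[OF assms(2,1), of 0 0] by (simp add: qbinom_def[of _ 0])
    ultimately show ?thesis by simp
  qed
  then show ?thesis
    by (simp add: asc2Poly_def qbinom_def[of q _ 0] qpoch_Suc algebra_simps)
qed

lemma asc2Poly_lower:
  assumes q: "norm q < 1" "q \<noteq> 0"
  shows "asc2Poly q c d (Suc k) y = asc2Poly q c d (Suc k) (q * y)
     - c * d * y * (1 - q ^ Suc k) * asc2Poly q c d k (q * y)"
proof -
  have P: "qpoch (c * (q * y)) q (Suc j) - qpoch (c * y) q (Suc j) = qpoch (c * (q * y)) q j * (c * y) * (1 - q ^ Suc j)" for j
    unfolding qpoch_Suc_left[of "c * y"] qpoch_Suc[of "c * (q * y)"] by (simp add: algebra_simps)
  have "asc2Poly q c d (Suc k) (q * y) - asc2Poly q c d (Suc k) y =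
     (\<Sum>j\<le>Suc k. qbinom q (Suc k) j * c ^ (Suc k - j) * d ^ j * (qpoch (c * (q * y)) q j - qpoch (c * y) q j))"
    by (simp add: asc2Poly_def right_diff_distrib sum_subtractf)
  also have "\<dots> = (\<Sum>j\<le>k. qbinom q (Suc k) (Suc j) * c ^ (k - j) * d ^ Suc j * (qpoch (c * (q * y)) q j * (c * y) * (1 - q ^ Suc j)))"
    unfolding P[symmetric] by (subst sum.atMost_Suc_shift) simp
  also have "\<dots> = (\<Sum>j\<le>k. c * d * y * (1 - q ^ Suc k) * (qbinom q k j * c ^ (k - j) * d ^ j * qpoch (c * (q * y)) q j))"
  proof (intro sum.cong refl)
    fix j
    have "(qbinom q (Suc k) (Suc j) * (1 - q ^ Suc j)) * (c ^ (k - j) * d ^ Suc j * (qpoch (c * (q * y)) q j * (c * y))) =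
       ((1 - q ^ Suc k) * qbinom q k j) * (c ^ (k - j) * d ^ Suc j * (qpoch (c * (q * y)) q j * (c * y)))"
      unfolding qbinom_Suc_Suc[OF q] ..
    then show "qbinom q (Suc k) (Suc j) * c ^ (k - j) * d ^ Suc j * (qpoch (c * (q * y)) q j * (c * y) * (1 - q ^ Suc j)) =
       c * d * y * (1 - q ^ Suc k) * (qbinom q k j * c ^ (k - j) * d ^ j * qpoch (c * (q * y)) q j)"
      by (simp add: mult_ac)
  qed
  finally show ?thesis by (simp add: asc2Poly_def sum_distrib_left algebra_simps)
qed

text \<open>Same argument as for the first kind: the defects have \<open>q\<close>-differences
  proportional to the preceding defect. The point of evaluation is now \<open>1/c\<close>, where all
  terms with \<open>j > 0\<close> vanish and the polynomial equals \<open>c^k\<close>.\<close>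

lemma asc2Poly_recurrence:
  assumes q: "norm q < 1" "q \<noteq> 0" and c: "c \<noteq> 0"
  shows "asc2Poly q c d (Suc (Suc k)) y = (c + d - c * d * y * q ^ Suc k) * asc2Poly q c d (Suc k) y
     - c * d * (1 - q ^ Suc k) * asc2Poly q c d k y"
proof -
  define T where "T = (\<lambda>k y. asc2Poly q c d (Suc (Suc k)) y - (c + d - c * d * y * q ^ Suc k) * asc2Poly q c d (Suc k) y
     + c * d * (1 - q ^ Suc k) * asc2Poly q c d k y)"
  have at: "asc2Poly q c d k (1 / c) = c ^ k" for k
  proof -
    have "asc2Poly q c d k (1 / c) = (\<Sum>j\<le>k. if j = 0 then c ^ k else 0)"
      unfolding asc2Poly_def
    proof (intro sum.cong refl)
      fix j
      have "j \<noteq> 0 \<Longrightarrow> qpoch 1 q j = 0" by (cases j) (simp_all add: qpoch_Suc_left)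
      then show "qbinom q k j * c ^ (k - j) * d ^ j * qpoch (c * (1 / c)) q j = (if j = 0 then c ^ k else 0)"
        using c by (simp add: qbinom_def)
    qed
    then show ?thesis by simp
  qed
  have zero: "T k (1 / c) = 0" for k
    unfolding T_def at using c by (simp add: algebra_simps)
  have "T k y = 0" for y
  proof (induction k arbitrary: y)
    case 0
    have inv: "T 0 (q * y) = T 0 y" for y
      unfolding T_def asc2Poly_lower[OF q, of _ _ _ y] asc2Poly_0 asc2Poly_1[OF q(2,1)]
      by (simp add: algebra_simps)
    have "T 0 y = T 0 0" "T 0 (1 / c) = T 0 0"
      by (rule q_invariant_eq[where f = "T 0", OF q(1) _ inv]; unfold T_def; intro continuous_intros)+
    then show ?case using zero by simp
  next
    case (Suc k)
    have inv: "T (Suc k) (q * y) = T (Suc k) y" for y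
    proof -
      have "T (Suc k) (q * y) - T (Suc k) y = c * d * y * (1 - q ^ Suc (Suc k)) * T k (q * y)"
        unfolding T_def asc2Poly_lower[OF q, of _ _ _ y] by (simp add: algebra_simps)
      then show ?thesis using Suc.IH[of "q * y"] by simp
    qed
    have "T (Suc k) y = T (Suc k) 0" "T (Suc k) (1 / c) = T (Suc k) 0"
      by (rule q_invariant_eq[where f = "T (Suc k)", OF q(1) _ inv]; unfold T_def; intro continuous_intros)+
    then show ?case using zero by simp
  qed
  from this[of y] show ?thesis unfolding T_def by (simp add: algebra_simps)
qed

lemma asc2Poly_raise:
  assumes q: "norm q < 1" "q \<noteq> 0" and c: "c \<noteq> 0"
  shows "asc2Poly q c d k y - (1 - c * y) * (1 - d * y) * asc2Poly q c d k (q * y) = y * asc2Poly q c d (Suc k) y"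
proof (cases k)
  case 0
  then show ?thesis unfolding 0 asc2Poly_0 asc2Poly_1[OF q(2,1)] by (simp add: algebra_simps)
next
  case (Suc n)
  show ?thesis
    unfolding Suc asc2Poly_lower[OF q, of _ _ _ y] asc2Poly_recurrence[OF assms, of _ _ "q * y"]
    by (simp add: algebra_simps)
qed

section \<open>Jackson integrals over a two-sided \<open>q\<close>-lattice\<close>

locale q_lattice =
  fixes q s :: complex
  assumes q: "norm q < 1" "q \<noteq> 0" and s: "s \<noteq> 0"
begin

definition node :: "complex \<Rightarrow> nat \<Rightarrow> nat \<Rightarrow> complex" where
  "node z N j = z * q ^ j / q ^ N"

text \<open>Limits are taken along the lattice only, because \<open>Q_k\<close> is not controlled
  elsewhere, and with one value \<open>L\<close> for both half-lattices. Starting at level 0 loses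
  nothing: level \<open>N\<close> adds finitely many nodes.\<close>

definition limit0 :: "(complex \<Rightarrow> complex) \<Rightarrow> complex \<Rightarrow> bool" where
  "limit0 f L \<longleftrightarrow> (\<forall>z\<in>{-1, s}. (\<lambda>j. f (node z 0 j)) \<longlonglongrightarrow> L)"

definition regular :: "(complex \<Rightarrow> complex) \<Rightarrow> bool" where
  "regular f \<longleftrightarrow> (\<exists>L. limit0 f L)"

definition J :: "nat \<Rightarrow> (complex \<Rightarrow> complex) \<Rightarrow> complex" where
  "J N f = jackson f (node (-1) N 0) (node s N 0) q"

lemma node_nonzero: "z \<in> {-1, s} \<Longrightarrow> node z N j \<noteq> 0"
  using q s by (auto simp: node_def)

lemma q_node: "q * node z N j = node z N (Suc j)"
  by (simp add: node_def)

lemma node_Suc_Suc: "node z (Suc N) (Suc j) = node z N j"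
  using q by (simp add: node_def)

lemma node_div: "node z N j / q = node z (Suc N) j"
  using q by (simp add: node_def)

lemma node_plus: "node z N (j + N) = node z 0 j"
  using q by (simp add: node_def power_add)

lemma limit0_node:
  assumes "limit0 f L" "z \<in> {-1, s}"
  shows "(\<lambda>j. f (node z N j)) \<longlonglongrightarrow> L"
  by (rule LIMSEQ_offset[where k = N]) (use assms in \<open>auto simp: node_plus limit0_def\<close>)

lemma node_tendsto_0: "(\<lambda>j. node z N j) \<longlonglongrightarrow> 0"
proof -
  have "(\<lambda>j. z * q ^ j / q ^ N) \<longlonglongrightarrow> z * 0 / q ^ N"
    using q by (intro tendsto_intros LIMSEQ_power_zero) auto
  then show ?thesis by (simp add: node_def)
qed

lemma isCont_limit0: "isCont f 0 \<Longrightarrow> limit0 f (f 0)"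
  unfolding limit0_def using isCont_tendsto_compose node_tendsto_0 by blast

lemma isCont_regular: "isCont f 0 \<Longrightarrow> regular f"
  unfolding regular_def using isCont_limit0 by blast

lemma regular_mult: "regular f \<Longrightarrow> regular g \<Longrightarrow> regular (\<lambda>y. f y * g y)"
  unfolding regular_def limit0_def using tendsto_mult by blast

lemma regular_add: "regular f \<Longrightarrow> regular g \<Longrightarrow> regular (\<lambda>y. f y + g y)"
  unfolding regular_def limit0_def using tendsto_add by blast

lemma regular_const: "regular (\<lambda>y. c)"
  by (intro isCont_regular continuous_intros)

lemma regular_cong:
  assumes "regular f" "\<And>z j. z \<in> {-1, s} \<Longrightarrow> f (node z 0 j) = g (node z 0 j)"
  shows "regular g"
  using assms unfolding regular_def limit0_def by auto

lemma summable_node: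
  assumes "regular f" "z \<in> {-1, s}"
  shows "summable (\<lambda>j. f (node z N j) * node z N j)"
proof -
  obtain L where "limit0 f L" using assms by (auto simp: regular_def)
  then have "(\<lambda>j. f (node z N j)) \<longlonglongrightarrow> L" using assms(2) by (rule limit0_node)
  then have "Bseq (\<lambda>j. f (node z N j))" by (intro convergent_imp_Bseq convergentI)
  then obtain K where K: "\<And>j. norm (f (node z N j)) \<le> K" by (auto simp: Bseq_def)
  show ?thesis
  proof (rule summable_comparison_test')
    show "summable (\<lambda>j. K * norm (z / q ^ N) * norm q ^ j)"
      using q by (intro summable_mult summable_geometric) auto
    show "norm (f (node z N j) * node z N j) \<le> K * norm (z / q ^ N) * norm q ^ j" for j
      using mult_right_mono[OF K[of j], of "norm (z / q ^ N) * norm q ^ j"]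
      by (simp add: node_def norm_mult norm_divide norm_power mult_ac)
  qed
qed

lemma J_eq: "J N f = (1 - q) * ((\<Sum>j. f (node s N j) * node s N j) - (\<Sum>j. f (node (-1) N j) * node (-1) N j))"
proof -
  have "node z N 0 * q ^ j = node z N j" for z j by (simp add: node_def)
  then show ?thesis by (simp add: J_def jackson_def jackson0_def right_diff_distrib)
qed

lemma J_cong:
  assumes "\<And>z j. z \<in> {-1, s} \<Longrightarrow> f (node z N j) = g (node z N j)"
  shows "J N f = J N g"
  unfolding J_eq using assms by simp

lemma J_add:
  assumes "regular f" "regular g"
  shows "J N (\<lambda>y. f y + g y) = J N f + J N g"
  using summable_node[OF assms(1), of _ N] summable_node[OF assms(2), of _ N]
  unfolding J_eq by (simp add: distrib_right suminf_add[symmetric] algebra_simps)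

lemma J_mult:
  assumes "regular f"
  shows "J N (\<lambda>y. c * f y) = c * J N f"
  using summable_node[OF assms(1), of _ N]
  unfolding J_eq mult.assoc by (simp add: suminf_mult algebra_simps)

lemma J_Suc_q: "J (Suc N) (\<lambda>y. q * f (q * y)) = J N f"
  unfolding J_eq q_node node_Suc_Suc
  by (simp add: mult.assoc q_node node_Suc_Suc mult.left_commute[of q])

text \<open>A weight vanishing at the outermost nodes allows the lattice to be prolonged for free,
  so that \<open>J_by_parts\<close>, which costs one layer, can be used even at level 0.\<close>

lemma J_Suc_zero:
  assumes "regular f" "\<And>z. z \<in> {-1, s} \<Longrightarrow> f (node z (Suc N) 0) = 0"
  shows "J (Suc N) f = J N f"
proof -
  have "(\<Sum>j. f (node z (Suc N) j) * node z (Suc N) j) = (\<Sum>j. f (node z N j) * node z N j)" if "z \<in> {-1, s}" for z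
    using suminf_split_head[OF summable_node[OF assms(1) that, of "Suc N"]] assms(2)[OF that]
    by (simp add: node_Suc_Suc)
  then show ?thesis unfolding J_eq by simp
qed

text \<open>The boundary terms at \<open>0\<close> of the two half-lattices cancel because \<open>w\<close> and \<open>g\<close> have the same
  limit at \<open>0\<close> on both.\<close>

lemma J_by_parts':
  assumes "regular w" "regular g" and reg: "regular (\<lambda>y. (w y - w (q * y)) / y * g y)"
    and "\<And>z. z \<in> {-1, s} \<Longrightarrow> w (node z N 0) * g (node z N 0) = 0"
  shows "J N (\<lambda>y. (w y - w (q * y)) / y * g y) = J N (\<lambda>y. w (q * y) * (g (q * y) - g y) / y)"
proof -
  obtain L1 L2 where L: "limit0 w L1" "limit0 g L2" using assms by (auto simp: regular_def)
  have *: "(\<Sum>j. w (q * node z N j) * (g (q * node z N j) - g (node z N j)) / node z N j * node z N j)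
     = (\<Sum>j. (w (node z N j) - w (q * node z N j)) / node z N j * g (node z N j) * node z N j) + L1 * L2"
    if z: "z \<in> {-1, s}" for z
  proof -
    let ?a = "\<lambda>j. w (node z N j)" and ?b = "\<lambda>j. g (node z N j)"
    let ?t = "\<lambda>j. (w (node z N j) - w (q * node z N j)) / node z N j * g (node z N j) * node z N j"
    have "?t sums suminf ?t"
      using summable_node[OF reg z, of N] by (simp add: summable_sums)
    moreover have "(\<lambda>j. ?a (Suc j) * ?b (Suc j) - ?a j * ?b j) sums (L1 * L2 - ?a 0 * ?b 0)"
      by (intro telescope_sums tendsto_mult limit0_node[OF _ z] L)
    ultimately have "(\<lambda>j. ?t j + (?a (Suc j) * ?b (Suc j) - ?a j * ?b j)) sums (suminf ?t + (L1 * L2 - 0))"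
      using assms(4)[OF z] by (intro sums_add) auto
    also have "(\<lambda>j. ?t j + (?a (Suc j) * ?b (Suc j) - ?a j * ?b j)) =
      (\<lambda>j. w (q * node z N j) * (g (q * node z N j) - g (node z N j)) / node z N j * node z N j)"
      using node_nonzero[OF z, of N] by (simp add: q_node fun_eq_iff) (simp add: algebra_simps)
    finally show ?thesis by (simp add: sums_iff)
  qed
  show ?thesis unfolding J_eq by (subst (1 2) *) auto
qed

text \<open>\<open>J_by_parts'\<close> followed by the substitution \<open>q y -> y\<close>, which
  moves the integral to the lattice with one layer less and turns the forward difference of
  \<open>g\<close> into a backward one.\<close>

lemma J_by_parts:
  assumes "regular w" "regular g" and reg: "regular (\<lambda>y. (w y - w (q * y)) / y * g y)"
    and "\<And>z. z \<in> {-1, s} \<Longrightarrow> w (node z (Suc N) 0) * g (node z (Suc N) 0) = 0"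
  shows "J (Suc N) (\<lambda>y. (w y - w (q * y)) / y * g y) = J N (\<lambda>y. w y * ((g y - g (y / q)) / y))"
proof -
  have "J (Suc N) (\<lambda>y. (w y - w (q * y)) / y * g y) = J (Suc N) (\<lambda>y. w (q * y) * (g (q * y) - g y) / y)"
    by (rule J_by_parts'[OF assms])
  also have "\<dots> = J (Suc N) (\<lambda>y. q * (w (q * y) * ((g (q * y) - g (q * y / q)) / (q * y))))"
    using q node_nonzero by (intro J_cong) auto
  also have "\<dots> = J N (\<lambda>y. w y * ((g y - g (y / q)) / y))"
    by (rule J_Suc_q)
  finally show ?thesis .
qed

definition W :: "complex \<Rightarrow> complex" where
  "W y = qpoch_inf (- q * y) q * qpoch_inf (q * y / s) q"

definition E :: "complex \<Rightarrow> complex \<Rightarrow> complex \<Rightarrow> complex" where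
  "E c d y = 1 / (qpoch_inf (c * y) q * qpoch_inf (d * y) q)"

definition admissible :: "nat \<Rightarrow> complex \<Rightarrow> bool" where
  "admissible N c \<longleftrightarrow> (\<forall>z\<in>{-1, s}. \<forall>j. qpoch_inf (c * node z N j) q \<noteq> 0)"

lemma isCont_W: "isCont W y"
  unfolding W_def by (intro continuous_intros q s)

lemma isCont_E: "isCont (E c d) 0"
  unfolding E_def by (intro continuous_intros q) auto

lemma W_div:
  assumes "z \<in> {-1, s}"
  shows "W (y / q) = (1 + y) * (1 - y / s) * W y"
proof -
  have "W (y / q) = qpoch_inf (- y) q * qpoch_inf (y / s) q"
    using q by (simp add: W_def)
  then show ?thesis
    using qpoch_inf_rec[OF q(1), of "- y"] qpoch_inf_rec[OF q(1), of "y / s"] by (simp add: W_def mult_ac)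
qed

lemma W_node_0: "z \<in> {-1, s} \<Longrightarrow> W (node z (Suc 0) 0) = 0"
  using q s qpoch_inf_rec[OF q(1), of 1] by (auto simp: W_def node_def)

lemma E_q:
  assumes "qpoch_inf (c * y) q \<noteq> 0" "qpoch_inf (d * y) q \<noteq> 0"
  shows "E c d (q * y) = (1 - c * y) * (1 - d * y) * E c d y"
proof -
  have "qpoch_inf (c * y) q = (1 - c * y) * qpoch_inf (c * (q * y)) q" for c
    using qpoch_inf_rec[OF q(1), of "c * y"] by (simp add: mult_ac)
  with assms show ?thesis by (simp add: E_def)
qed

lemma admissible_q: "admissible N c \<Longrightarrow> admissible N (c * q)"
  unfolding admissible_def by (simp add: mult.assoc q_node)

lemma admissible_0: "admissible N 0"
  by (simp add: admissible_def)

text \<open>The \<open>q\<close>-derivative of \<open>W (y/q) E c d y\<close> is the weight times a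
  linear polynomial, and its integral vanishes; this expresses the first moment by the zeroth. Since
  passing from \<open>c\<close> to \<open>c q\<close> multiplies the weight by
  \<open>1 - c y\<close>, a contiguous relation in \<open>c\<close> follows.\<close>

lemma J_W_E_shift:
  assumes "admissible 0 c" "admissible 0 d"
  shows "(1 + c * d * s) * J 0 (\<lambda>y. W y * E (c * q) d y) = (1 + c) * (1 - c * s) * J 0 (\<lambda>y. W y * E c d y)"
proof -
  define V where "V = (\<lambda>y. W (y / q) * E c d y)"
  define w where "w = (\<lambda>y. W y * E c d y)"
  have cw: "isCont w 0" unfolding w_def by (intro continuous_intros isCont_W isCont_E)
  have contW: "isCont (\<lambda>y. W (y / q)) 0"
    unfolding W_def by (intro continuous_intros q s)
  have cV: "isCont V 0" unfolding V_def by (intro continuous_intros isCont_E contW)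
  have Veq: "(V y - V (q * y)) / y * 1 = (1 - 1 / s + c + d) * w y - (1 / s + c * d) * (y * w y)"
    if y: "z \<in> {-1, s}" "y = node z 0 j" for z j y
  proof -
    have nz: "y \<noteq> 0" "qpoch_inf (c * y) q \<noteq> 0" "qpoch_inf (d * y) q \<noteq> 0"
      using y assms node_nonzero[OF y(1)] by (auto simp: admissible_def)
    have e1: "V y = (1 + y) * (1 - y / s) * w y"
      using W_div[OF y(1), of y] by (simp add: V_def w_def)
    have e2: "V (q * y) = (1 - c * y) * (1 - d * y) * w y"
      unfolding V_def w_def E_q[OF nz(2,3)] using q by simp
    show ?thesis unfolding e1 e2 using nz(1) s by (simp add: field_simps)
  qed
  have rw: "regular (\<lambda>y. w y)" "regular (\<lambda>y. y * w y)"
    by (intro isCont_regular continuous_intros cw)+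
  have rr: "regular (\<lambda>y. (1 - 1 / s + c + d) * w y)" "regular (\<lambda>y. (- (1 / s + c * d)) * (y * w y))"
    by (intro isCont_regular continuous_intros cw)+
  have r: "regular (\<lambda>y. (1 - 1 / s + c + d) * w y + (- (1 / s + c * d)) * (y * w y))"
    by (intro isCont_regular continuous_intros cw)
  have "J 0 (\<lambda>y. (1 - 1 / s + c + d) * w y + (- (1 / s + c * d)) * (y * w y)) = J 0 (\<lambda>y. (V y - V (q * y)) / y * 1)"
    by (intro J_cong) (simp only: Veq, simp add: algebra_simps)
  also have "\<dots> = J 0 (\<lambda>y. V (q * y) * (1 - 1) / y)"
  proof (rule J_by_parts')
    show "regular (\<lambda>y. (V y - V (q * y)) / y * 1)"
      by (rule regular_cong[OF r]) (simp only: Veq, simp add: algebra_simps)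
    show "V (node z 0 0) * 1 = 0" if "z \<in> {-1, s}" for z
      using W_node_0[OF that] node_div[of z 0 0] by (simp add: V_def)
  qed (intro isCont_regular cV continuous_intros)+
  also have "\<dots> = 0" by (simp add: J_eq)
  finally have M: "(1 - 1 / s + c + d) * J 0 w = (1 / s + c * d) * J 0 (\<lambda>y. y * w y)"
    unfolding J_add[OF rr] unfolding J_mult[OF rw(1)] J_mult[OF rw(2)] by (simp add: algebra_simps)
  have "J 0 (\<lambda>y. W y * E (c * q) d y) = J 0 (\<lambda>y. w y + (- c) * (y * w y))"
  proof (rule J_cong)
    fix z j assume "z \<in> {-1, s}"
    then have nz: "qpoch_inf (c * node z 0 j) q \<noteq> 0" using assms by (auto simp: admissible_def)
    have rec: "qpoch_inf (c * node z 0 j) q = (1 - c * node z 0 j) * qpoch_inf (c * q * node z 0 j) q"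
      using qpoch_inf_rec[OF q(1), of "c * node z 0 j"] by (simp add: mult_ac)
    have Eq: "E (c * q) d (node z 0 j) = (1 - c * node z 0 j) * E c d (node z 0 j)"
      using nz unfolding E_def rec by simp
    show "W (node z 0 j) * E (c * q) d (node z 0 j) = w (node z 0 j) + (- c) * (node z 0 j * w (node z 0 j))"
      unfolding w_def Eq by (simp add: algebra_simps)
  qed
  also have "\<dots> = J 0 w - c * J 0 (\<lambda>y. y * w y)"
  proof -
    have "regular (\<lambda>y. (- c) * (y * w y))" by (intro regular_mult[OF regular_const] rw)
    from J_add[OF rw(1) this] show ?thesis unfolding J_mult[OF rw(2)] by simp
  qed
  finally have e: "J 0 (\<lambda>y. W y * E (c * q) d y) = J 0 w - c * J 0 (\<lambda>y. y * w y)" .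
  have "(1 + c * d * s) * J 0 (\<lambda>y. W y * E (c * q) d y) =
      (1 + c * d * s) * J 0 w - c * s * ((1 / s + c * d) * J 0 (\<lambda>y. y * w y))"
    unfolding e using s by (simp add: field_simps)
  also have "\<dots> = (1 + c) * (1 - c * s) * J 0 w"
    unfolding M[symmetric] using s by (simp add: field_simps)
  finally show ?thesis by (simp add: w_def)
qed

text \<open>Dominated convergence. Replacing \<open>c\<close> by \<open>c q^n\<close> at node
  \<open>j\<close> is the same as keeping \<open>c\<close> and moving to node \<open>j + n\<close>,
  so a single bound for the reciprocal product along the lattice serves all
  \<open>n\<close>.\<close>

lemma J_W_E_tendsto:
  assumes "admissible 0 c"
  shows "(\<lambda>n. J 0 (\<lambda>y. W y * E (c * q ^ n) d y)) \<longlonglongrightarrow> J 0 (\<lambda>y. W y * E 0 d y)"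
proof -
  have "(\<lambda>n. \<Sum>j. W (node z 0 j) * E (c * q ^ n) d (node z 0 j) * node z 0 j)
      \<longlonglongrightarrow> (\<Sum>j. W (node z 0 j) * E 0 d (node z 0 j) * node z 0 j)" if z: "z \<in> {-1, s}" for z
  proof -
    define g where "g = (\<lambda>j. W (node z 0 j) * E 0 d (node z 0 j) * node z 0 j)"
    have "(\<lambda>k. 1 / qpoch_inf (c * node z 0 k) q) \<longlonglongrightarrow> 1 / qpoch_inf (c * 0) q"
      using node_tendsto_0 q by (intro tendsto_intros isCont_tendsto_compose[OF isCont_qpoch_inf]) auto
    then have "Bseq (\<lambda>k. 1 / qpoch_inf (c * node z 0 k) q)" by (intro convergent_imp_Bseq convergentI)
    then obtain M where M: "\<And>k. norm (1 / qpoch_inf (c * node z 0 k) q) \<le> M" by (auto simp: Bseq_def)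
    have eq: "W (node z 0 j) * E (c * q ^ n) d (node z 0 j) * node z 0 j = g j * (1 / qpoch_inf (c * node z 0 (j + n)) q)" for n j
      by (simp add: g_def E_def node_def power_add mult_ac)
    have sm: "summable (\<lambda>j. norm (g j))"
    proof -
      obtain K where K: "\<And>j. norm (W (node z 0 j) * E 0 d (node z 0 j)) \<le> K"
      proof -
        have "(\<lambda>j. W (node z 0 j) * E 0 d (node z 0 j)) \<longlonglongrightarrow> W 0 * E 0 d 0"
          by (intro tendsto_mult isCont_tendsto_compose[OF isCont_W] isCont_tendsto_compose[OF isCont_E] node_tendsto_0)
        then have "Bseq (\<lambda>j. W (node z 0 j) * E 0 d (node z 0 j))" by (intro convergent_imp_Bseq convergentI)
        then show ?thesis using that by (auto simp: Bseq_def)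
      qed
      show ?thesis
      proof (rule summable_comparison_test')
        show "summable (\<lambda>j. K * norm z * norm q ^ j)"
          using q by (intro summable_mult summable_geometric) auto
        show "norm (norm (g j)) \<le> K * norm z * norm q ^ j" for j
          using mult_right_mono[OF K[of j], of "norm z * norm q ^ j"]
          by (simp add: g_def node_def norm_mult norm_power mult_ac)
      qed
    qed
    show ?thesis
      unfolding eq g_def[symmetric]
    proof (rule tannerys_theorem[where M = "\<lambda>j. norm (g j) * M", THEN conjunct2, THEN conjunct2])
      show "((\<lambda>n. g j * (1 / qpoch_inf (c * node z 0 (j + n)) q)) \<longlongrightarrow> g j) sequentially" for j
      proof -
        have "(\<lambda>n. node z 0 (j + n)) \<longlonglongrightarrow> 0"
          using LIMSEQ_ignore_initial_segment[OF node_tendsto_0, of z 0 j] by (simp add: add.commute)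
        then have "(\<lambda>n. g j * (1 / qpoch_inf (c * node z 0 (j + n)) q)) \<longlonglongrightarrow> g j * (1 / qpoch_inf (c * 0) q)"
          using q by (intro tendsto_intros isCont_tendsto_compose[OF isCont_qpoch_inf]) auto
        then show ?thesis by simp
      qed
      have "norm (g j * (1 / qpoch_inf (c * node z 0 (j + n)) q)) \<le> norm (g j) * M" for j n
        unfolding norm_mult by (intro mult_left_mono M) auto
      then show "\<forall>\<^sub>F (j, n) in at_top \<times>\<^sub>F sequentially. norm (g j * (1 / qpoch_inf (c * node z 0 (j + n)) q)) \<le> norm (g j) * M"
        by (intro always_eventually) auto
      show "summable (\<lambda>j. norm (g j) * M)" using sm by (rule summable_mult2)
    qed simp
  qed
  then show ?thesis unfolding J_eq by (intro tendsto_intros) auto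
qed

text \<open>Iterating the contiguous relation sends \<open>c\<close> to 0, while the accumulated
  factors tend to the infinite products.\<close>

lemma J_W_E_to_0:
  assumes "admissible 0 c" "admissible 0 d"
  shows "qpoch_inf (- c * d * s) q * J 0 (\<lambda>y. W y * E 0 d y) =
     qpoch_inf (- c) q * qpoch_inf (c * s) q * J 0 (\<lambda>y. W y * E c d y)"
proof (rule LIMSEQ_unique)
  have adm: "admissible 0 (c * q ^ n)" for n
    by (induction n) (use assms admissible_q[of 0 "c * q ^ _"] in \<open>auto simp: mult_ac\<close>)
  have "qpoch (- c * d * s) q n * J 0 (\<lambda>y. W y * E (c * q ^ n) d y) =
     qpoch (- c) q n * qpoch (c * s) q n * J 0 (\<lambda>y. W y * E c d y)" for n
  proof (induction n)
    case (Suc n)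
    have "qpoch (- c * d * s) q (Suc n) * J 0 (\<lambda>y. W y * E (c * q ^ Suc n) d y) =
       qpoch (- c * d * s) q n * ((1 + (c * q ^ n) * d * s) * J 0 (\<lambda>y. W y * E ((c * q ^ n) * q) d y))"
      by (simp add: qpoch_Suc mult_ac)
    also have "\<dots> = ((1 + c * q ^ n) * (1 - c * q ^ n * s)) * (qpoch (- c * d * s) q n * J 0 (\<lambda>y. W y * E (c * q ^ n) d y))"
      unfolding J_W_E_shift[OF adm assms(2)] by (simp add: mult_ac)
    also have "\<dots> = qpoch (- c) q (Suc n) * qpoch (c * s) q (Suc n) * J 0 (\<lambda>y. W y * E c d y)"
      unfolding Suc.IH by (simp add: qpoch_Suc mult_ac)
    finally show ?case .
  qed simp
  then show "(\<lambda>n. qpoch (- c * d * s) q n * J 0 (\<lambda>y. W y * E (c * q ^ n) d y)) \<longlonglongrightarrow>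
     qpoch_inf (- c) q * qpoch_inf (c * s) q * J 0 (\<lambda>y. W y * E c d y)"
    by (simp only:) (intro tendsto_intros qpoch_tendsto[OF q(1)])
  show "(\<lambda>n. qpoch (- c * d * s) q n * J 0 (\<lambda>y. W y * E (c * q ^ n) d y)) \<longlonglongrightarrow>
     qpoch_inf (- c * d * s) q * J 0 (\<lambda>y. W y * E 0 d y)"
    by (intro tendsto_intros qpoch_tendsto[OF q(1)] J_W_E_tendsto assms)
qed

lemma E_commute: "E c d = E d c"
  by (simp add: E_def fun_eq_iff mult.commute)

text \<open>For \<open>c = -q\<close> one factor of the weight cancels and the remaining series telescope.\<close>

lemma J_W:
  assumes "qtheta (- s) q \<noteq> 0"
  shows "J 0 W = (1 - q) * qpoch_inf q q * qtheta (- s) q"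
proof -
  have tel: "(\<lambda>j. q ^ j * a * qpoch_inf (a * q ^ Suc j) q) sums (1 - qpoch_inf a q)" for a
  proof -
    have "(\<lambda>j. a * q ^ j) \<longlonglongrightarrow> a * 0"
      using q by (intro tendsto_intros LIMSEQ_power_zero) auto
    then have "(\<lambda>j. qpoch_inf (a * q ^ j) q) \<longlonglongrightarrow> qpoch_inf (a * 0) q"
      by (intro isCont_tendsto_compose[OF isCont_qpoch_inf] q)
    from telescope_sums[OF this]
    have "(\<lambda>j. qpoch_inf (a * q ^ Suc j) q - qpoch_inf (a * q ^ j) q) sums (1 - qpoch_inf a q)" by simp
    moreover have "qpoch_inf (a * q ^ Suc j) q - qpoch_inf (a * q ^ j) q = q ^ j * a * qpoch_inf (a * q ^ Suc j) q" for j
      using qpoch_inf_rec[OF q(1), of "a * q ^ j"] by (simp add: algebra_simps)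
    ultimately show ?thesis by simp
  qed
  have nz: "qpoch_inf (- s) q \<noteq> 0" using assms by (auto simp: qtheta_def)
  have adm: "admissible 0 (- q)"
    unfolding admissible_def
  proof (intro ballI allI)
    fix z j assume "z \<in> {-1, s}"
    moreover have "qpoch_inf (q * q ^ j) q \<noteq> 0"
    proof -
      have "1 - q * q ^ (j + i) \<noteq> 0" for i by (rule one_minus_power_neq_0[OF q(1)])
      then show ?thesis unfolding qpoch_inf_eq_0_iff[OF q(1)] by (auto simp: power_add mult.assoc)
    qed
    moreover have "qpoch_inf (- s * q ^ Suc j) q \<noteq> 0"
      using nz qpoch_inf_split[OF q(1), of "- s" "Suc j"] by auto
    ultimately show "qpoch_inf (- q * node z 0 j) q \<noteq> 0" by (auto simp: node_def mult_ac)
  qed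
  have one: "qpoch_inf 1 q = 0" using qpoch_inf_rec[OF q(1), of 1] by simp
  have "J 0 (\<lambda>y. W y * E (- q) 0 y) = J 0 (\<lambda>y. qpoch_inf (q * y / s) q)"
    using adm by (intro J_cong) (auto simp: W_def E_def admissible_def)
  also have "\<dots> = (1 - q) * (s * (\<Sum>j. q ^ j * 1 * qpoch_inf (1 * q ^ Suc j) q)
       - s * (\<Sum>j. q ^ j * (- 1 / s) * qpoch_inf ((- 1 / s) * q ^ Suc j) q))"
    unfolding suminf_mult[OF sums_summable[OF tel], symmetric] J_eq node_def using s by (simp add: mult_ac)
  also have "\<dots> = (1 - q) * (s * qpoch_inf (- 1 / s) q)"
    unfolding sums_unique[OF tel, symmetric] by (simp add: one algebra_simps)
  also have "s * qpoch_inf (- 1 / s) q = (1 + s) * qpoch_inf (q / (- s)) q"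
    using qpoch_inf_rec[OF q(1), of "- 1 / s"] s by (simp add: field_simps)
  finally have 1: "J 0 (\<lambda>y. W y * E (- q) 0 y) = (1 - q) * ((1 + s) * qpoch_inf (q / (- s)) q)" .
  have "J 0 W = J 0 (\<lambda>y. W y * E 0 0 y)" by (simp add: E_def)
  also have "\<dots> = qpoch_inf q q * qpoch_inf (- q * s) q * J 0 (\<lambda>y. W y * E (- q) 0 y)"
    using J_W_E_to_0[OF adm admissible_0] by simp
  also have "\<dots> = (1 - q) * qpoch_inf q q * qtheta (- s) q"
    unfolding 1 qtheta_def using qpoch_inf_rec[OF q(1), of "- s"] by (simp add: mult_ac)
  finally show ?thesis .
qed

text \<open>Two uses of \<open>J_W_E_to_0\<close> remove first \<open>c\<close>, then
  \<open>d\<close>, and leave the pure weight integral \<open>J_W\<close>.\<close>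

lemma J_W_E:
  assumes "qtheta (- s) q \<noteq> 0" "admissible 0 c" "admissible 0 d"
  shows "J 0 (\<lambda>y. W y * E c d y) = (1 - q) * qpoch_inf q q * qtheta (- s) q * qpoch_inf (- c * d * s) q /
     (qpoch_inf (- c) q * qpoch_inf (c * s) q * (qpoch_inf (- d) q * qpoch_inf (d * s) q))"
proof -
  have nz: "qpoch_inf (- c) q \<noteq> 0 \<and> qpoch_inf (c * s) q \<noteq> 0" if "admissible 0 c" for c
    using that unfolding admissible_def by (auto simp: node_def dest: spec[of _ 0])
  have "J 0 W = J 0 (\<lambda>y. W y * E 0 0 y)" by (simp add: E_def)
  also have "\<dots> = qpoch_inf (- d) q * qpoch_inf (d * s) q * J 0 (\<lambda>y. W y * E 0 d y)"
    using J_W_E_to_0[OF assms(3) admissible_0] unfolding E_commute[of 0 d] by simp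
  finally have "J 0 (\<lambda>y. W y * E 0 d y) = (1 - q) * qpoch_inf q q * qtheta (- s) q / (qpoch_inf (- d) q * qpoch_inf (d * s) q)"
    unfolding J_W[OF assms(1)] using nz[OF assms(3)] by (simp add: nonzero_eq_divide_eq mult_ac)
  then have "(1 - q) * qpoch_inf q q * qtheta (- s) q * qpoch_inf (- c * d * s) q /
      (qpoch_inf (- d) q * qpoch_inf (d * s) q) = qpoch_inf (- c * d * s) q * J 0 (\<lambda>y. W y * E 0 d y)"
    by simp
  then show ?thesis
    unfolding J_W_E_to_0[OF assms(2,3)] using nz[OF assms(2)] nz[OF assms(3)]
    by (simp add: nonzero_eq_divide_eq nonzero_divide_eq_eq mult_ac)
qed

end

section \<open>Integration by parts along a ladder of functions\<close>

text \<open>Both families of the theorem fit this pattern: \<open>P\<^sub>k\<close> with \<open>S = {0..}\<close>, \<open>A = cd\<close>, \<open>B = 1\<close>,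
  \<open>\<rho> = 1\<close>, and \<open>Q\<^sub>k\<close> with \<open>S = UNIV\<close>, \<open>A = -1/s\<close>, \<open>B = -cds/q\<close>, \<open>\<rho> = q\<close>. The function \<open>w i\<close> is the
  \<open>i\<close>-fold \<open>q\<close>-derivative of the weight.\<close>

locale ladder = q_lattice +
  fixes n :: nat and w :: "nat \<Rightarrow> complex \<Rightarrow> complex" and Q :: "int \<Rightarrow> complex \<Rightarrow> complex"
    and S :: "int set" and c d A B \<rho> :: complex and \<Gamma> F :: "int \<Rightarrow> complex"
    and Lam :: "nat \<Rightarrow> nat \<Rightarrow> int \<Rightarrow> complex"
  defines "Lam \<equiv> \<lambda>i m k. bigqLaguerre_norm m (q powi (k + 1) / B) (q powi (int i - int m))
      (- q / (\<rho> * A * B * s) * q powi (int i - int m)) q"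
  assumes regular_w: "\<And>i. i \<le> n \<Longrightarrow> regular (w i)"
    and w_Suc: "\<And>i z j. i < n \<Longrightarrow> z \<in> {-1, s} \<Longrightarrow>
      w (Suc i) (node z (Suc i) j) = (w i (node z (Suc i) j) - w i (node z i j)) / node z (Suc i) j"
    and w_zero: "\<And>i z. i < n \<Longrightarrow> z \<in> {-1, s} \<Longrightarrow> w i (node z (Suc i) 0) = 0"
    and w_0: "\<And>z j. z \<in> {-1, s} \<Longrightarrow> w 0 (node z 0 j) = W (node z 0 j) * E c d (node z 0 j)"
    and regular_Q: "\<And>k. k \<in> S \<Longrightarrow> regular (Q k)"
    and lower: "\<And>k i z j. k \<in> S \<Longrightarrow> i < n \<Longrightarrow> z \<in> {-1, s} \<Longrightarrow> Q k (node z i j) - Q k (node z (Suc i) j)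
      = A * (1 - B * q powi (- k)) * (node z i j * Q (k - 1) (node z i j))"
    and raise: "\<And>k z j. k \<in> S \<Longrightarrow> z \<in> {-1, s} \<Longrightarrow>
      Q k (node z 0 j) * E c d (node z 0 j) - Q k (node z 0 (Suc j)) * E c d (node z 0 (Suc j))
      = - \<rho> * q powi k * (node z 0 j * (Q (k + 1) (node z 0 j) * E c d (node z 0 j)))"
    and S_Suc: "\<And>k. k \<in> S \<Longrightarrow> k + 1 \<in> S"
    and S_pred: "\<And>k. k \<in> S \<Longrightarrow> k - 1 \<in> S \<or>
      A * (1 - B * q powi (- k)) = 0 \<and> (\<forall>i m. Lam i m (k - 1) * F (int m + k - 1 - int i) = 0)"
    and nonzero: "A \<noteq> 0" "B \<noteq> 0" "\<rho> \<noteq> 0"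
    and Gam_Suc: "\<And>k. k \<in> S \<Longrightarrow> \<Gamma> (k + 1) = \<Gamma> k * (1 - q powi (k + 1) / B)"
    and integral: "\<And>k. k \<in> S \<Longrightarrow> J 0 (\<lambda>y. W y * E c d y * Q k y) = \<Gamma> k * F k"
begin

lemma q_powi_add: "q powi (a + b) = q powi a * q powi b"
  using q by (simp add: power_int_add)

definition X :: "nat \<Rightarrow> nat \<Rightarrow> int \<Rightarrow> complex" where
  "X i m k = J i (\<lambda>y. w i y * (ascPoly q (- s) m (- y * q ^ i) * Q k y))"

text \<open>The terms free of \<open>i\<close> collect the powers from the \<open>m\<close> raising
  steps at level 0 and compensate the normalisation of \<open>Lam\<close> there; those in
  \<open>i\<close> are forced by \<open>T_recurrence\<close>.\<close>

definition expo :: "nat \<Rightarrow> nat \<Rightarrow> int \<Rightarrow> int" where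
  "expo i m k = int m * (int m + k - 1) + int (m * (m - 1) div 2) - 2 * int m * int i - k * int i
     + int (i * (i - 1) div 2)"

definition T :: "nat \<Rightarrow> nat \<Rightarrow> int \<Rightarrow> complex" where
  "T i m k = (- s * \<rho>) ^ m * (- A * B) ^ i * q powi (expo i m k) * Lam i m k * F (int m + k - int i)"

text \<open>The contiguous relation with \<open>\<xi> = q^(k+1)/B\<close>: lowering \<open>k\<close>
  divides \<open>\<xi>\<close> by \<open>q\<close>, and lowering \<open>i\<close> divides both
  parameters by \<open>q\<close>. The rest is bookkeeping of exponents.\<close>

lemma T_recurrence:
  "T (Suc i) m k = - A * B * q powi (- k) * T i m (k - 1) + q ^ i * (1 - q ^ m) * T i (m - 1) k"
proof (cases m)
  case 0
  have "expo (Suc i) 0 k = expo i 0 (k - 1) + - k"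
    unfolding expo_def triangular_Suc by (simp add: algebra_simps)
  then have "q powi (expo (Suc i) 0 k) = q powi (expo i 0 (k - 1)) * q powi (- k)"
    by (simp only: q_powi_add)
  moreover have "Lam i 0 k = 1" for i k
    by (simp add: Lam_def bigqLaguerre_norm_def)
  moreover have f: "int 0 + k - int (Suc i) = int 0 + (k - 1) - int i" by simp
  ultimately show ?thesis unfolding 0 T_def f by (simp add: mult_ac)
next
  case (Suc m')
  define a where "a = q powi (int i - int m')"
  define b where "b = - q / (\<rho> * A * B * s) * a"
  have a_q: "q powi (int i - int m) = a / q"
  proof -
    have "int i - int m = (int i - int m') + - 1" by (simp add: Suc)
    then show ?thesis by (simp only: q_powi_add a_def power_int_minus1_right divide_inverse)
  qed
  have k_q: "q powi k / B = q powi (k + 1) / B / q"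
    using q by (simp add: power_int_add)
  have L1: "Lam (Suc i) m k = bigqLaguerre_norm (Suc m') (q powi (k + 1) / B) a b q"
    unfolding Lam_def a_def b_def Suc by simp
  have L2: "Lam i m (k - 1) = bigqLaguerre_norm (Suc m') (q powi (k + 1) / B / q) (a / q) (b / q) q"
    unfolding Lam_def b_def a_q k_q[symmetric] unfolding Suc by simp
  have L3: "Lam i m' k = bigqLaguerre_norm m' (q powi (k + 1) / B) a b q"
    unfolding Lam_def a_def b_def by simp
  have L: "Lam (Suc i) m k = q ^ m * Lam i m (k - 1) - (1 - q ^ m) * q ^ m * a * b * Lam i m' k"
    unfolding L1 L2 L3 unfolding Suc by (rule bigqLaguerre_norm_contiguous[OF q])
  have "expo (Suc i) m k + int m = expo i m (k - 1) + - k"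
    unfolding expo_def triangular_Suc by (simp add: algebra_simps)
  then have "q powi (expo (Suc i) m k + int m) = q powi (expo i m (k - 1) + - k)" by simp
  then have e1: "q powi (expo (Suc i) m k) * q ^ m = q powi (expo i m (k - 1)) * q powi (- k)"
    by (simp only: q_powi_add power_int_of_nat)
  have "expo (Suc i) m k + int m + (int i - int m') + (int i - int m') + 1 = expo i m' k + int i"
    unfolding expo_def triangular_Suc Suc by (simp add: algebra_simps)
  then have "q powi (expo (Suc i) m k + int m + (int i - int m') + (int i - int m') + 1) = q powi (expo i m' k + int i)" by (rule arg_cong)
  then have e2: "q powi (expo (Suc i) m k) * q ^ m * a * a * q = q powi (expo i m' k) * q ^ i"
    unfolding a_def by (simp only: q_powi_add power_int_of_nat power_int_1_right)
  have f1: "int m + k - int (Suc i) = int m + (k - 1) - int i"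
    and f2: "int m' + k - int i = int m + (k - 1) - int i" by (simp_all add: Suc)
  define G where "G = F (int m + (k - 1) - int i)"
  define u where "u = (- s * \<rho>) ^ m'"
  define v where "v = (- A * B) ^ i"
  have su: "(- s * \<rho>) ^ m = - s * \<rho> * u" by (simp add: Suc u_def)
  have sv: "(- A * B) ^ Suc i = - A * B * v" by (simp add: v_def)
  \<comment> \<open>The constant \<open>-q/(\<rho> A B s)\<close> in \<open>Lam\<close> is fixed by
    this line: the product \<open>a b\<close> of the contiguous relation has to cancel the prefactor
    up to a power of \<open>q\<close>.\<close>
  have ab: "s * \<rho> * A * B * (a * b) = - (a * a * q)"
    unfolding b_def using nonzero s by (simp add: field_simps)
  have "T (Suc i) m k = - s * \<rho> * u * (- A * B * v) * G * (q powi (expo (Suc i) m k) * q ^ m) * Lam i m (k - 1)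
      + u * v * G * (1 - q ^ m) * (q powi (expo (Suc i) m k) * q ^ m * (- (s * \<rho> * A * B * (a * b)))) * Lam i m' k"
    unfolding T_def L f1 G_def[symmetric] su sv by (simp add: algebra_simps)
  also have "q powi (expo (Suc i) m k) * q ^ m * (- (s * \<rho> * A * B * (a * b))) = q powi (expo i m' k) * q ^ i"
    unfolding ab e2[symmetric] by simp
  also have "- s * \<rho> * u * (- A * B * v) * G * (q powi (expo (Suc i) m k) * q ^ m) * Lam i m (k - 1)
      + u * v * G * (1 - q ^ m) * (q powi (expo i m' k) * q ^ i) * Lam i m' k
      = - A * B * q powi (- k) * T i m (k - 1) + q ^ i * (1 - q ^ m) * T i m' k"
  proof -
    have T1: "T i m (k - 1) = (- s * \<rho> * u) * v * q powi (expo i m (k - 1)) * Lam i m (k - 1) * G"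
      unfolding T_def su v_def G_def ..
    have T2: "T i m' k = u * v * q powi (expo i m' k) * Lam i m' k * G"
      unfolding T_def u_def v_def G_def f2 ..
    show ?thesis unfolding T1 T2 e1 by (simp add: mult_ac)
  qed
  finally show ?thesis by (simp add: Suc)
qed

lemma regular_asc: "regular (\<lambda>y. ascPoly q (- s) m (- y * r))"
  by (intro isCont_regular continuous_intros)

text \<open>Integration by parts moves the \<open>q\<close>-derivative from \<open>w i\<close> to
  the product of the polynomial and \<open>Q k\<close>. The product rule gives one term with
  \<open>Q\<close> lowered and one with the degree \<open>m\<close> lowered.\<close>

lemma X_Suc:
  assumes "i < n" "k \<in> S" "k - 1 \<in> S \<or> A * (1 - B * q powi (- k)) = 0"
  shows "X (Suc i) m k = A * (1 - B * q powi (- k)) * X i m (k - 1) + q ^ i * (1 - q ^ m) * X i (m - 1) k"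
proof -
  define lam where "lam = A * (1 - B * q powi (- k))"
  define U where "U = (\<lambda>m i y. ascPoly q (- s) m (- y * q ^ i))"
  define g where "g = (\<lambda>y. U m (Suc i) y * Q k y)"
  have regw: "regular (w i)" "regular (w (Suc i))" using assms regular_w by auto
  have regU: "regular (U m i)" for m i unfolding U_def by (rule regular_asc)
  have regg: "regular g" unfolding g_def by (intro regular_mult regU regular_Q assms)
  have eq: "w (Suc i) (node z (Suc i) j) = (w i (node z (Suc i) j) - w i (q * node z (Suc i) j)) / node z (Suc i) j"
    if "z \<in> {-1, s}" for z j
    using w_Suc[OF assms(1) that] by (simp add: q_node node_Suc_Suc)
  have reg: "regular (\<lambda>y. (w i y - w i (q * y)) / y * g y)"
  proof (rule regular_cong)
    show "regular (\<lambda>y. w (Suc i) y * g y)" by (intro regular_mult regw regg)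
    fix z j assume z: "z \<in> {-1, s}"
    have "node z 0 j = node z (Suc i) (j + Suc i)" by (simp only: node_plus)
    then show "w (Suc i) (node z 0 j) * g (node z 0 j) =
       (w i (node z 0 j) - w i (q * node z 0 j)) / node z 0 j * g (node z 0 j)"
      using eq[OF z] by simp
  qed
  have "X (Suc i) m k = J (Suc i) (\<lambda>y. (w i y - w i (q * y)) / y * g y)"
    unfolding X_def U_def g_def by (rule J_cong) (simp only: eq)
  also have "\<dots> = J i (\<lambda>y. w i y * ((g y - g (y / q)) / y))"
    by (rule J_by_parts) (use regw regg reg w_zero[OF assms(1)] in auto)
  also have "\<dots> = J i (\<lambda>y. lam * (w i y * (U m i y * Q (k - 1) y)) + q ^ i * (1 - q ^ m) * (w i y * (U (m - 1) i y * Q k y)))"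
  proof (rule J_cong)
    fix z j assume z: "z \<in> {-1, s}"
    define y where "y = node z i j"
    have y: "y \<noteq> 0" unfolding y_def by (rule node_nonzero[OF z])
    have low: "Q k (y / q) = Q k y - lam * (y * Q (k - 1) y)"
      using lower[OF assms(2,1) z, of j] unfolding node_div y_def lam_def by (simp add: algebra_simps)
    \<comment> \<open>The scaling of the polynomial argument with the level makes the shifted factor
      at level \<open>Suc i\<close> equal to the unshifted one at level \<open>i\<close>.\<close>
    have U1: "U m (Suc i) (y / q) = U m i y"
      using q by (simp add: U_def)
    have U2: "U m (Suc i) y = U m i y + y * q ^ i * (1 - q ^ m) * U (m - 1) i y"
    proof (cases m)
      case 0
      then show ?thesis by (simp add: U_def)
    next
      case (Suc m')
      show ?thesis unfolding U_def Suc using ascPoly_lower[OF q, of "- s" m' "- y * q ^ i"] s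
        by (simp add: mult_ac)
    qed
    have "g y - g (y / q) = y * (lam * (U m i y * Q (k - 1) y) + q ^ i * (1 - q ^ m) * (U (m - 1) i y * Q k y))"
      unfolding g_def U1 low U2 by (simp add: algebra_simps)
    then have "(g y - g (y / q)) / y = lam * (U m i y * Q (k - 1) y) + q ^ i * (1 - q ^ m) * (U (m - 1) i y * Q k y)"
      using y by simp
    then show "w i (node z i j) * ((g (node z i j) - g (node z i j / q)) / node z i j) =
      lam * (w i (node z i j) * (U m i (node z i j) * Q (k - 1) (node z i j)))
       + q ^ i * (1 - q ^ m) * (w i (node z i j) * (U (m - 1) i (node z i j) * Q k (node z i j)))"
      unfolding y_def[symmetric] by (simp only:) (simp add: algebra_simps)
  qed
  also have "\<dots> = lam * X i m (k - 1) + q ^ i * (1 - q ^ m) * X i (m - 1) k"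
  proof -
    have r1: "regular (\<lambda>y. w i y * (U (m - 1) i y * Q k y))"
      by (intro regular_mult regw regU regular_Q assms)
    then have r1': "regular (\<lambda>y. q ^ i * (1 - q ^ m) * (w i y * (U (m - 1) i y * Q k y)))"
      by (rule regular_mult[OF regular_const])
    show ?thesis
    proof (cases "lam = 0")
      case True
      then show ?thesis using J_mult[OF r1] by (simp add: X_def U_def)
    next
      case False
      then have "k - 1 \<in> S" using assms(3) lam_def by auto
      then have r2: "regular (\<lambda>y. w i y * (U m i y * Q (k - 1) y))"
        by (intro regular_mult regw regU regular_Q)
      then have r2': "regular (\<lambda>y. lam * (w i y * (U m i y * Q (k - 1) y)))"
        by (rule regular_mult[OF regular_const])
      show ?thesis unfolding J_add[OF r2' r1'] J_mult[OF r2] J_mult[OF r1] by (simp add: X_def U_def)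
    qed
  qed
  finally show ?thesis by (simp add: lam_def)
qed

text \<open>By parts in the opposite direction: the raising relation presents \<open>Q (k+1)\<close>
  times \<open>E\<close> as a \<open>q\<close>-derivative, and the difference moved onto
  \<open>W\<close> times the polynomial of degree \<open>m\<close> yields degree
  \<open>m + 1\<close> by \<open>ascPoly_raise\<close>.\<close>

lemma X_0_Suc:
  assumes "k \<in> S"
  shows "X 0 (Suc m) k = s * \<rho> * q ^ m * q powi k * X 0 m (k + 1)"
proof -
  define U where "U = (\<lambda>m y. ascPoly q (- s) m (- y))"
  define h where "h = (\<lambda>y. Q k y * E c d y)"
  define g where "g = (\<lambda>y. W y * U m y)"
  have regU: "regular (U m)" for m unfolding U_def by (intro isCont_regular continuous_intros)
  have regE: "regular (E c d)" by (intro isCont_regular isCont_E)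
  have regW: "regular W" by (intro isCont_regular isCont_W)
  have regh: "regular h" unfolding h_def by (intro regular_mult regular_Q regE assms)
  have regg: "regular g" unfolding g_def by (intro regular_mult regW regU)
  have eq: "(h (node z 0 j) - h (q * node z 0 j)) / node z 0 j = - \<rho> * q powi k * (Q (k + 1) (node z 0 j) * E c d (node z 0 j))"
    if "z \<in> {-1, s}" for z j
    using raise[OF assms that, of j] node_nonzero[OF that, of 0 j] unfolding h_def q_node
    by (simp add: mult_ac)
  have r0: "regular (\<lambda>y. W y * E c d y * (U m y * Q (k + 1) y))"
    by (intro regular_mult regular_Q regE S_Suc assms regW regU)
  have reg: "regular (\<lambda>y. (h y - h (q * y)) / y * g y)"
  proof (rule regular_cong)
    show "regular (\<lambda>y. - \<rho> * q powi k * (W y * E c d y * (U m y * Q (k + 1) y)))"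
      by (intro regular_mult[OF regular_const r0])
    fix z j assume z: "z \<in> {-1, s}"
    show "- \<rho> * q powi k * (W (node z 0 j) * E c d (node z 0 j) * (U m (node z 0 j) * Q (k + 1) (node z 0 j)))
        = (h (node z 0 j) - h (q * node z 0 j)) / node z 0 j * g (node z 0 j)"
      unfolding eq[OF z] g_def by (simp add: mult_ac)
  qed
  have X0: "X 0 m k = J 0 (\<lambda>y. W y * E c d y * (U m y * Q k y))" for m k
    unfolding X_def U_def by (rule J_cong) (simp add: w_0)
  have g0: "g (node z (Suc 0) 0) = 0" if "z \<in> {-1, s}" for z
    using W_node_0[OF that] by (simp add: g_def)
  have "- \<rho> * q powi k * X 0 m (k + 1) = J 0 (\<lambda>y. - \<rho> * q powi k * (W y * E c d y * (U m y * Q (k + 1) y)))"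
    unfolding X0 J_mult[OF r0] ..
  also have "\<dots> = J 0 (\<lambda>y. (h y - h (q * y)) / y * g y)"
    by (rule J_cong) (simp only: eq, simp add: g_def mult_ac)
  \<comment> \<open>\<open>W\<close> vanishes on the added layer.\<close>
  also have "\<dots> = J (Suc 0) (\<lambda>y. (h y - h (q * y)) / y * g y)"
    by (rule J_Suc_zero[symmetric]) (use reg g0 in auto)
  also have "\<dots> = J 0 (\<lambda>y. h y * ((g y - g (y / q)) / y))"
    by (rule J_by_parts) (use regh regg reg g0 in auto)
  also have "\<dots> = J 0 (\<lambda>y. - 1 / (s * q ^ m) * (W y * E c d y * (U (Suc m) y * Q k y)))"
  proof (rule J_cong)
    fix z j assume z: "z \<in> {-1, s}"
    define y where "y = node z 0 j"
    have y: "y \<noteq> 0" unfolding y_def by (rule node_nonzero[OF z])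
    have "y * U (Suc m) y = - s * q ^ m * (U m y - (1 + y) * (1 - y / s) * U m (y / q))"
      using arg_cong[where f = uminus, OF ascPoly_raise[OF q, of "- s" "- y / q" m]] s q by (simp add: U_def)
    then have "U m y - (1 + y) * (1 - y / s) * U m (y / q) = - 1 / (s * q ^ m) * (y * U (Suc m) y)"
      using s q by (simp add: field_simps)
    moreover have "g y - g (y / q) = W y * (U m y - (1 + y) * (1 - y / s) * U m (y / q))"
      unfolding g_def W_div[OF z] by (simp only: right_diff_distrib mult_ac)
    ultimately have "g y - g (y / q) = W y * (- 1 / (s * q ^ m) * (y * U (Suc m) y))" by simp
    then show "h (node z 0 j) * ((g (node z 0 j) - g (node z 0 j / q)) / node z 0 j) =
      - 1 / (s * q ^ m) * (W (node z 0 j) * E c d (node z 0 j) * (U (Suc m) (node z 0 j) * Q k (node z 0 j)))"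
      unfolding y_def[symmetric] using y by (simp add: h_def mult_ac)
  qed
  also have "\<dots> = - 1 / (s * q ^ m) * X 0 (Suc m) k"
    unfolding X0 by (intro J_mult regular_mult regular_Q regE assms regW regU)
  finally show ?thesis using s q by (simp add: field_simps)
qed

text \<open>After \<open>m\<close> raising steps only the integral against \<open>Q (k + m)\<close>
  is left. The quotient of \<open>\<Gamma> (k + m)\<close> by \<open>\<Gamma> k\<close> is the
  finite product that \<open>Lam 0 m k\<close> contains by
  \<open>bigqLaguerre_norm_base\<close>.\<close>

lemma X_0:
  assumes "k \<in> S"
  shows "X 0 m k = \<Gamma> k * T 0 m k"
proof -
  have 1: "\<Gamma> (k + int m) = \<Gamma> k * qpoch (q powi (k + 1) / B) q m" if "k \<in> S" for k
  proof -
    have "k + int m \<in> S \<and> \<Gamma> (k + int m) = \<Gamma> k * qpoch (q powi (k + 1) / B) q m"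
    proof (induction m)
      case (Suc m)
      have e: "k + int (Suc m) = k + int m + 1" by simp
      have "q powi (k + int m + 1) = q powi (k + 1) * q ^ m"
        using q by (simp add: power_int_add)
      then show ?case unfolding e using Suc Gam_Suc[of "k + int m"] S_Suc[of "k + int m"]
        by (simp add: qpoch_Suc)
    qed (use that in auto)
    then show ?thesis ..
  qed
  have 2: "X 0 m k = (s * \<rho>) ^ m * q powi (int m * (int m + k - 1)) * (\<Gamma> (k + int m) * F (k + int m))"
    using assms
  proof (induction m arbitrary: k)
    case 0
    have "X 0 0 k = J 0 (\<lambda>y. W y * E c d y * Q k y)"
      unfolding X_def by (rule J_cong) (simp add: w_0)
    then show ?case using integral[OF 0] by simp
  next
    case (Suc m)
    have e: "int (Suc m) * (int (Suc m) + k - 1) = int m * (int m + (k + 1) - 1) + int m + k"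
      by (simp add: algebra_simps)
    have k: "k + 1 + int m = k + int (Suc m)" by simp
    show ?case
      unfolding X_0_Suc[OF Suc.prems] Suc.IH[OF S_Suc[OF Suc.prems]] e k using q
      by (simp add: power_int_add)
  qed
  have b: "qbin_coeff q m m * q ^ (m * (m - 1) div 2) * q ^ m = (-1) ^ m"
    using qbin_coeff_self[OF q, of m] triangular_Suc[of m] by (simp add: power_add mult_ac)
  have L: "Lam 0 m k = qbin_coeff q m m * q ^ m * qpoch (q powi (k + 1) / B) q m"
    unfolding Lam_def using bigqLaguerre_norm_base[OF q] by simp
  have x: "q powi (expo 0 m k) = q powi (int m * (int m + k - 1)) * q ^ (m * (m - 1) div 2)"
    unfolding expo_def using q by (simp add: power_int_add)
  have y: "(- s * \<rho>) ^ m = (s * \<rho>) ^ m * (-1) ^ m"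
    by (simp add: power_mult_distrib[symmetric])
  have i: "(-1) ^ m * (-1) ^ m = (1 :: complex)" by (simp add: power_mult_distrib[symmetric])
  have "T 0 m k = (s * \<rho>) ^ m * q powi (int m * (int m + k - 1)) * qpoch (q powi (k + 1) / B) q m * F (k + int m)
      * ((-1) ^ m * (qbin_coeff q m m * q ^ (m * (m - 1) div 2) * q ^ m))"
    unfolding T_def L x y by (simp add: mult_ac add.commute)
  then have "T 0 m k = (s * \<rho>) ^ m * q powi (int m * (int m + k - 1)) * qpoch (q powi (k + 1) / B) q m * F (k + int m)"
    unfolding b i by simp
  then show ?thesis unfolding 2 1[OF assms] by (simp add: mult_ac)
qed

text \<open>The recursions in \<open>i\<close> for \<open>X\<close> and for \<open>T\<close> agree
  because \<open>Gam_Suc\<close> turns \<open>A (1 - B q^(-k))\<close> times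
  \<open>\<Gamma> (k-1)\<close> into \<open>-A B q^(-k)\<close> times \<open>\<Gamma> k\<close>.
  When \<open>k - 1\<close> lies outside \<open>S\<close>, \<open>S_pred\<close> makes the
  corresponding terms vanish on both sides.\<close>

theorem X_eq:
  assumes "i \<le> n" "k \<in> S"
  shows "X i m k = \<Gamma> k * T i m k"
  using assms
proof (induction i arbitrary: m k)
  case 0
  then show ?case by (simp add: X_0)
next
  case (Suc i)
  define lam where "lam = A * (1 - B * q powi (- k))"
  have in_S: "k - 1 \<in> S \<or> lam = 0" using S_pred[OF Suc.prems(2)] by (auto simp: lam_def)
  have 1: "lam * X i m (k - 1) = \<Gamma> k * (- A * B * q powi (- k) * T i m (k - 1))"
  proof (cases "k - 1 \<in> S")
    case True
    have "lam * \<Gamma> (k - 1) = - A * B * q powi (- k) * \<Gamma> k"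
    proof -
      have G: "\<Gamma> k = \<Gamma> (k - 1) * (1 - q powi k / B)" using Gam_Suc[OF True] by simp
      show ?thesis unfolding lam_def G power_int_minus using nonzero q by (simp add: field_simps)
    qed
    moreover have "lam * X i m (k - 1) = lam * \<Gamma> (k - 1) * T i m (k - 1)"
      using Suc.IH[OF _ True, of m] Suc.prems by simp
    ultimately show ?thesis by (simp add: mult_ac)
  next
    case False
    then have "lam = 0" "Lam i m (k - 1) * F (int m + k - 1 - int i) = 0"
      using S_pred[OF Suc.prems(2)] by (auto simp: lam_def)
    moreover have "int m + k - 1 - int i = int m + (k - 1) - int i" by simp
    ultimately show ?thesis by (auto simp: T_def)
  qed
  have "X (Suc i) m k = lam * X i m (k - 1) + q ^ i * (1 - q ^ m) * X i (m - 1) k"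
    using X_Suc[of i k m] Suc.prems in_S by (simp add: lam_def)
  also have "X i (m - 1) k = \<Gamma> k * T i (m - 1) k"
    using Suc.IH[of k "m - 1"] Suc.prems by simp
  finally show ?case unfolding 1 T_recurrence by (simp add: algebra_simps)
qed

end

section \<open>The weight and the polynomials \<open>P\<^sub>k\<close>\<close>

locale dual_hahn = q_lattice +
  fixes \<alpha> x :: complex and n :: nat
  assumes \<alpha>: "\<alpha> \<noteq> 0" and x: "x \<noteq> 0"
    and adm: "admissible n (\<alpha> * x)" "admissible n (\<alpha> / x)"
begin

abbreviation "c \<equiv> \<alpha> * x"
abbreviation "d \<equiv> \<alpha> / x"

definition w :: "nat \<Rightarrow> complex \<Rightarrow> complex" where
  "w i y = \<alpha> ^ i * cdqHahn i x (- q / \<alpha>) (q / (s * \<alpha>)) (\<alpha> * y) q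
     * (qpoch_inf (- y * q ^ Suc i) q * qpoch_inf (y * q ^ Suc i / s) q) * E c d y"

lemma cd: "c * d = \<alpha> ^ 2"
  using x by (simp add: power2_eq_square)

lemma admissibleD: "admissible N a \<Longrightarrow> z \<in> {-1, s} \<Longrightarrow> qpoch_inf (a * node z N j) q \<noteq> 0"
  unfolding admissible_def by blast

lemma admissible_le:
  assumes "i \<le> n" "admissible n a"
  shows "admissible i a"
  unfolding admissible_def
proof (intro ballI allI)
  fix z j assume z: "z \<in> {-1, s}"
  obtain l where l: "n = i + l" using assms(1) le_Suc_ex by blast
  have "node z i j = node z n (j + l)"
    using q by (simp add: node_def l power_add)
  then show "qpoch_inf (a * node z i j) q \<noteq> 0" using admissibleD[OF assms(2) z] by simp
qed

lemma regular_w: "regular (w i)"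
  unfolding w_def by (intro isCont_regular continuous_intros q s isCont_E)

text \<open>\<open>cdqHahn_raise\<close> with third parameter \<open>\<alpha> y\<close>. The first
  two parameters are chosen so that its left-hand factors become \<open>1 + y q^(i+1)\<close> and
  \<open>1 - y q^(i+1)/s\<close>, exactly those separating consecutive infinite products of the
  weight.\<close>

lemma w_step:
  assumes "qpoch_inf (c * y) q \<noteq> 0" "qpoch_inf (d * y) q \<noteq> 0"
  shows "w i y - w i (q * y) = y * w (Suc i) y"
proof -
  define p where "p = (\<lambda>i y. cdqHahn i x (- q / \<alpha>) (q / (s * \<alpha>)) (\<alpha> * y) q)"
  define V where "V = (\<lambda>i y. qpoch_inf (- y * q ^ Suc i) q * qpoch_inf (y * q ^ Suc i / s) q)"
  have V1: "V i (q * y) = V (Suc i) y" by (simp add: V_def mult_ac)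
  have V2: "V i y = (1 + y * q ^ Suc i) * (1 - y * q ^ Suc i / s) * V (Suc i) y"
    using qpoch_inf_rec[OF q(1), of "- y * q ^ Suc i"] qpoch_inf_rec[OF q(1), of "y * q ^ Suc i / s"]
    by (simp add: V_def mult_ac)
  have "p i y * ((1 - (- q / \<alpha>) * (\<alpha> * y) * q ^ i) * (1 - q / (s * \<alpha>) * (\<alpha> * y) * q ^ i))
      - cdqHahn i x (- q / \<alpha>) (q / (s * \<alpha>)) ((\<alpha> * y) * q) q * ((1 - \<alpha> * y * x) * (1 - \<alpha> * y / x)) = \<alpha> * y * p (Suc i) y"
    unfolding p_def using q \<alpha> x by (intro cdqHahn_raise) auto
  moreover have e1: "(\<alpha> * y) * q = \<alpha> * (q * y)" by simp
  moreover have e2: "(- q / \<alpha>) * (\<alpha> * y) * q ^ i = - (y * q ^ Suc i)" "q / (s * \<alpha>) * (\<alpha> * y) * q ^ i = y * q ^ Suc i / s"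
    using \<alpha> s by simp_all
  moreover have e3: "\<alpha> * y * x = c * y" "\<alpha> * y / x = d * y" by simp_all
  ultimately have P: "p i y * ((1 + y * q ^ Suc i) * (1 - y * q ^ Suc i / s))
      - p i (q * y) * ((1 - c * y) * (1 - d * y)) = \<alpha> * y * p (Suc i) y"
    unfolding e1 e2 e3 p_def by (simp only: diff_minus_eq_add)
  have wp: "w i y = \<alpha> ^ i * p i y * V i y * E c d y" for i y unfolding w_def p_def V_def ..
  have "w i y - w i (q * y) = \<alpha> ^ i * V (Suc i) y * E c d y * (p i y * ((1 + y * q ^ Suc i) * (1 - y * q ^ Suc i / s))
      - p i (q * y) * ((1 - c * y) * (1 - d * y)))"
    unfolding wp V1 E_q[OF assms] unfolding V2
    by (simp only: right_diff_distrib mult_ac)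
  then show ?thesis unfolding P wp by (simp add: mult_ac)
qed

lemma w_Suc:
  assumes "i < n" "z \<in> {-1, s}"
  shows "w (Suc i) (node z (Suc i) j) = (w i (node z (Suc i) j) - w i (node z i j)) / node z (Suc i) j"
proof -
  have "admissible (Suc i) c" "admissible (Suc i) d" using assms adm admissible_le by auto
  then have "w i (node z (Suc i) j) - w i (q * node z (Suc i) j) = node z (Suc i) j * w (Suc i) (node z (Suc i) j)"
    using assms by (intro w_step admissibleD) auto
  then show ?thesis using node_nonzero[OF assms(2)] by (simp add: q_node node_Suc_Suc)
qed

lemma w_zero: "z \<in> {-1, s} \<Longrightarrow> w i (node z (Suc i) 0) = 0"
  using q s qpoch_inf_rec[OF q(1), of 1] by (auto simp: w_def node_def)

lemma w_0: "w 0 y = W y * E c d y"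
  by (simp add: w_def W_def mult_ac)

section \<open>The polynomials \<open>P_k\<close> as a ladder and their integral against the
  weight\<close>

definition P :: "int \<Rightarrow> complex \<Rightarrow> complex" where
  "P k y = (if k < 0 then 0 else (-1) ^ nat k * asc2Poly q c d (nat k) y / q ^ (nat k * (nat k - 1) div 2))"

lemma P_int: "P (int k) y = (-1) ^ k / q ^ (k * (k - 1) div 2) * asc2Poly q c d k y"
  by (simp add: P_def)

lemma P_int_Suc: "q ^ k * P (int k + 1) y = - ((-1) ^ k / q ^ (k * (k - 1) div 2)) * asc2Poly q c d (Suc k) y"
proof -
  have "int k + 1 = int (Suc k)" by simp
  then show ?thesis unfolding P_int triangular_Suc power_add using q by (simp only: P_int triangular_Suc power_add) simp
qed

lemma P_eq: "alSalamCarlitz2 k y c d q = P (int k) y"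
  using alSalamCarlitz2_eq_asc2Poly[OF q(2), of c k y d] \<alpha> x by (simp add: P_def)

lemma P_lower: "P k y - P k (y / q) = \<alpha> ^ 2 * (1 - 1 * q powi (- k)) * (y * P (k - 1) y)"
proof (cases "k \<le> 0")
  case True
  then show ?thesis by (auto simp: P_def)
next
  case False
  then obtain k' where k: "k = int (Suc k')" by (metis gr0_conv_Suc not_le zero_less_imp_eq_int)
  have "asc2Poly q c d (Suc k') (y / q) = asc2Poly q c d (Suc k') y - c * d * (y / q) * (1 - q ^ Suc k') * asc2Poly q c d k' y"
    using asc2Poly_lower[OF q, of c d k' "y / q"] q by simp
  then have 1: "asc2Poly q c d (Suc k') y - asc2Poly q c d (Suc k') (y / q) = \<alpha> ^ 2 * (y / q) * (1 - q ^ Suc k') * asc2Poly q c d k' y"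
    unfolding cd by simp
  have k1: "k - 1 = int k'" by (simp add: k)
  have "P k y - P k (y / q) = (-1) ^ Suc k' / q ^ (Suc k' * (Suc k' - 1) div 2) * (\<alpha> ^ 2 * (y / q) * (1 - q ^ Suc k') * asc2Poly q c d k' y)"
    unfolding 1[symmetric] k P_int by (simp only: right_diff_distrib)
  also have "\<dots> = \<alpha> ^ 2 * (1 - 1 * q powi (- k)) * (y * P (k - 1) y)"
    unfolding triangular_Suc power_add k1 P_int unfolding k power_int_minus power_int_of_nat using q
    by (simp add: field_simps)
  finally show ?thesis .
qed

lemma P_raise:
  assumes "qpoch_inf (c * y) q \<noteq> 0" "qpoch_inf (d * y) q \<noteq> 0" "0 \<le> k"
  shows "P k y * E c d y - P k (q * y) * E c d (q * y) = - 1 * q powi k * (y * (P (k + 1) y * E c d y))"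
proof -
  obtain k' where k: "k = int k'" using assms(3) by (metis nonneg_int_cases)
  have "- 1 * q powi k * (y * P (k + 1) y) = - y * (q ^ k' * P (int k' + 1) y)"
    unfolding k power_int_of_nat by simp
  also have "\<dots> = (-1) ^ k' / q ^ (k' * (k' - 1) div 2) * (y * asc2Poly q c d (Suc k') y)"
    unfolding P_int_Suc by simp
  also have "y * asc2Poly q c d (Suc k') y = asc2Poly q c d k' y - (1 - c * y) * (1 - d * y) * asc2Poly q c d k' (q * y)"
    using asc2Poly_raise[OF q, of c d k' y] \<alpha> x by simp
  finally have e: "- 1 * q powi k * (y * P (k + 1) y) = P k y - (1 - c * y) * (1 - d * y) * P k (q * y)"
    unfolding k P_int by (simp only: right_diff_distrib mult_ac)
  have "P k y * E c d y - P k (q * y) * E c d (q * y) = (P k y - (1 - c * y) * (1 - d * y) * P k (q * y)) * E c d y"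
    unfolding E_q[OF assms(1,2)] by (simp add: algebra_simps)
  also have "\<dots> = - 1 * q powi k * (y * (P (k + 1) y * E c d y))"
    unfolding e[symmetric] by (simp add: mult_ac)
  finally show ?thesis .
qed

lemma regular_P: "regular (P k)"
proof (cases "k < 0")
  case True
  then have "P k = (\<lambda>y. 0)" by (simp add: P_def fun_eq_iff)
  then show ?thesis using regular_const[of 0] by simp
next
  case False
  then have "P k = (\<lambda>y. (-1) ^ nat k * asc2Poly q c d (nat k) y / q ^ (nat k * (nat k - 1) div 2))"
    by (simp add: P_def fun_eq_iff)
  then show ?thesis using q by (simp add: isCont_regular continuous_intros)
qed

definition F_P :: "int \<Rightarrow> complex" where
  "F_P K = (if K < 0 then 0 else J 0 (\<lambda>y. W y * E c d y * P K y) / qpoch q q (nat K))"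

lemma bigqLaguerre_norm_at_1: "bigqLaguerre_norm m 1 a b q = qpoch (a * q) q m * qpoch (b * q) q m"
proof -
  have "qpoch 1 q j = 0" if "j \<noteq> 0" for j using that by (cases j) (simp_all add: qpoch_Suc_left)
  then have "bigqLaguerre_norm m 1 a b q = (\<Sum>j\<le>m. if j = 0 then qpoch (a * q) q m * qpoch (b * q) q m else 0)"
    unfolding bigqLaguerre_norm_def by (intro sum.cong refl) auto
  then show ?thesis by simp
qed

lemma ladder_P: "ladder q s n w P {0..} c d (\<alpha> ^ 2) 1 1 (\<lambda>k. qpoch q q (nat k)) F_P"
proof unfold_locales
  have adm0: "admissible 0 c" "admissible 0 d" using adm admissible_le by auto
  show "P k (node z i j) - P k (node z (Suc i) j) = \<alpha>\<^sup>2 * (1 - 1 * q powi - k) * (node z i j * P (k - 1) (node z i j))" for k i z j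
    using P_lower[of k "node z i j"] by (simp add: node_div)
  show "P k (node z 0 j) * E c d (node z 0 j) - P k (node z 0 (Suc j)) * E c d (node z 0 (Suc j))
    = - 1 * q powi k * (node z 0 j * (P (k + 1) (node z 0 j) * E c d (node z 0 j)))" if "k \<in> {0..}" "z \<in> {-1, s}" for k z j
    using P_raise[OF admissibleD[OF adm0(1) that(2)] admissibleD[OF adm0(2) that(2)], of k j] that(1)
    unfolding q_node by simp
  show "k - 1 \<in> {0..} \<or> \<alpha>\<^sup>2 * (1 - 1 * q powi - k) = 0 \<and>
     (\<forall>i m. bigqLaguerre_norm m (q powi (k - 1 + 1) / 1) (q powi (int i - int m)) (- q / (1 * \<alpha>\<^sup>2 * 1 * s) * q powi (int i - int m)) q
        * F_P (int m + k - 1 - int i) = 0)" if "k \<in> {0..}" for k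
  \<comment> \<open>At \<open>k = 0\<close> the Laguerre argument is 1 and the normalised polynomial
    is a product. Either \<open>i < m\<close>, and the parameter \<open>q^(i-m)\<close> makes this
    product 0, or \<open>m - 1 - i\<close> is negative and \<open>F_P\<close> is 0.\<close>
  proof (cases "k = 0")
    case True
    have "qpoch (q powi (int i - int m) * q) q m = 0" if "i < m" for i m
    proof -
      have "q powi (int i - int m) * q = q powi (int i - int m + 1)" using q by (simp add: power_int_add)
      also have "int i - int m + 1 = - int (m - Suc i)" using that by (simp add: of_nat_diff)
      finally show ?thesis using qpoch_terminates[OF q(2), of "m - Suc i" m] that by simp
    qed
    then have Z: "bigqLaguerre_norm m 1 (q powi (int i - int m)) b q * F_P (int m + 0 - 1 - int i) = 0" for i m b
      unfolding bigqLaguerre_norm_at_1 by (cases "i < m") (auto simp: F_P_def)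
    have e: "q powi (0 - 1 + 1) / 1 = 1" "\<alpha>\<^sup>2 * (1 - 1 * q powi - 0) = 0" by simp_all
    show ?thesis unfolding True unfolding e using Z by blast
  next
    case False
    then have "k - 1 \<in> {0..}" using that by auto
    then show ?thesis by (rule disjI1)
  qed
  show "qpoch q q (nat (k + 1)) = qpoch q q (nat k) * (1 - q powi (k + 1) / 1)" if "k \<in> {0..}" for k
  proof -
    have "0 \<le> k" using that by simp
    then obtain k' where k: "k = int k'" by (rule nonneg_int_cases)
    have k1: "k + 1 = int (Suc k')" by (simp add: k)
    show ?thesis unfolding k1 power_int_of_nat nat_int unfolding k by (simp add: qpoch_Suc)
  qed
  show "regular (w i)" for i by (rule regular_w)
  show "w (Suc i) (node z (Suc i) j) = (w i (node z (Suc i) j) - w i (node z i j)) / node z (Suc i) j"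
    if "i < n" "z \<in> {-1, s}" for i z j
    by (rule w_Suc[OF that])
  show "w i (node z (Suc i) 0) = 0" if "z \<in> {-1, s}" for i z by (rule w_zero[OF that])
  show "w 0 (node z 0 j) = W (node z 0 j) * E c d (node z 0 j)" for z j by (rule w_0)
  show "regular (P k)" for k by (rule regular_P)
  show "J 0 (\<lambda>y. W y * E c d y * P k y) = qpoch q q (nat k) * F_P k" if "k \<in> {0..}" for k
    using that qpoch_q_neq_0[OF q(1)] by (simp add: F_P_def)
  show "k + 1 \<in> {0..}" if "k \<in> {0..}" for k :: int using that by simp
  show "\<alpha>\<^sup>2 \<noteq> 0" using \<alpha> by simp
qed simp_all

text \<open>The recurrence of \<open>asc2Poly\<close> involves the first moment \<open>M k\<close>.
  Integration by parts expresses \<open>M k\<close> through \<open>G k\<close> and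
  \<open>G (Suc k)\<close>, so \<open>G\<close> satisfies a three-term recurrence, which is that of
  the Al-Salam--Chihara polynomials with parameters \<open>\<alpha> s\<close> and
  \<open>-\<alpha>\<close>.\<close>

lemma J_W_E_asc2Poly:
  "J 0 (\<lambda>y. W y * E c d y * asc2Poly q c d k y) * qpoch (- c * d * s) q k
     = J 0 (\<lambda>y. W y * E c d y) * (\<alpha> ^ k * cdqHahn k x (\<alpha> * s) (- \<alpha>) 0 q)"
proof -
  interpret L: ladder q s n w P "{0..}" c d "\<alpha> ^ 2" 1 1 "\<lambda>k. qpoch q q (nat k)" F_P
    "\<lambda>i m k. bigqLaguerre_norm m (q powi (k + 1) / 1) (q powi (int i - int m))
      (- q / (1 * \<alpha> ^ 2 * 1 * s) * q powi (int i - int m)) q"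
    by (rule ladder_P)
  define G where "G = (\<lambda>k. J 0 (\<lambda>y. W y * E c d y * asc2Poly q c d k y))"
  define M where "M = (\<lambda>k. J 0 (\<lambda>y. y * (W y * E c d y * asc2Poly q c d k y)))"
  define h where "h = (\<lambda>k. \<alpha> ^ k * cdqHahn k x (\<alpha> * s) (- \<alpha>) 0 q)"
  have reg: "regular (\<lambda>y. W y * E c d y * asc2Poly q c d k y)" for k
    by (intro isCont_regular continuous_intros isCont_W isCont_E)
  have regy: "regular (\<lambda>y. y * (W y * E c d y * asc2Poly q c d k y))" for k
    by (intro regular_mult[OF isCont_regular reg] continuous_intros)
  note rc = regular_mult[OF regular_const]
  have lin: "J 0 (\<lambda>y. u * (W y * E c d y * asc2Poly q c d k y) + v * (y * (W y * E c d y * asc2Poly q c d k y))) = u * G k + v * M k" for u v k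
    unfolding G_def M_def J_add[OF rc[OF reg] rc[OF regy]] J_mult[OF reg] J_mult[OF regy] ..
  \<comment> \<open>The polynomial of degree 1 at \<open>-y\<close> is \<open>s - 1 - y\<close>, so
    its integral, computed directly and by \<open>X_0_Suc\<close>, gives the moment.\<close>
  have M: "M k = (s - 1) * G k + s * G (Suc k)" for k
  proof -
    define t where "t = (-1) ^ k / q ^ (k * (k - 1) div 2)"
    have t: "t \<noteq> 0" using q by (simp add: t_def)
    have Pk: "P (int k) y = t * asc2Poly q c d k y" for y unfolding P_int t_def ..
    have Pk1: "q ^ k * P (int k + 1) y = - t * asc2Poly q c d (Suc k) y" for y
      unfolding P_int_Suc t_def ..
    have "L.X 0 (Suc 0) (int k) = s * 1 * q ^ 0 * q powi (int k) * L.X 0 0 (int k + 1)"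
      by (rule L.X_0_Suc) simp
    also have "\<dots> = s * (q ^ k * J 0 (\<lambda>y. W y * E c d y * P (int k + 1) y))"
      unfolding L.X_def by (simp add: w_0)
    also have "q ^ k * J 0 (\<lambda>y. W y * E c d y * P (int k + 1) y) = J 0 (\<lambda>y. q ^ k * (W y * E c d y * P (int k + 1) y))"
      by (intro J_mult[symmetric] regular_mult regular_P isCont_regular isCont_W isCont_E)
    also have "\<dots> = J 0 (\<lambda>y. - t * (W y * E c d y * asc2Poly q c d (Suc k) y))"
    proof -
      have "q ^ k * (W y * E c d y * P (int k + 1) y) = - t * (W y * E c d y * asc2Poly q c d (Suc k) y)" for y
      proof -
        have "q ^ k * (W y * E c d y * P (int k + 1) y) = W y * E c d y * (q ^ k * P (int k + 1) y)"
          by (simp only: mult_ac)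
        then show ?thesis unfolding Pk1 by (simp only: mult_ac)
      qed
      then show ?thesis by simp
    qed
    also have "\<dots> = - t * G (Suc k)" unfolding J_mult[OF reg] G_def ..
    finally have 1: "L.X 0 (Suc 0) (int k) = - s * t * G (Suc k)" by simp
    have "L.X 0 (Suc 0) (int k) = J 0 (\<lambda>y. t * (s - 1) * (W y * E c d y * asc2Poly q c d k y) + (- t) * (y * (W y * E c d y * asc2Poly q c d k y)))"
      unfolding L.X_def w_0 Pk using q s by (intro J_cong) (simp add: ascPoly_1 algebra_simps)
    also have "\<dots> = t * (s - 1) * G k + (- t) * M k" by (rule lin)
    finally have "t * ((s - 1) * G k - M k) = t * (- s * G (Suc k))" unfolding 1 by (simp add: algebra_simps)
    then have "(s - 1) * G k - M k = - s * G (Suc k)" by (simp only: mult_left_cancel[OF t])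
    then show ?thesis by (simp add: algebra_simps)
  qed
  \<comment> \<open>The new unknown \<open>g2\<close> occurs on both sides; collecting it creates
    the factor \<open>1 + t s r\<close>, whose product over the steps is
    \<open>(-cds;q)_k\<close>.\<close>
  have alg: "(1 + t * s * r) * g2 = (u - t * (s - 1) * r) * g1 - v * g0"
    if "g2 = u * g1 - t * r * ((s - 1) * g1 + s * g2) - v * g0" for t r u v g0 g1 g2 :: complex
    using arg_cong[where f = "\<lambda>z. z + t * r * (s * g2)", OF that] by (simp add: algebra_simps)
  have c0: "c \<noteq> 0" using \<alpha> x by simp
  have G1: "(1 + c * d * s) * G (Suc 0) = (c + d - c * d * (s - 1)) * G 0"
  proof -
    have "G (Suc 0) = J 0 (\<lambda>y. (c + d) * (W y * E c d y * asc2Poly q c d 0 y) + (- (c * d)) * (y * (W y * E c d y * asc2Poly q c d 0 y)))"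
      unfolding G_def asc2Poly_1[OF q(2,1)] by (intro J_cong) (simp add: algebra_simps)
    also have "\<dots> = (c + d) * G 0 + (- (c * d)) * M 0" by (rule lin)
    finally have "G (Suc 0) = (c + d) * G 0 - c * d * 1 * ((s - 1) * G 0 + s * G (Suc 0)) - 0 * G 0" unfolding M by simp
    from alg[OF this] show ?thesis by simp
  qed
  have G2: "(1 + c * d * s * q ^ Suc k) * G (Suc (Suc k)) = (c + d - c * d * (s - 1) * q ^ Suc k) * G (Suc k)
      - c * d * (1 - q ^ Suc k) * G k" for k
  proof -
    have "G (Suc (Suc k)) = J 0 (\<lambda>y. ((c + d) * (W y * E c d y * asc2Poly q c d (Suc k) y)
        + (- (c * d * q ^ Suc k)) * (y * (W y * E c d y * asc2Poly q c d (Suc k) y)))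
        + (- (c * d * (1 - q ^ Suc k))) * (W y * E c d y * asc2Poly q c d k y))"
      unfolding G_def asc2Poly_recurrence[OF q c0] by (intro J_cong) (simp add: algebra_simps)
    also have "\<dots> = ((c + d) * G (Suc k) + (- (c * d * q ^ Suc k)) * M (Suc k)) + (- (c * d * (1 - q ^ Suc k))) * G k"
      unfolding J_add[OF regular_add[OF rc[OF reg] rc[OF regy]] rc[OF reg]] lin J_mult[OF reg] G_def ..
    finally have "G (Suc (Suc k)) = (c + d) * G (Suc k) - c * d * q ^ Suc k * ((s - 1) * G (Suc k) + s * G (Suc (Suc k)))
        - c * d * (1 - q ^ Suc k) * G k" unfolding M by simp
    from alg[OF this] show ?thesis .
  qed
  have sum: "c + d = \<alpha> * (x + 1 / x)" by (simp add: algebra_simps)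
  have rec: "cdqHahn (Suc (Suc k)) x (\<alpha> * s) (- \<alpha>) 0 q = (x + 1 / x - (\<alpha> * s + - \<alpha>) * q ^ Suc k) * cdqHahn (Suc k) x (\<alpha> * s) (- \<alpha>) 0 q
     - (1 - q ^ Suc k) * (1 - \<alpha> * s * - \<alpha> * q ^ k) * cdqHahn k x (\<alpha> * s) (- \<alpha>) 0 q"
    and rec1: "cdqHahn (Suc 0) x (\<alpha> * s) (- \<alpha>) 0 q = x + 1 / x - (\<alpha> * s + - \<alpha>)" for k
    using cdqHahn_recurrence[OF q, of "\<alpha> * s" x] \<alpha> s x by auto
  have h1: "h (Suc 0) = c + d - c * d * (s - 1)"
    unfolding h_def rec1 cd sum by (simp add: power2_eq_square algebra_simps)
  have h2: "h (Suc (Suc k)) = (c + d - c * d * (s - 1) * q ^ Suc k) * h (Suc k)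
      - c * d * (1 - q ^ Suc k) * (1 + c * d * s * q ^ k) * h k" for k
    unfolding h_def rec cd sum by (simp add: power2_eq_square algebra_simps)
  have "G k * qpoch (- c * d * s) q k = G 0 * h k \<and> G (Suc k) * qpoch (- c * d * s) q (Suc k) = G 0 * h (Suc k)"
  proof (induction k)
    case 0
    show ?case using G1 h1 by (simp add: h_def qpoch_Suc mult_ac)
  next
    case (Suc k)
    have "G (Suc (Suc k)) * qpoch (- c * d * s) q (Suc (Suc k)) =
        qpoch (- c * d * s) q (Suc k) * ((1 + c * d * s * q ^ Suc k) * G (Suc (Suc k)))"
      by (simp add: qpoch_Suc[of _ _ "Suc k"] mult_ac)
    also have "\<dots> = (c + d - c * d * (s - 1) * q ^ Suc k) * (G (Suc k) * qpoch (- c * d * s) q (Suc k))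
       - c * d * (1 - q ^ Suc k) * (1 + c * d * s * q ^ k) * (G k * qpoch (- c * d * s) q k)"
      unfolding G2 qpoch_Suc[of _ _ k] by (simp add: algebra_simps)
    also have "\<dots> = G 0 * h (Suc (Suc k))"
      unfolding h2 Suc.IH[THEN conjunct1] Suc.IH[THEN conjunct2] by (simp add: algebra_simps)
    finally show ?case using Suc.IH by simp
  qed
  then show ?thesis unfolding G_def h_def by simp
qed

end

section \<open>Constant terms of Laurent expansions\<close>

definition circ :: "real \<Rightarrow> real \<Rightarrow> complex" where
  "circ r t = of_real r * exp (2 * of_real pi * \<i> * of_real t)"

text \<open>For \<open>g\<close> holomorphic on an annulus around the circle, this mean value is the
  constant coefficient of the Laurent expansion there. Linearity and limits need only continuity on
  the circle.\<close>

definition CT :: "real \<Rightarrow> (complex \<Rightarrow> complex) \<Rightarrow> complex" where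
  "CT r g = integral {0..1} (\<lambda>t. g (circ r t))"

lemma norm_circ: "r > 0 \<Longrightarrow> norm (circ r t) = r"
proof -
  have "2 * of_real pi * \<i> * of_real t = \<i> * of_real (2 * pi * t)" by simp
  then have "norm (exp (2 * of_real pi * \<i> * of_real t :: complex)) = 1"
    by (simp only: norm_exp_i_times)
  then show "r > 0 \<Longrightarrow> norm (circ r t) = r" by (simp add: circ_def norm_mult)
qed

lemma circ_in_sphere [simp]: "r > 0 \<Longrightarrow> circ r t \<in> sphere 0 r"
  by (simp add: norm_circ)

lemma continuous_on_circ: "continuous_on A (circ r)"
  unfolding circ_def by (intro continuous_intros)

lemma CT_cong:
  assumes "r > 0" "\<And>T. norm T = r \<Longrightarrow> f T = g T"
  shows "CT r f = CT r g"
  unfolding CT_def using assms by (intro integral_cong) (auto simp: norm_circ)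

lemma continuous_on_circ_compose:
  assumes "r > 0" "continuous_on (sphere 0 r) f"
  shows "continuous_on A (\<lambda>t. f (circ r t))"
  by (rule continuous_on_compose2[OF assms(2) continuous_on_circ]) (use assms(1) in \<open>auto simp: norm_circ\<close>)

lemma CT_add:
  assumes "r > 0" "continuous_on (sphere 0 r) f" "continuous_on (sphere 0 r) g"
  shows "CT r (\<lambda>T. f T + g T) = CT r f + CT r g"
  unfolding CT_def
  by (intro integral_add integrable_continuous_interval continuous_on_circ_compose assms)

lemma CT_diff:
  assumes "r > 0" "continuous_on (sphere 0 r) f" "continuous_on (sphere 0 r) g"
  shows "CT r (\<lambda>T. f T - g T) = CT r f - CT r g"
  unfolding CT_def
  by (intro integral_diff integrable_continuous_interval continuous_on_circ_compose assms)

lemma CT_mult: "CT r (\<lambda>T. a * f T) = a * CT r f"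
  unfolding CT_def by simp

lemma CT_scale: "CT r (\<lambda>T. g (of_real p * T)) = CT (p * r) g"
  unfolding CT_def circ_def by (simp add: mult_ac)

lemma CT_eq_contour_integral:
  assumes "r > 0"
  shows "contour_integral (circlepath 0 r) (\<lambda>T. g T / T) = 2 * of_real pi * \<i> * CT r g"
proof -
  have "contour_integral (circlepath 0 r) (\<lambda>T. g T / T) = integral {0..1} (\<lambda>t. 2 * of_real pi * \<i> * g (circ r t))"
    unfolding contour_integral_integral
  proof (intro integral_cong)
    fix t :: real
    have "circlepath 0 r t = circ r t" by (simp add: circlepath circ_def)
    moreover have "circ r t \<noteq> 0" using norm_circ[OF assms, of t] assms by auto
    moreover have "vector_derivative (circlepath 0 r) (at t) = 2 * of_real pi * \<i> * circ r t"
      unfolding vector_derivative_circlepath circ_def by simp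
    ultimately show "g (circlepath 0 r t) / circlepath 0 r t * vector_derivative (circlepath 0 r) (at t) = 2 * of_real pi * \<i> * g (circ r t)"
      by simp
  qed
  then show ?thesis unfolding CT_def by simp
qed

text \<open>Both mean values are the residue of \<open>g T / T\<close> at 0.\<close>

lemma CT_radius:
  assumes "g holomorphic_on ball 0 R - {0}" "0 < r" "r < R" "0 < r'" "r' < R"
  shows "CT r g = CT r' g"
proof -
  have "2 * of_real pi * \<i> * CT \<rho> g = 2 * pi * \<i> * residue (\<lambda>T. g T / T) 0" if "0 < \<rho>" "\<rho> < R" for \<rho>
  proof -
    have "((\<lambda>T. g T / T) has_contour_integral 2 * pi * \<i> * residue (\<lambda>T. g T / T) 0) (circlepath 0 \<rho>)"
      by (rule base_residue[of "ball 0 R"]) (use that assms in \<open>auto intro!: holomorphic_intros\<close>)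
    then show ?thesis
      unfolding CT_eq_contour_integral[OF that(1), symmetric] by (rule contour_integral_unique)
  qed
  from this[OF assms(2,3)] this[OF assms(4,5)] have "2 * of_real pi * \<i> * CT r g = 2 * of_real pi * \<i> * CT r' g" by simp
  then show ?thesis by simp
qed

lemma CT_holomorphic:
  assumes "g holomorphic_on ball 0 R" "0 < r" "r < R"
  shows "CT r g = g 0"
proof -
  have "((\<lambda>T. g T / (T - 0)) has_contour_integral (2 * of_real pi * \<i> * g 0)) (circlepath 0 r)"
    by (rule Cauchy_integral_circlepath_simple) (use assms in \<open>auto intro: holomorphic_on_subset\<close>)
  then have "contour_integral (circlepath 0 r) (\<lambda>T. g T / T) = 2 * of_real pi * \<i> * g 0"
    by (simp add: contour_integral_unique)
  then show ?thesis unfolding CT_eq_contour_integral[OF assms(2)] by simp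
qed

text \<open>The substitution \<open>T -> 1/T\<close> reverses the circle, and periodicity moves the
  parameter interval back.\<close>

lemma CT_inverse:
  assumes "h holomorphic_on UNIV" "0 < r"
  shows "CT r (\<lambda>T. h (1 / T)) = h 0"
proof -
  define F where "F = (\<lambda>t. h (circ (1 / r) t))"
  have per: "F (t - 1) = F t" for t
  proof -
    have "2 * of_real pi * \<i> * of_real (t - 1) = 2 * of_real pi * \<i> * of_real t - 2 * of_real pi * \<i>"
      by (simp add: algebra_simps)
    then have "exp (2 * of_real pi * \<i> * of_real (t - 1)) = exp (2 * of_real pi * \<i> * of_real t) / exp (2 * of_real pi * \<i>)"
      by (simp only: exp_diff)
    also have "exp (2 * of_real pi * \<i>) = 1" by simp
    finally show ?thesis unfolding F_def circ_def by simp
  qed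
  have "CT r (\<lambda>T. h (1 / T)) = integral {0..1} (\<lambda>t. F (- t))"
    unfolding CT_def F_def circ_def by (simp add: exp_minus divide_inverse)
  also have "\<dots> = integral {-1..0} F"
    using Henstock_Kurzweil_Integration.integral_reflect_real[of 0 "-1" F] by simp
  also have "\<dots> = integral {0..1} (F \<circ> ((+) (-1)))"
    using integral_shift_Icc_real[of 0 1 F "-1"] by simp
  also have "F \<circ> ((+) (-1)) = F" using per by (auto simp: fun_eq_iff)
  also have "integral {0..1} F = CT (1 / r) h" unfolding CT_def F_def ..
  also have "\<dots> = h 0"
    by (rule CT_holomorphic[of _ "1 / r + 1"]) (use assms in \<open>auto intro: holomorphic_on_subset\<close>)
  finally show ?thesis .
qed

lemma CT_tendsto:
  assumes r: "r > 0" and cont: "\<And>n. continuous_on (sphere 0 r) (g n)"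
    and ul: "uniform_limit (sphere 0 r) g h sequentially"
  shows "(\<lambda>n. CT r (g n)) \<longlonglongrightarrow> CT r h"
proof -
  have *: "uniform_limit {0..1} (\<lambda>n t. g n (circ r t)) (\<lambda>t. h (circ r t)) sequentially"
    by (rule uniform_limit_compose'[OF ul]) (use r in \<open>auto simp: norm_circ\<close>)
  obtain I J where IJ: "\<And>n. ((\<lambda>t. g n (circ r t)) has_integral I n) {0..1}" "((\<lambda>t. h (circ r t)) has_integral J) {0..1}" "I \<longlonglongrightarrow> J"
    using uniform_limit_integral[OF *] continuous_on_circ_compose[OF r cont] by auto
  have "I = (\<lambda>n. CT r (g n))" "J = CT r h"
    unfolding CT_def using integral_unique[OF IJ(1)] integral_unique[OF IJ(2)] by simp_all
  with IJ(3) show ?thesis by simp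
qed

lemma CT_sums:
  assumes r: "r > 0" and cont: "\<And>n. continuous_on (sphere 0 r) (g n)"
    and bound: "\<And>n T. norm T = r \<Longrightarrow> norm (g n T) \<le> M n" and M: "summable M"
  shows "(\<lambda>n. CT r (g n)) sums CT r (\<lambda>T. \<Sum>n. g n T)"
proof -
  have "uniform_limit (sphere 0 r) (\<lambda>N T. \<Sum>n<N. g n T) (\<lambda>T. \<Sum>n. g n T) sequentially"
    by (rule Weierstrass_m_test[OF _ M]) (use bound in auto)
  then have "(\<lambda>N. CT r (\<lambda>T. \<Sum>n<N. g n T)) \<longlonglongrightarrow> CT r (\<lambda>T. \<Sum>n. g n T)"
    by (intro CT_tendsto r continuous_intros cont)
  also have "(\<lambda>N. CT r (\<lambda>T. \<Sum>n<N. g n T)) = (\<lambda>N. \<Sum>n<N. CT r (g n))"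
  proof
    fix N show "CT r (\<lambda>T. \<Sum>n<N. g n T) = (\<Sum>n<N. CT r (g n))"
    proof (induction N)
      case (Suc N)
      have "CT r (\<lambda>T. \<Sum>n<Suc N. g n T) = CT r (\<lambda>T. (\<Sum>n<N. g n T) + g N T)" by simp
      also have "\<dots> = CT r (\<lambda>T. \<Sum>n<N. g n T) + CT r (g N)"
        by (intro CT_add r continuous_intros cont)
      finally show ?case using Suc by simp
    qed (simp add: CT_def)
  qed
  finally show ?thesis by (simp add: sums_def)
qed

lemma uniform_limit_scaled:
  fixes h :: "complex \<Rightarrow> complex" and f :: "complex \<Rightarrow> complex"
  assumes h: "isCont h 0" and a: "a \<longlonglongrightarrow> 0" and f: "\<And>T. T \<in> A \<Longrightarrow> norm (f T) \<le> K"
  shows "uniform_limit A (\<lambda>n T. h (a n * f T)) (\<lambda>_. h 0) sequentially"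
  unfolding uniform_limit_iff
proof (intro allI impI)
  fix e :: real assume "e > 0"
  then obtain \<delta> where \<delta>: "\<delta> > 0" "\<And>z. dist z 0 < \<delta> \<Longrightarrow> dist (h z) (h 0) < e"
    using h[unfolded continuous_at_eps_delta, rule_format, of e] by auto
  have "(\<lambda>n. norm (a n) * (\<bar>K\<bar> + 1)) \<longlonglongrightarrow> 0 * (\<bar>K\<bar> + 1)"
    using tendsto_norm[OF a] by (intro tendsto_intros) simp
  then have "\<forall>\<^sub>F n in sequentially. norm (a n) * (\<bar>K\<bar> + 1) < \<delta>"
    using \<delta>(1) by (intro order_tendstoD(2)) auto
  then show "\<forall>\<^sub>F n in sequentially. \<forall>T\<in>A. dist (h (a n * f T)) (h 0) < e"
  proof eventually_elim
    case (elim n)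
    show ?case
    proof
      fix T assume "T \<in> A"
      then have "norm (f T) \<le> \<bar>K\<bar> + 1" using f[of T] by linarith
      then have "norm (a n * f T) < \<delta>"
        using elim mult_left_mono[of "norm (f T)" "\<bar>K\<bar> + 1" "norm (a n)"] by (simp add: norm_mult)
      then show "dist (h (a n * f T)) (h 0) < e" by (intro \<delta>) simp
    qed
  qed
qed

lemma uniform_limit_times:
  fixes g :: "complex \<Rightarrow> complex"
  assumes "uniform_limit (sphere 0 r) f (\<lambda>_. l) sequentially" "continuous_on (sphere 0 r) g"
  shows "uniform_limit (sphere 0 r) (\<lambda>n T. g T * f n T) (\<lambda>T. g T * l) sequentially"
proof (rule uniform_lim_mult)
  show "bounded (g ` sphere 0 r)"
    by (intro compact_imp_bounded compact_continuous_image assms) simp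
  show "bounded ((\<lambda>_. l) ` sphere 0 r)" by (rule bounded_subset[of "{l}"]) auto
qed (use assms in \<open>auto intro: uniform_limit_const\<close>)

lemma uniform_limit_const_imp_bounded:
  fixes f :: "nat \<Rightarrow> complex \<Rightarrow> complex"
  assumes "uniform_limit K f (\<lambda>_. l) sequentially" "compact K" "\<And>n. continuous_on K (f n)"
  obtains B where "\<And>n T. T \<in> K \<Longrightarrow> norm (f n T) \<le> B"
proof -
  have "\<forall>\<^sub>F n in sequentially. \<forall>T\<in>K. dist (f n T) l < 1"
    using assms(1)[unfolded uniform_limit_iff, rule_format, of 1] by simp
  then obtain N where N: "\<And>n T. n \<ge> N \<Longrightarrow> T \<in> K \<Longrightarrow> dist (f n T) l < 1"
    by (auto simp: eventually_sequentially)
  have "bounded (\<Union>n<N. f n ` K)"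
    using assms(2,3) by (intro bounded_UN) (auto intro: compact_imp_bounded compact_continuous_image)
  then obtain C where C: "\<And>z. z \<in> (\<Union>n<N. f n ` K) \<Longrightarrow> norm z \<le> C"
    unfolding bounded_iff by blast
  have "norm (f n T) \<le> max C (norm l + 1)" if "T \<in> K" for n T
  proof (cases "n < N")
    case True
    then have "f n T \<in> (\<Union>n<N. f n ` K)" using that by blast
    then show ?thesis using C[of "f n T"] by linarith
  next
    case False
    then have "norm (f n T - l) < 1" using N[of n T] that by (simp add: dist_norm)
    then show ?thesis using norm_triangle_ineq2[of "f n T" l] by linarith
  qed
  then show ?thesis by (rule that)
qed

section \<open>Theta functions and the \<open>q\<close>-binomial theorem\<close>

lemma qtheta_mult_q:
  assumes "norm q < 1" "q \<noteq> 0" "a \<noteq> 0"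
  shows "qtheta a q = - a * qtheta (a * q) q"
proof -
  have e1: "qtheta (a * q) q = qpoch_inf (a * q) q * ((1 - 1 / a) * qpoch_inf (q / a) q)"
    using qpoch_inf_rec[OF assms(1), of "1 / a"] assms by (simp add: qtheta_def)
  have e2: "qtheta a q = (1 - a) * qpoch_inf (a * q) q * qpoch_inf (q / a) q"
    using qpoch_inf_rec[OF assms(1), of a] by (simp add: qtheta_def)
  show ?thesis unfolding e1 e2 using assms by (simp add: field_simps)
qed

lemma qtheta_powi:
  assumes q: "norm q < 1" "q \<noteq> 0" and "a \<noteq> 0"
  shows "qtheta a q = (- a) powi i * q powi (i * (i - 1) div 2) * qtheta (a * q powi i) q"
proof (induction i rule: int_induct[where k = 0])
  case base
  then show ?case by simp
next
  case (step1 i)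
  have e: "(i + 1) * (i + 1 - 1) div 2 = i * (i - 1) div 2 + i"
  proof -
    have "(i + 1) * (i + 1 - 1) = i * (i - 1) + i * 2" by (simp add: algebra_simps)
    then show ?thesis by (simp only: div_mult_self1 zero_neq_numeral not_False_eq_True)
  qed
  have "qtheta (a * q powi i) q = - (a * q powi i) * qtheta (a * q powi i * q) q"
    using assms by (intro qtheta_mult_q) auto
  also have "a * q powi i * q = a * q powi (i + 1)" using q by (simp add: power_int_add)
  finally have 1: "qtheta (a * q powi i) q = - (a * q powi i) * qtheta (a * q powi (i + 1)) q" .
  show ?case unfolding step1(2) 1 e using assms by (simp add: power_int_add)
next
  case (step2 i)
  have e: "i * (i - 1) div 2 = (i - 1) * (i - 1 - 1) div 2 + (i - 1)"
  proof -
    have "i * (i - 1) = (i - 1) * (i - 1 - 1) + (i - 1) * 2" by (simp add: algebra_simps)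
    then show ?thesis by (simp only: div_mult_self1 zero_neq_numeral not_False_eq_True)
  qed
  have "qtheta (a * q powi (i - 1)) q = - (a * q powi (i - 1)) * qtheta (a * q powi (i - 1) * q) q"
    using assms by (intro qtheta_mult_q) auto
  also have "a * q powi (i - 1) * q = a * q powi i" using q by (simp add: power_int_diff)
  finally have 1: "qtheta (a * q powi (i - 1)) q = - (a * q powi (i - 1)) * qtheta (a * q powi i) q" .
  have i1: "(- a) powi i = (- a) powi (i - 1) * - a" using assms by (simp add: power_int_diff)
  show ?case unfolding step2(2) 1 e i1 using assms by (simp add: power_int_add)
qed

text \<open>The ratio of consecutive coefficients gives
  \<open>(1 - w) \<phi>(w) = (1 - vw/c) \<phi>(qw)\<close> for the series \<open>\<phi>\<close>.
  Iteration and continuity at 0 produce the quotient of infinite products.\<close>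

lemma q_binomial:
  assumes q: "norm q < 1" "q \<noteq> 0" and "c \<noteq> 0" "norm (c * T) < 1"
  shows "(\<lambda>n. qpoch (v / c) q n / qpoch q q n * (c * T) ^ n) sums (qpoch_inf (v * T) q / qpoch_inf (c * T) q)"
    and "summable (\<lambda>n. norm (qpoch (v / c) q n / qpoch q q n) * norm (c * T) ^ n)"
proof -
  define A where "A = (\<lambda>n. qpoch (v / c) q n / qpoch q q n)"
  have lim: "qpoch a q \<longlonglongrightarrow> qpoch_inf a q" for a by (rule qpoch_tendsto[OF q(1)])
  have "qpoch_inf q q \<noteq> 0"
    using one_minus_power_neq_0[OF q(1)] by (auto simp: qpoch_inf_eq_0_iff[OF q(1)])
  then have "A \<longlonglongrightarrow> qpoch_inf (v / c) q / qpoch_inf q q"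
    unfolding A_def by (intro tendsto_divide lim)
  then have "Bseq A" by (intro convergent_imp_Bseq convergentI)
  then obtain K where K: "\<And>n. norm (A n) \<le> K" by (auto simp: Bseq_def)
  have summ: "summable (\<lambda>n. norm (A n) * norm w ^ n)" if "norm w < 1" for w :: complex
  proof (rule summable_comparison_test')
    show "summable (\<lambda>n. K * norm w ^ n)" using that by (intro summable_mult summable_geometric) auto
    show "norm (norm (A n) * norm w ^ n) \<le> K * norm w ^ n" for n
      using mult_right_mono[OF K[of n], of "norm w ^ n"] by simp
  qed
  then show "summable (\<lambda>n. norm (qpoch (v / c) q n / qpoch q q n) * norm (c * T) ^ n)"
    using assms(4) unfolding A_def by blast
  have summ': "summable (\<lambda>n. A n * w ^ n)" if "norm w < 1" for w :: complex
    by (rule summable_norm_cancel) (use summ[OF that] in \<open>simp add: norm_mult norm_power\<close>)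
  define \<phi> where "\<phi> = (\<lambda>w. \<Sum>n. A n * w ^ n)"
  have AS: "A (Suc n) * (1 - q ^ Suc n) = A n * (1 - v / c * q ^ n)" for n
    using one_minus_power_neq_0[OF q(1), of n] qpoch_q_neq_0[OF q(1), of n] by (simp add: A_def qpoch_Suc field_simps)
  have step: "(1 - w) * \<phi> w = (1 - v / c * w) * \<phi> (w * q)" if w: "norm w < 1" for w
  proof -
    have "norm w * norm q \<le> norm w * 1" using q(1) by (intro mult_left_mono) auto
    then have wq: "norm (w * q) < 1" using w by (simp add: norm_mult)
    have s1: "(\<lambda>n. A n * w ^ n) sums \<phi> w" and s2: "(\<lambda>n. A n * (w * q) ^ n) sums \<phi> (w * q)"
      unfolding \<phi>_def using summ'[OF w] summ'[OF wq] by (simp_all add: summable_sums)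
    have "(\<lambda>n. A n * w ^ n - A n * (w * q) ^ n) sums (\<phi> w - \<phi> (w * q))"
      by (intro sums_diff s1 s2)
    then have "(\<lambda>n. A (Suc n) * w ^ Suc n - A (Suc n) * (w * q) ^ Suc n) sums (\<phi> w - \<phi> (w * q))"
      by (intro sums_Suc_iff[of "\<lambda>n. A n * w ^ n - A n * (w * q) ^ n", THEN iffD2]) simp
    moreover have "(\<lambda>n. w * (A n * w ^ n) - v / c * w * (A n * (w * q) ^ n)) sums (w * \<phi> w - v / c * w * \<phi> (w * q))"
      by (intro sums_diff sums_mult s1 s2)
    moreover have "A (Suc n) * w ^ Suc n - A (Suc n) * (w * q) ^ Suc n = w * (A n * w ^ n) - v / c * w * (A n * (w * q) ^ n)" for n
    proof -
      have "A (Suc n) * w ^ Suc n - A (Suc n) * (w * q) ^ Suc n = (A (Suc n) * (1 - q ^ Suc n)) * w ^ Suc n"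
        unfolding power_mult_distrib by (simp only: right_diff_distrib left_diff_distrib mult_ac mult_1_right mult_1)
      then show ?thesis unfolding AS by (simp add: power_mult_distrib algebra_simps)
    qed
    ultimately have "\<phi> w - \<phi> (w * q) = w * \<phi> w - v / c * w * \<phi> (w * q)"
      by (simp add: sums_unique2)
    then show ?thesis by (simp add: algebra_simps)
  qed
  define w where "w = c * T"
  have w: "norm w < 1" using assms(4) by (simp add: w_def)
  have wn: "norm (w * q ^ n) < 1" for n
  proof -
    have "norm w * norm q ^ n \<le> norm w * 1" using q(1) by (intro mult_left_mono power_le_one) auto
    then show ?thesis using w by (simp add: norm_mult norm_power)
  qed
  have fin: "qpoch w q n * \<phi> w = qpoch (v / c * w) q n * \<phi> (w * q ^ n)" for n
  proof (induction n)
    case (Suc n)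
    have "qpoch w q (Suc n) * \<phi> w = qpoch (v / c * w) q n * ((1 - w * q ^ n) * \<phi> (w * q ^ n))"
      using Suc by (simp add: qpoch_Suc mult_ac)
    also have "\<dots> = qpoch (v / c * w) q (Suc n) * \<phi> (w * q ^ Suc n)"
      unfolding step[OF wn] by (simp add: qpoch_Suc mult_ac)
    finally show ?case .
  qed simp
  have "isCont \<phi> 0"
  proof -
    have "isCont (\<lambda>x. \<Sum>n. A n * x ^ n) 0"
      by (rule isCont_powser[of _ "1 / 2"]) (use summ'[of "1 / 2"] in auto)
    then show ?thesis by (simp add: \<phi>_def)
  qed
  moreover have "(\<lambda>n. w * q ^ n) \<longlonglongrightarrow> 0"
    using tendsto_mult[OF tendsto_const[of w] LIMSEQ_power_zero[OF q(1)]] by simp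
  ultimately have "(\<lambda>n. \<phi> (w * q ^ n)) \<longlonglongrightarrow> \<phi> 0" by (rule isCont_tendsto_compose)
  then have "(\<lambda>n. qpoch (v / c * w) q n * \<phi> (w * q ^ n)) \<longlonglongrightarrow> qpoch_inf (v / c * w) q * \<phi> 0"
    by (intro tendsto_mult lim)
  moreover have "(\<lambda>n. qpoch w q n * \<phi> w) \<longlonglongrightarrow> qpoch_inf w q * \<phi> w"
    by (intro tendsto_intros lim)
  ultimately have "qpoch_inf w q * \<phi> w = qpoch_inf (v / c * w) q * \<phi> 0"
    unfolding fin using LIMSEQ_unique by blast
  moreover have "\<phi> 0 = 1" unfolding \<phi>_def by (subst powser_zero) (simp add: A_def)
  moreover have "qpoch_inf w q \<noteq> 0"
  proof
    assume "qpoch_inf w q = 0"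
    then obtain j where "w * q ^ j = 1" unfolding qpoch_inf_eq_0_iff[OF q(1)] by blast
    with wn[of j] show False by simp
  qed
  ultimately have "\<phi> w = qpoch_inf (v * T) q / qpoch_inf (c * T) q"
    using assms(3) by (simp add: w_def field_simps)
  moreover have "(\<lambda>n. A n * w ^ n) sums \<phi> w" unfolding \<phi>_def using summ'[OF w] by (rule summable_sums)
  ultimately show "(\<lambda>n. qpoch (v / c) q n / qpoch q q n * (c * T) ^ n) sums (qpoch_inf (v * T) q / qpoch_inf (c * T) q)"
    by (simp add: A_def w_def)
qed

text \<open>With \<open>q\<close> positive real, \<open>T -> q T\<close> maps parametrised circles
  about 0 to each other without rotation; this is what turns the shift into a change of
  radius.\<close>

locale real_base =
  fixes q :: complex
  assumes q: "norm q < 1" "q \<noteq> 0" and q_real: "q = of_real (norm q)"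
begin

lemma CT_q_shift:
  assumes "G holomorphic_on ball 0 R - {0}" "0 < r" "r < R"
  shows "CT r (\<lambda>T. G (q * T)) = CT r G"
proof -
  have 1: "0 < norm q * r" using assms q by simp
  have "norm q * r \<le> 1 * r" using q assms by (intro mult_right_mono) auto
  then have 2: "norm q * r < R" using assms by linarith
  have "CT r (\<lambda>T. G (q * T)) = CT (norm q * r) G"
    using CT_scale[of r G "norm q"] q_real by simp
  also have "\<dots> = CT r G" by (rule CT_radius[OF assms(1) 1 2 assms(2,3)])
  finally show ?thesis .
qed

lemma qpoch_inf_neq_0:
  assumes "norm a < 1"
  shows "qpoch_inf a q \<noteq> 0"
proof
  assume "qpoch_inf a q = 0"
  then obtain j where "a * q ^ j = 1" unfolding qpoch_inf_eq_0_iff[OF q(1)] by blast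
  then have "norm a * norm q ^ j = 1" by (metis norm_mult norm_one norm_power)
  moreover have "norm a * norm q ^ j \<le> norm a * 1"
    using q by (intro mult_left_mono power_le_one) auto
  ultimately show False using assms by simp
qed

lemma norm_mult_less_1:
  fixes \<delta> T :: complex
  assumes "norm \<delta> * R \<le> 1" "norm T < R"
  shows "norm (\<delta> * T) < 1"
proof (cases "\<delta> = 0")
  case False
  then have "norm \<delta> * norm T < norm \<delta> * R" using assms by (intro mult_strict_left_mono) auto
  then show ?thesis using assms by (simp add: norm_mult)
qed simp

lemma holomorphic_qtheta_inverse:
  assumes "u \<noteq> 0" "0 \<notin> A"
  shows "(\<lambda>T. qtheta (u / T) q) holomorphic_on A"
  unfolding qtheta_def using assms q by (intro holomorphic_intros) auto

lemma holomorphic_theta_quotient: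
  assumes "u \<noteq> 0" "norm \<delta> * R \<le> 1"
  shows "(\<lambda>T. qtheta (u / T) q / qpoch_inf (\<delta> * T) q) holomorphic_on ball 0 R - {0}"
  by (intro holomorphic_intros holomorphic_qtheta_inverse qpoch_inf_neq_0 norm_mult_less_1[of \<delta> R] q assms) auto

text \<open>The integrands for \<open>\<delta>\<close> and \<open>\<delta> q\<close> differ by
  \<open>\<delta> T\<close> times the first. Quasi-periodicity of theta turns that into
  \<open>-\<delta> u\<close> times the integrand with \<open>u q\<close> for \<open>u\<close>, and
  the substitution \<open>T -> q T\<close> restores \<open>u\<close> at the price of
  \<open>\<delta> q\<close>.\<close>

lemma CT_theta_step:
  assumes u: "u \<noteq> 0" and \<delta>: "norm \<delta> * R \<le> 1" and r: "0 < r" "r < R"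
  shows "CT r (\<lambda>T. qtheta (u / T) q / qpoch_inf (\<delta> * T) q) =
     (1 - \<delta> * u) * CT r (\<lambda>T. qtheta (u / T) q / qpoch_inf (\<delta> * q * T) q)"
proof -
  let ?G = "\<lambda>v \<delta> T. qtheta (v / T) q / qpoch_inf (\<delta> * T) q"
  have hol: "?G v \<epsilon> holomorphic_on ball 0 R - {0}" if "v \<noteq> 0" "norm \<epsilon> * R \<le> 1" for v \<epsilon>
    using holomorphic_theta_quotient[OF that] .
  have \<delta>q: "norm (\<delta> * q) * R \<le> 1"
  proof -
    have "norm \<delta> * R * norm q \<le> 1 * 1" using \<delta> q r by (intro mult_mono) auto
    then show ?thesis by (simp add: norm_mult mult_ac)
  qed
  have uq: "u * q \<noteq> 0" using u q by simp
  have sub: "sphere 0 r \<subseteq> ball 0 R - {0}" using r by auto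
  have cont: "continuous_on (sphere 0 r) (?G v \<epsilon>)" if "v \<noteq> 0" "norm \<epsilon> * R \<le> 1" for v \<epsilon>
    using holomorphic_on_imp_continuous_on[OF hol[OF that]] sub by (rule continuous_on_subset)
  have "?G u \<delta> T - ?G u (\<delta> * q) T = - (\<delta> * u) * ?G (u * q) \<delta> T" if "norm T = r" for T
  proof -
    have T: "T \<noteq> 0" using that r by auto
    have nz: "qpoch_inf (\<delta> * T) q \<noteq> 0"
      using that r by (intro qpoch_inf_neq_0 norm_mult_less_1[OF \<delta>]) simp
    have rec: "qpoch_inf (\<delta> * T) q = (1 - \<delta> * T) * qpoch_inf (\<delta> * q * T) q"
      using qpoch_inf_rec[OF q(1), of "\<delta> * T"] by (simp add: mult_ac)
    have th: "qtheta (u / T) q = - (u / T) * qtheta (u * q / T) q"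
      using qtheta_mult_q[OF q, of "u / T"] u T by (simp add: mult_ac)
    have "1 / qpoch_inf (\<delta> * q * T) q = (1 - \<delta> * T) / qpoch_inf (\<delta> * T) q"
      using nz unfolding rec by simp
    then have "?G u (\<delta> * q) T = qtheta (u / T) q * ((1 - \<delta> * T) / qpoch_inf (\<delta> * T) q)"
      by (metis times_divide_eq_right mult.right_neutral)
    then have "?G u \<delta> T - ?G u (\<delta> * q) T = \<delta> * T * qtheta (u / T) q / qpoch_inf (\<delta> * T) q"
      by (simp add: diff_divide_distrib algebra_simps)
    then show ?thesis unfolding th using T by simp
  qed
  then have "CT r (\<lambda>T. ?G u \<delta> T - ?G u (\<delta> * q) T) = CT r (\<lambda>T. - (\<delta> * u) * ?G (u * q) \<delta> T)"
    by (intro CT_cong r) auto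
  also have "\<dots> = - (\<delta> * u) * CT r (?G (u * q) \<delta>)" by (rule CT_mult)
  also have "CT r (?G (u * q) \<delta>) = CT r (\<lambda>T. ?G (u * q) \<delta> (q * T))"
    by (rule CT_q_shift[symmetric, OF hol[OF uq \<delta>] r])
  also have "(\<lambda>T. ?G (u * q) \<delta> (q * T)) = ?G u (\<delta> * q)"
    using q by (simp add: fun_eq_iff mult_ac)
  also have "CT r (\<lambda>T. ?G u \<delta> T - ?G u (\<delta> * q) T) = CT r (?G u \<delta>) - CT r (?G u (\<delta> * q))"
    by (intro CT_diff r cont u \<delta> \<delta>q)
  finally show ?thesis by (simp add: algebra_simps)
qed

text \<open>Iteration of \<open>CT_theta_step\<close> with \<open>\<delta> q^n -> 0\<close>; on the
  circle the integrands converge uniformly.\<close>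

lemma CT_theta_to_0:
  assumes u: "u \<noteq> 0" and \<delta>: "norm \<delta> * R \<le> 1" and r: "0 < r" "r < R"
  shows "CT r (\<lambda>T. qtheta (u / T) q / qpoch_inf (\<delta> * T) q) = qpoch_inf (\<delta> * u) q * CT r (\<lambda>T. qtheta (u / T) q)"
proof -
  let ?G = "\<lambda>\<delta> T. qtheta (u / T) q / qpoch_inf (\<delta> * T) q"
  have \<delta>n: "norm (\<delta> * q ^ n) * R \<le> 1" for n
  proof -
    have "norm \<delta> * R * norm q ^ n \<le> 1 * 1" using \<delta> q r by (intro mult_mono power_le_one) auto
    then show ?thesis by (simp add: norm_mult norm_power mult_ac)
  qed
  have eq: "CT r (?G \<delta>) = qpoch (\<delta> * u) q n * CT r (?G (\<delta> * q ^ n))" for n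
  proof (induction n)
    case (Suc n)
    have "CT r (?G (\<delta> * q ^ n)) = (1 - \<delta> * q ^ n * u) * CT r (?G (\<delta> * q ^ n * q))"
      by (rule CT_theta_step[OF u \<delta>n r])
    then show ?case using Suc by (simp add: qpoch_Suc mult_ac)
  qed simp
  have sub: "sphere 0 r \<subseteq> ball 0 R - {0}" using r by auto
  have "(\<lambda>n. CT r (?G (\<delta> * q ^ n))) \<longlonglongrightarrow> CT r (\<lambda>T. qtheta (u / T) q * 1)"
  proof (rule CT_tendsto[OF r(1)])
    show "continuous_on (sphere 0 r) (?G (\<delta> * q ^ n))" for n
      using holomorphic_on_imp_continuous_on[OF holomorphic_theta_quotient[OF u \<delta>n]] sub
      by (rule continuous_on_subset)
    have "(\<lambda>n. \<delta> * q ^ n) \<longlonglongrightarrow> 0"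
      using tendsto_mult[OF tendsto_const[of \<delta>] LIMSEQ_power_zero[OF q(1)]] by simp
    then have "uniform_limit (sphere 0 r) (\<lambda>n T. 1 / qpoch_inf (\<delta> * q ^ n * T) q) (\<lambda>_. 1 / qpoch_inf 0 q) sequentially"
      by (intro uniform_limit_scaled[of "\<lambda>w. 1 / qpoch_inf w q" _ _ "\<lambda>T. T" r] continuous_intros q) auto
    from uniform_limit_times[OF this holomorphic_on_imp_continuous_on[OF holomorphic_qtheta_inverse[OF u]]] r
    show "uniform_limit (sphere 0 r) (\<lambda>n T. ?G (\<delta> * q ^ n) T) (\<lambda>T. qtheta (u / T) q * 1) sequentially" by simp
  qed
  then have "(\<lambda>n. qpoch (\<delta> * u) q n * CT r (?G (\<delta> * q ^ n))) \<longlonglongrightarrow> qpoch_inf (\<delta> * u) q * CT r (\<lambda>T. qtheta (u / T) q * 1)"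
    by (intro tendsto_mult qpoch_tendsto[OF q(1)])
  then have "(\<lambda>n. CT r (?G \<delta>)) \<longlonglongrightarrow> qpoch_inf (\<delta> * u) q * CT r (\<lambda>T. qtheta (u / T) q * 1)"
    by (simp only: eq[symmetric])
  then show ?thesis by (simp add: LIMSEQ_const_iff)
qed

lemma qpoch_inf_q_neq_0: "qpoch_inf q q \<noteq> 0"
  by (rule qpoch_inf_neq_0) (rule q)

text \<open>The constant coefficient in Jacobi's triple product. For \<open>\<delta> = q/u\<close>
  the denominator cancels one factor of theta and leaves an entire function of \<open>1/T\<close>
  with constant term 1, so \<open>CT_theta_to_0\<close> can be read backwards. The choice of
  \<open>R\<close> makes this \<open>\<delta>\<close> just admissible.\<close>

lemma CT_theta:
  assumes u: "u \<noteq> 0" and r: "0 < r"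
  shows "CT r (\<lambda>T. qtheta (u / T) q) = 1 / qpoch_inf q q"
proof -
  define R where "R = norm (u / q)"
  define r0 where "r0 = R / 2"
  have R: "0 < r0" "r0 < R" using u q by (auto simp: R_def r0_def)
  have \<delta>: "norm (q / u) * R \<le> 1" using u q by (simp add: R_def norm_divide)
  have "CT r (\<lambda>T. qtheta (u / T) q) = CT r0 (\<lambda>T. qtheta (u / T) q)"
    by (rule CT_radius[of _ "r + r0 + 1"]) (use u r R in \<open>auto intro: holomorphic_qtheta_inverse\<close>)
  moreover have "1 = CT r0 (\<lambda>T. qtheta (u / T) q / qpoch_inf (q / u * T) q)"
  proof -
    have "CT r0 (\<lambda>T. qtheta (u / T) q / qpoch_inf (q / u * T) q) = CT r0 (\<lambda>T. qpoch_inf (u * (1 / T)) q)"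
    proof (rule CT_cong[OF R(1)])
      fix T :: complex assume T: "norm T = r0"
      have "qpoch_inf (q / u * T) q \<noteq> 0"
        using T R by (intro qpoch_inf_neq_0 norm_mult_less_1[OF \<delta>]) simp
      then show "qtheta (u / T) q / qpoch_inf (q / u * T) q = qpoch_inf (u * (1 / T)) q"
        by (simp add: qtheta_def)
    qed
    also have "\<dots> = qpoch_inf (u * 0) q"
      by (rule CT_inverse[of "\<lambda>w. qpoch_inf (u * w) q"]) (intro holomorphic_intros q R)+
    finally show ?thesis by simp
  qed
  moreover have "\<dots> = qpoch_inf (q / u * u) q * CT r0 (\<lambda>T. qtheta (u / T) q)"
    by (rule CT_theta_to_0[OF u \<delta> R])
  ultimately show ?thesis using u qpoch_inf_q_neq_0 by (simp add: field_simps)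
qed

lemma CT_theta_div:
  assumes "u \<noteq> 0" "norm \<delta> * R \<le> 1" "0 < r" "r < R"
  shows "CT r (\<lambda>T. qtheta (u / T) q / qpoch_inf (\<delta> * T) q) = qpoch_inf (\<delta> * u) q / qpoch_inf q q"
  using CT_theta_to_0[OF assms] CT_theta[OF assms(1,3)] by simp

text \<open>Expand \<open>(vT)/(cT)\<close> by the q-binomial theorem. The power \<open>T^n\<close>
  is absorbed by quasi-periodicity, which replaces \<open>u\<close> by \<open>u q^n\<close>, and
  each term is then given by \<open>CT_theta_div\<close>.\<close>

lemma CT_theta_quotient_sums:
  assumes u: "u \<noteq> 0" and c: "c \<noteq> 0" "norm c * R \<le> 1" and d: "norm d * R \<le> 1" and r: "0 < r" "r < R"
  shows "(\<lambda>n. qpoch (v / c) q n * c ^ n / qpoch q q n * ((- u) ^ n * q ^ (n * (n - 1) div 2)) * qpoch_inf (d * u * q ^ n) q)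
     sums (qpoch_inf q q * CT r (\<lambda>T. qtheta (u / T) q * qpoch_inf (v * T) q / (qpoch_inf (c * T) q * qpoch_inf (d * T) q)))"
proof -
  define A where "A = (\<lambda>n. qpoch (v / c) q n / qpoch q q n)"
  define H where "H = (\<lambda>T. qtheta (u / T) q / qpoch_inf (d * T) q)"
  define g where "g = (\<lambda>n T. A n * (c * T) ^ n * H T)"
  have sub: "sphere 0 r \<subseteq> ball 0 R - {0}" using r by auto
  have contH: "continuous_on (sphere 0 r) H"
    unfolding H_def using holomorphic_on_imp_continuous_on[OF holomorphic_theta_quotient[OF u d]] sub
    by (rule continuous_on_subset)
  then have "bounded (H ` sphere 0 r)" by (intro compact_imp_bounded compact_continuous_image) auto
  then obtain B where "\<And>z. z \<in> H ` sphere 0 r \<Longrightarrow> norm z \<le> B" unfolding bounded_iff by blast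
  then have B: "norm (H T) \<le> B" if "norm T = r" for T using that by simp
  have cT: "norm (c * T) < 1" if "norm T = r" for T
    using that r by (intro norm_mult_less_1[OF c(2)]) simp
  have "norm (c * of_real r) < 1" using r by (intro cT) simp
  from q_binomial(2)[OF q c(1) this, of v] have summ: "summable (\<lambda>n. norm (A n) * norm (c * of_real r) ^ n)"
    by (simp add: A_def)
  have "(\<lambda>n. CT r (g n)) sums CT r (\<lambda>T. \<Sum>n. g n T)"
  proof (rule CT_sums[OF r(1)])
    show "continuous_on (sphere 0 r) (g n)" for n
      unfolding g_def by (intro continuous_intros contH)
    show "norm (g n T) \<le> norm (A n) * norm (c * of_real r) ^ n * B" if "norm T = r" for n T
      using mult_left_mono[OF B[OF that], of "norm (A n) * norm (c * of_real r) ^ n"] that r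
      by (simp add: g_def norm_mult norm_power mult_ac)
    show "summable (\<lambda>n. norm (A n) * norm (c * of_real r) ^ n * B)" by (intro summable_mult2 summ)
  qed
  also have "CT r (\<lambda>T. \<Sum>n. g n T) = CT r (\<lambda>T. qtheta (u / T) q * qpoch_inf (v * T) q / (qpoch_inf (c * T) q * qpoch_inf (d * T) q))"
  proof (rule CT_cong[OF r(1)])
    fix T :: complex assume T: "norm T = r"
    have "(\<lambda>n. A n * (c * T) ^ n * H T) sums (qpoch_inf (v * T) q / qpoch_inf (c * T) q * H T)"
      unfolding A_def by (intro sums_mult2 q_binomial(1)[OF q c(1) cT[OF T]])
    then show "(\<Sum>n. g n T) = qtheta (u / T) q * qpoch_inf (v * T) q / (qpoch_inf (c * T) q * qpoch_inf (d * T) q)"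
      unfolding g_def by (simp add: sums_iff H_def mult_ac)
  qed
  finally have "(\<lambda>n. qpoch_inf q q * CT r (g n)) sums (qpoch_inf q q * CT r (\<lambda>T. qtheta (u / T) q * qpoch_inf (v * T) q / (qpoch_inf (c * T) q * qpoch_inf (d * T) q)))"
    by (rule sums_mult)
  moreover have "qpoch_inf q q * CT r (g n) = qpoch (v / c) q n * c ^ n / qpoch q q n * ((- u) ^ n * q ^ (n * (n - 1) div 2)) * qpoch_inf (d * u * q ^ n) q" for n
  proof -
    have un: "u * q ^ n \<noteq> 0" using u q by simp
    have "CT r (g n) = CT r (\<lambda>T. A n * c ^ n * ((- u) ^ n * q ^ (n * (n - 1) div 2)) * (qtheta (u * q ^ n / T) q / qpoch_inf (d * T) q))"
    proof (rule CT_cong[OF r(1)])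
      fix T :: complex assume T: "norm T = r"
      then have T0: "T \<noteq> 0" using r by auto
      have "int n * (int n - 1) div 2 = int (n * (n - 1) div 2)"
        by (cases n) (auto simp: zdiv_int algebra_simps)
      then have "qtheta (u / T) q = (- (u / T)) ^ n * q ^ (n * (n - 1) div 2) * qtheta (u / T * q ^ n) q"
        using qtheta_powi[OF q, of "u / T" "int n"] u T0 by simp
      then have "T ^ n * qtheta (u / T) q = (- u) ^ n * q ^ (n * (n - 1) div 2) * qtheta (u * q ^ n / T) q"
        using T0 by (simp add: power_divide power_minus[of "u / T"] power_minus[of u])
      then show "g n T = A n * c ^ n * ((- u) ^ n * q ^ (n * (n - 1) div 2)) * (qtheta (u * q ^ n / T) q / qpoch_inf (d * T) q)"
        unfolding g_def H_def power_mult_distrib by (metis (no_types, lifting) mult.assoc times_divide_eq_right)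
    qed
    also have "\<dots> = A n * c ^ n * ((- u) ^ n * q ^ (n * (n - 1) div 2)) * (qpoch_inf (d * (u * q ^ n)) q / qpoch_inf q q)"
      unfolding CT_mult CT_theta_div[OF un d r] ..
    finally show ?thesis using qpoch_inf_q_neq_0 by (simp add: A_def mult_ac)
  qed
  ultimately show ?thesis by simp
qed

end

section \<open>The functions \<open>Q\<^sub>k\<close> as constant terms\<close>

text \<open>The radius \<open>R\<close> keeps the zeros of the products in \<open>c T\<close> and
  \<open>d T\<close> outside the disc. The circle of radius \<open>r\<close> avoids the moduli of
  all lattice points, so the product in \<open>y/T\<close> has no zero on it.\<close>

locale dual_hahn_contour = dual_hahn + real_base q +
  fixes r R :: real
  assumes r: "0 < r" "r < R" and cR: "norm (\<alpha> * x) * R \<le> 1" and dR: "norm (\<alpha> / x) * R \<le> 1"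
    and generic: "\<And>z i. z \<in> {-1, s} \<Longrightarrow> norm (z * q powi i) \<noteq> r"
    and theta: "qtheta (- \<alpha> / x) q \<noteq> 0" "qtheta (\<alpha> / x * s) q \<noteq> 0"
begin

lemma nonzero: "c \<noteq> 0" "d \<noteq> 0"
  using \<alpha> x by auto

lemma node_powi: "node z N j = z * q powi (int j - int N)"
  using q by (simp add: node_def power_int_diff)

text \<open>The second circle is the image of the first under \<open>T -> q T\<close>; the lowering
  relation needs the integrand on both.\<close>

definition on_circle :: "complex \<Rightarrow> bool" where
  "on_circle T \<longleftrightarrow> norm T = r \<or> norm T = norm q * r"

lemma on_circleD:
  assumes "on_circle T"
  shows "T \<noteq> 0" "norm T < R" "qpoch_inf (c * T) q \<noteq> 0" "qpoch_inf (d * T) q \<noteq> 0"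
proof -
  have "norm q * r \<le> 1 * r" using q r by (intro mult_right_mono) auto
  then show TR: "norm T < R" using assms r unfolding on_circle_def by linarith
  show "T \<noteq> 0" using assms r q unfolding on_circle_def by auto
  show "qpoch_inf (c * T) q \<noteq> 0" "qpoch_inf (d * T) q \<noteq> 0"
    by (intro qpoch_inf_neq_0 norm_mult_less_1[OF cR TR] norm_mult_less_1[OF dR TR])+
qed

lemma qpoch_inf_node_div:
  assumes "on_circle T" "z \<in> {-1, s}"
  shows "qpoch_inf (z * q powi i / T) q \<noteq> 0"
proof
  assume "qpoch_inf (z * q powi i / T) q = 0"
  then obtain j where "z * q powi i / T * q ^ j = 1" unfolding qpoch_inf_eq_0_iff[OF q(1)] by blast
  moreover have "q powi i * q ^ j = q powi (i + int j)" using q by (simp add: power_int_add)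
  ultimately have T: "z * q powi (i + int j) = T"
    using on_circleD(1)[OF assms(1)] by (simp add: field_simps)
  show False
  proof (cases "norm T = r")
    case True
    then show ?thesis using generic[OF assms(2), of "i + int j"] T by simp
  next
    case False
    have "z * q powi (i + int j - 1) = T / q" using T q by (simp add: power_int_diff)
    then have "norm (z * q powi (i + int j - 1)) = norm T / norm q" by (simp add: norm_divide)
    also have "\<dots> = r" using False assms(1) q by (simp add: on_circle_def)
    finally show ?thesis using generic[OF assms(2)] by blast
  qed
qed

definition Th :: "complex \<Rightarrow> complex" where
  "Th T = qtheta (- 1 / T) q * qtheta (s / T) q"

definition D :: "complex \<Rightarrow> complex" where
  "D T = qpoch_inf (c * T) q * qpoch_inf (d * T) q"

definition Psi :: "int \<Rightarrow> complex \<Rightarrow> complex \<Rightarrow> complex" where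
  "Psi k y T = T powi (- k) * Th T / (qpoch_inf (y / T) q * D T)"

text \<open>On the two circles this agrees with \<open>Psi k (z q\<^sup>i)\<close>, whose singularities at the lattice points
  are removable.\<close>

definition Psi' :: "complex \<Rightarrow> int \<Rightarrow> int \<Rightarrow> complex \<Rightarrow> complex" where
  "Psi' z i k T = T powi (- k) * ((- (z * q powi i / T)) powi i * q powi (- (i * (i + 1) div 2)) * qpoch_inf (q * T / (z * q powi i)) q)
     * qtheta (- s / z / T) q / D T"

lemma D_nonzero: "norm T < R \<Longrightarrow> D T \<noteq> 0"
  unfolding D_def mult_eq_0_iff de_Morgan_disj
  by (intro conjI qpoch_inf_neq_0 norm_mult_less_1[OF cR] norm_mult_less_1[OF dR])

lemma holomorphic_D: "D holomorphic_on A"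
  unfolding D_def by (intro holomorphic_intros q)

lemma Psi'_holomorphic:
  assumes "z \<in> {-1, s}"
  shows "Psi' z i k holomorphic_on ball 0 R - {0}"
proof -
  have z: "z \<noteq> 0" "- s / z \<noteq> 0" using assms s by auto
  show ?thesis
    unfolding Psi'_def
    by (intro holomorphic_intros holomorphic_qtheta_inverse holomorphic_D D_nonzero q)
      (use z q in auto)
qed

text \<open>Quasi-periodicity replaces theta of \<open>z/T\<close> by theta of \<open>y/T\<close>,
  whose first factor cancels the denominator. The result is holomorphic on the punctured disc, so
  that circles may be moved across lattice points.\<close>

lemma Psi_eq:
  assumes "on_circle T" "z \<in> {-1, s}"
  shows "Psi k (z * q powi i) T = Psi' z i k T"
proof -
  have z: "z \<noteq> 0" using assms s by auto
  define y where "y = z * q powi i"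
  have y: "y \<noteq> 0" using z q by (simp add: y_def)
  have T: "T \<noteq> 0" by (rule on_circleD(1)[OF assms(1)])
  have nz: "qpoch_inf (y / T) q \<noteq> 0" unfolding y_def by (rule qpoch_inf_node_div[OF assms])
  have "qtheta (y / T) q = (- (y / T)) powi (- i) * q powi ((- i) * (- i - 1) div 2) * qtheta (y / T * q powi (- i)) q"
    by (rule qtheta_powi[OF q]) (use y T in auto)
  also have "(- i) * (- i - 1) = i * (i + 1)" by (simp add: algebra_simps)
  also have "y / T * q powi (- i) = z / T" using q by (simp add: y_def power_int_minus)
  finally have 1: "qtheta (z / T) q = (- (y / T)) powi i * q powi (- (i * (i + 1) div 2)) * qtheta (y / T) q"
    using y T q by (simp add: power_int_minus field_simps)
  \<comment> \<open>\<open>- s / z\<close> is the starting point other than \<open>z\<close>, which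
    treats both half-lattices uniformly.\<close>
  have 2: "Th T = qtheta (z / T) q * qtheta (- s / z / T) q"
    using assms s by (auto simp: Th_def)
  have 3: "q * T / y = q / (y / T)" by simp
  show ?thesis
    unfolding Psi_def Psi'_def y_def[symmetric] 2 1 3 using nz
    by (simp add: qtheta_def)
qed

lemma on_circle_r: "norm T = r \<Longrightarrow> on_circle T"
  by (simp add: on_circle_def)

lemma on_circle_q: "norm T = r \<Longrightarrow> on_circle (q * T)"
  by (simp add: on_circle_def norm_mult)

lemma continuous_on_Th: "continuous_on (sphere 0 r) Th"
  unfolding Th_def using r s
  by (intro continuous_intros holomorphic_on_imp_continuous_on[OF holomorphic_qtheta_inverse]) auto

lemma continuous_on_D: "continuous_on A D"
  by (rule holomorphic_on_imp_continuous_on[OF holomorphic_D])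

lemma continuous_on_Psi0: "continuous_on (sphere 0 r) (\<lambda>T. T powi (- k) * Th T / D T)"
  by (intro continuous_intros continuous_on_Th continuous_on_D) (use r D_nonzero in auto)

lemma continuous_on_Psi:
  assumes "z \<in> {-1, s}"
  shows "continuous_on (sphere 0 r) (Psi k (z * q powi i))"
  unfolding Psi_def
  by (intro continuous_intros continuous_on_Th continuous_on_D q)
    (use r D_nonzero qpoch_inf_node_div[OF on_circle_r assms] in auto)

definition pref :: "int \<Rightarrow> complex" where
  "pref k = (-1) powi k * q powi (- (k * (k + 1) div 2)) * qpoch_inf q q"

text \<open>On the lattice this will be \<open>Q_k\<close> divided by the infinite products in
  \<open>c y\<close> and \<open>d y\<close>. The prefactor carries the sign and the triangular power
  of \<open>Qfun\<close>.\<close>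

definition f :: "int \<Rightarrow> complex \<Rightarrow> complex" where
  "f k y = pref k * CT r (Psi k y)"

lemma pref_Suc: "pref k = - (q powi (k + 1)) * pref (k + 1)"
proof -
  have "(k + 1) * (k + 1 + 1) = k * (k + 1) + (k + 1) * 2" by (simp add: algebra_simps)
  then have e: "(k + 1) * (k + 1 + 1) div 2 = k * (k + 1) div 2 + (k + 1)"
    by (simp only: div_mult_self1 zero_neq_numeral not_False_eq_True)
  have "q powi (- (k * (k + 1) div 2)) = q powi (k + 1) * q powi (- (k * (k + 1) div 2 + (k + 1)))"
    using q by (subst power_int_add[symmetric]) auto
  moreover have "(-1) powi k = - ((-1) powi (k + 1) :: complex)" by (simp add: power_int_add)
  ultimately show ?thesis unfolding pref_def e by (simp add: mult_ac)
qed

lemma triangular_int: "i * (i - 1) div 2 = i * i + - (i * (i + 1) div 2)" for i :: int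
proof -
  have "even (i * (i + 1))" by simp
  then obtain m where m: "i * (i + 1) = 2 * m" by (rule evenE)
  then have "i * (i - 1) = 2 * (i * i - m)" by (simp add: algebra_simps)
  then show ?thesis unfolding m by simp
qed

text \<open>The powers of \<open>T\<close> in the integrand are absorbed into the remaining theta
  function, which moves its argument to \<open>u\<close>. What is left has the shape of
  \<open>CT_theta_quotient_sums\<close> with \<open>v = q/y\<close>.\<close>

lemma CT_Psi:
  assumes z: "z \<in> {-1, s}" and y_def: "y = z * q powi i" and u_def: "u = - s / z * q powi (- (k + i))"
  shows "CT r (Psi k y) * ((- u) powi (k + i) * q powi ((k + i) * (k + i - 1) div 2)) =
    (- y) powi i * q powi (- (i * (i + 1) div 2)) *
      CT r (\<lambda>T. qtheta (u / T) q * qpoch_inf (q / y * T) q / (qpoch_inf (c * T) q * qpoch_inf (d * T) q))"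
proof -
  have z0: "z \<noteq> 0" using assms s by auto
  have u: "u \<noteq> 0" using z0 s q by (simp add: u_def)
  have "CT r (Psi k y) * ((- u) powi (k + i) * q powi ((k + i) * (k + i - 1) div 2))
     = CT r (\<lambda>T. (- u) powi (k + i) * q powi ((k + i) * (k + i - 1) div 2) * Psi k y T)"
    unfolding CT_mult by (simp add: mult_ac)
  also have "\<dots> = CT r (\<lambda>T. (- y) powi i * q powi (- (i * (i + 1) div 2)) *
      (qtheta (u / T) q * qpoch_inf (q / y * T) q / (qpoch_inf (c * T) q * qpoch_inf (d * T) q)))"
  proof (rule CT_cong[OF r(1)])
    fix T :: complex assume "norm T = r"
    then have T: "on_circle T" by (rule on_circle_r)
    have T0: "T \<noteq> 0" by (rule on_circleD(1)[OF T])
    have pd: "(- (a / T)) powi j = (- a) powi j * T powi (- j)" for a j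
      using power_int_divide_distrib[of "- a" T j] by (simp add: power_int_minus divide_inverse)
    have Tki: "T powi (- (k + i)) = T powi (- k) * T powi (- i)"
      using T0 by (simp add: power_int_add[symmetric])
    have "qtheta (u / T) q = (- (u / T)) powi (k + i) * q powi ((k + i) * (k + i - 1) div 2) * qtheta (u / T * q powi (k + i)) q"
      by (rule qtheta_powi[OF q]) (use u T0 in auto)
    also have "u / T * q powi (k + i) = - s / z / T"
      unfolding u_def power_int_minus using q by simp
    also have "(- (u / T)) powi (k + i) = (- u) powi (k + i) * (T powi (- k) * T powi (- i))"
      unfolding pd Tki ..
    finally have 1: "qtheta (u / T) q = (- u) powi (k + i) * (T powi (- k) * T powi (- i)) * q powi ((k + i) * (k + i - 1) div 2) * qtheta (- s / z / T) q" .
    have 2: "(- (y / T)) powi i = (- y) powi i * T powi (- i)"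
      by (rule pd)
    show "(- u) powi (k + i) * q powi ((k + i) * (k + i - 1) div 2) * Psi k y T =
      (- y) powi i * q powi (- (i * (i + 1) div 2)) *
      (qtheta (u / T) q * qpoch_inf (q / y * T) q / (qpoch_inf (c * T) q * qpoch_inf (d * T) q))"
      unfolding y_def Psi_eq[OF T z] unfolding Psi'_def y_def[symmetric] 1 2 D_def by simp
  qed
  also have "\<dots> = (- y) powi i * q powi (- (i * (i + 1) div 2)) *
      CT r (\<lambda>T. qtheta (u / T) q * qpoch_inf (q / y * T) q / (qpoch_inf (c * T) q * qpoch_inf (d * T) q))"
    by (rule CT_mult)
  finally show ?thesis .
qed

lemma theta_z: "z \<in> {-1, s} \<Longrightarrow> qtheta (d * z) q \<noteq> 0 \<and> qtheta (d * (- s / z)) q \<noteq> 0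
    \<and> qtheta (- d) q * qtheta (d * s) q = qtheta (d * z) q * qtheta (d * (- s / z)) q"
  using theta s by auto

text \<open>In terms of \<open>u\<close> the parameter and the argument of the series in
  \<open>Qfun\<close> are \<open>d u\<close> and \<open>c u\<close>, so the series is the sum of
  \<open>CT_theta_quotient_sums\<close> divided by the infinite product at \<open>d u\<close>. Only
  theta factors remain to be matched.\<close>

lemma Qfun_eq:
  assumes z: "z \<in> {-1, s}" and y: "y = z * q powi i"
  shows "Qfun k y c d (-1) s q = f k y * (qpoch_inf (c * y) q * qpoch_inf (d * y) q)"
proof -
  define u where "u = - s / z * q powi (- (k + i))"
  define S where "S = qpoch_inf q q * CT r (\<lambda>T. qtheta (u / T) q * qpoch_inf (q / y * T) q / (qpoch_inf (c * T) q * qpoch_inf (d * T) q))"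
  define e1 where "e1 = (- y) powi i * q powi (- (i * (i + 1) div 2))"
  define e2 where "e2 = (- u) powi (k + i) * q powi ((k + i) * (k + i - 1) div 2)"
  have z0: "z \<noteq> 0" using assms s by auto
  have u: "u \<noteq> 0" using z0 s q by (simp add: u_def)
  have e2: "e2 \<noteq> 0" using u q by (simp add: e2_def)
  have qki: "q powi (k + i) = q powi k * q powi i" using q by (simp add: power_int_add)
  have du: "d * -1 * s * q powi (- k) / y = d * u" and cu: "c * -1 * s * q powi (- k) / y = c * u"
    unfolding u_def y power_int_minus qki by (simp_all add: divide_inverse mult_ac)
  have qA: "q powi (k + 1) * y / (d * -1 * s) = q / (d * u)"
    unfolding u_def y power_int_minus qki using q z0 s nonzero by (simp add: power_int_add field_simps)
  have th_y: "qtheta (d * z) q = (- (d * z)) powi i * q powi (i * (i - 1) div 2) * qtheta (d * y) q"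
    unfolding y using qtheta_powi[OF q, of "d * z" i] nonzero z0 by (simp add: mult_ac)
  have "d * u * q powi (k + i) = d * (- s / z)"
    unfolding u_def power_int_minus using q by simp
  then have th_u: "qtheta (d * u) q = (- (d * u)) powi (k + i) * q powi ((k + i) * (k + i - 1) div 2) * qtheta (d * (- s / z)) q"
    using qtheta_powi[OF q, of "d * u" "k + i"] nonzero u by simp
  have nz_y: "qtheta (d * y) q \<noteq> 0" using th_y theta_z[OF z] by auto
  have nz_u: "qtheta (d * u) q \<noteq> 0" unfolding th_u using theta_z[OF z] nonzero u q by auto
  have nz: "qpoch_inf (d * u) q \<noteq> 0" "qpoch_inf (q / (d * u)) q \<noteq> 0" "qpoch_inf (d * y) q \<noteq> 0" "qpoch_inf (q / (d * y)) q \<noteq> 0"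
    using nz_u nz_y by (auto simp: qtheta_def)
  have "(\<lambda>n. qpoch (q / y / c) q n * c ^ n / qpoch q q n * ((- u) ^ n * q ^ (n * (n - 1) div 2)) * qpoch_inf (d * u * q ^ n) q) sums S"
    unfolding S_def by (rule CT_theta_quotient_sums[OF u nonzero(1) cR dR r])
  then have "(\<lambda>n. qpoch (q / y / c) q n * c ^ n / qpoch q q n * ((- u) ^ n * q ^ (n * (n - 1) div 2)) * qpoch_inf (d * u * q ^ n) q / qpoch_inf (d * u) q) sums (S / qpoch_inf (d * u) q)"
    by (rule sums_divide)
  also have "(\<lambda>n. qpoch (q / y / c) q n * c ^ n / qpoch q q n * ((- u) ^ n * q ^ (n * (n - 1) div 2)) * qpoch_inf (d * u * q ^ n) q / qpoch_inf (d * u) q)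
    = (\<lambda>n. qpoch (q / (c * y)) q n / (qpoch q q n * qpoch (d * u) q n) * ((-1) ^ n * q ^ (n * (n - 1) div 2)) * (c * u) ^ n)"
  proof
    fix n
    have sp: "qpoch_inf (d * u) q = qpoch (d * u) q n * qpoch_inf (d * u * q ^ n) q"
      by (rule qpoch_inf_split[OF q(1)])
    have m: "(- u) ^ n = (-1) ^ n * u ^ n" by (simp add: power_minus[of u])
    have y': "q / y / c = q / (c * y)" by (simp add: mult_ac)
    show "qpoch (q / y / c) q n * c ^ n / qpoch q q n * ((- u) ^ n * q ^ (n * (n - 1) div 2)) * qpoch_inf (d * u * q ^ n) q / qpoch_inf (d * u) q
      = qpoch (q / (c * y)) q n / (qpoch q q n * qpoch (d * u) q n) * ((-1) ^ n * q ^ (n * (n - 1) div 2)) * (c * u) ^ n"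
      unfolding y' m power_mult_distrib using nz(1) unfolding sp by simp
  qed
  finally have hyp: "qhyp [q / (c * y)] [d * u] q (c * u) = S / qpoch_inf (d * u) q"
    unfolding qhyp_def by (simp add: sums_iff)
  have ct: "qpoch_inf q q * CT r (Psi k y) * e2 = e1 * S"
    using arg_cong[where f = "\<lambda>t. qpoch_inf q q * t", OF CT_Psi[OF z y u_def]] unfolding e1_def e2_def S_def
    by (simp add: mult_ac)
  \<comment> \<open>All constants agree by quasi-periodicity at \<open>d z\<close> and
    \<open>d u\<close>, since \<open>z\<close> and \<open>-s/z\<close> are together the two starting
    points.\<close>
  have key: "(- d) powi k * (qtheta (- d) q * qtheta (d * s) q) * e2 = (-1) powi k * e1 * qtheta (d * y) q * qtheta (d * u) q"
  proof -
    have a: "(- (d * u)) powi (k + i) = d powi k * d powi i * (- u) powi (k + i)"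
      unfolding mult_minus_right[symmetric] power_int_mult_distrib power_int_add[OF disjI1[OF nonzero(2)], symmetric] ..
    have b: "(- (d * z)) powi i = d powi i * (- z) powi i"
      unfolding mult_minus_right[symmetric] power_int_mult_distrib ..
    have m: "(- d) powi k = (-1) powi k * d powi k"
      using power_int_mult_distrib[of "-1" d k] by simp
    have y': "e1 = (- z) powi i * q powi (i * (i - 1) div 2)"
    proof -
      have "(- y) powi i = (- z) powi i * q powi (i * i)"
        unfolding y mult_minus_left[symmetric] power_int_mult_distrib power_int_mult[symmetric] ..
      then show ?thesis unfolding e1_def triangular_int[of i] power_int_add[OF disjI1[OF q(2)]] by simp
    qed
    show ?thesis
      using theta_z[OF z] unfolding th_y th_u a b m y' e2_def
      by (simp add: mult_ac)
  qed
  have "Qfun k y c d (-1) s q = (- d) powi k * q powi (- (k * (k + 1) div 2)) * (qpoch_inf (c * y) q * (qtheta (- d) q * qtheta (d * s) q)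
        / (qpoch_inf (q / (d * y)) q * qpoch_inf (q / (d * u)) q)) * (S / qpoch_inf (d * u) q)"
    unfolding Qfun_def du cu qA hyp by simp
  also have "\<dots> = ((- d) powi k * (qtheta (- d) q * qtheta (d * s) q) * e2) * S * q powi (- (k * (k + 1) div 2)) * qpoch_inf (c * y) q
        / (qpoch_inf (q / (d * y)) q * qtheta (d * u) q * e2)"
    using e2 unfolding qtheta_def[of "d * u"] by (simp add: field_simps)
  also have "\<dots> = (e1 * S) * (-1) powi k * qtheta (d * y) q * q powi (- (k * (k + 1) div 2)) * qpoch_inf (c * y) q / (qpoch_inf (q / (d * y)) q * e2)"
    unfolding key using nz_u by simp
  also have "\<dots> = qpoch_inf q q * CT r (Psi k y) * (-1) powi k * qpoch_inf (d * y) q * q powi (- (k * (k + 1) div 2)) * qpoch_inf (c * y) q"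
    unfolding ct[symmetric] qtheta_def using e2 nz by simp
  also have "\<dots> = f k y * (qpoch_inf (c * y) q * qpoch_inf (d * y) q)"
    by (simp add: f_def pref_def mult_ac)
  finally show ?thesis .
qed

end

lemma CT_diff_linear:
  assumes "r > 0" "continuous_on (sphere 0 r) f" "continuous_on (sphere 0 r) g" "continuous_on (sphere 0 r) h"
  shows "CT r (\<lambda>T. f T - (a * g T - b * h T)) = CT r f - (a * CT r g - b * CT r h)"
    and "CT r (\<lambda>T. (f T - a * g T) - b * h T) = (CT r f - a * CT r g) - b * CT r h"
proof -
  have ag: "continuous_on (sphere 0 r) (\<lambda>T. a * g T)" and bh: "continuous_on (sphere 0 r) (\<lambda>T. b * h T)"
    by (intro continuous_intros assms)+
  show "CT r (\<lambda>T. f T - (a * g T - b * h T)) = CT r f - (a * CT r g - b * CT r h)"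
    using CT_diff[OF assms(1,2) continuous_on_diff[OF ag bh]] CT_diff[OF assms(1) ag bh] by (simp add: CT_mult)
  show "CT r (\<lambda>T. (f T - a * g T) - b * h T) = (CT r f - a * CT r g) - b * CT r h"
    using CT_diff[OF assms(1) continuous_on_diff[OF assms(2) ag] bh] CT_diff[OF assms(1,2) ag] by (simp add: CT_mult)
qed

section \<open>Raising and lowering relations of the constant terms, and their integral\<close>

lemma lower_identity:
  fixes q s T P y c d :: complex
  assumes "T \<noteq> 0" "q \<noteq> 0" "s \<noteq> 0" "P \<noteq> 0"
  shows "(1 - y / (q * T)) - (1 - c * y / q) * (1 - d * y / q) - (c * d / q + P / s) * y * T * (1 - y / (q * T)) =
      y * P / s * ((- s / (q * P)) * ((1 - c * T) * (1 - d * T) / T) - T * (1 - y / (q * T)))"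
proof -
  have "y * P / s * ((- s / (q * P)) * X - Z) = - (y / q) * X - P / s * (y * Z)" for X Z
    using assms by (simp add: field_simps)
  then have "y * P / s * ((- s / (q * P)) * ((1 - c * T) * (1 - d * T) / T) - T * (1 - y / (q * T)))
    = - (y / q) * ((1 - c * T) * (1 - d * T) / T) - P / s * (y * (T * (1 - y / (q * T))))" .
  moreover have "(1 - y / (q * T)) - (1 - c * y / q) * (1 - d * y / q) - c * d / q * y * T * (1 - y / (q * T))
    = - (y / q) * ((1 - c * T) * (1 - d * T) / T)"
  proof -
    define Y where "Y = y / q"
    have Y: "y / (q * T) = Y / T" "c * y / q = c * Y" "d * y / q = d * Y" "c * d / q * y = c * d * Y" "y / q = Y"
      by (simp_all add: Y_def)
    have f1: "c * d * Y * T * (1 - Y / T) = c * d * Y * T - c * d * Y * Y"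
      using assms(1) by (simp add: right_diff_distrib)
    have f2: "(1 - c * T) * (1 - d * T) / T = 1 / T - c - d + c * d * T"
      using assms(1) by (simp add: field_simps)
    show ?thesis unfolding Y f1 f2 by (simp add: algebra_simps)
  qed
  ultimately show ?thesis by (simp only: ring_distribs diff_conv_add_uminus minus_mult_left) (simp add: algebra_simps)
qed

context dual_hahn_contour
begin

lemma CT_Psi_add:
  assumes "z \<in> {-1, s}" "z' \<in> {-1, s}"
  shows "CT r (\<lambda>T. a * Psi k (z * q powi i) T - b * Psi l (z' * q powi j) T)
    = a * CT r (Psi k (z * q powi i)) - b * CT r (Psi l (z' * q powi j))"
  unfolding CT_mult[symmetric]
  by (intro CT_diff r continuous_intros continuous_on_Psi assms)

text \<open>The reciprocals of the products at \<open>y/T\<close> and \<open>q y/T\<close> differ by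
  the factor \<open>y/T\<close>, which raises the exponent \<open>k\<close> under the constant
  term.\<close>

lemma f_raise:
  assumes z: "z \<in> {-1, s}" and y: "y = z * q powi i"
  shows "f k y - f k (q * y) = - q * q powi k * (y * f (k + 1) y)"
proof -
  have qy: "q * y = z * q powi (i + 1)" using q by (simp add: y power_int_add)
  have "CT r (\<lambda>T. 1 * Psi k y T - 1 * Psi k (q * y) T) = CT r (\<lambda>T. y * Psi (k + 1) y T)"
  proof (rule CT_cong[OF r(1)])
    fix T :: complex assume "norm T = r"
    then have T: "on_circle T" by (rule on_circle_r)
    have T0: "T \<noteq> 0" by (rule on_circleD(1)[OF T])
    have nz: "qpoch_inf (y / T) q \<noteq> 0" unfolding y by (rule qpoch_inf_node_div[OF T z])
    have rec: "qpoch_inf (y / T) q = (1 - y / T) * qpoch_inf (q * y / T) q"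
      using qpoch_inf_rec[OF q(1), of "y / T"] by (simp add: mult_ac)
    have p: "1 / qpoch_inf (q * y / T) q = (1 - y / T) / qpoch_inf (y / T) q"
      using nz unfolding rec by simp
    have g: "Psi l v T = T powi (- l) * Th T / D T * (1 / qpoch_inf (v / T) q)" for l v
      by (simp add: Psi_def)
    have t: "T powi (- k) = T powi (- (k + 1)) * T" using T0 by (simp add: power_int_diff)
    show "1 * Psi k y T - 1 * Psi k (q * y) T = y * Psi (k + 1) y T"
      unfolding g p t using T0 by (simp add: diff_divide_distrib algebra_simps)
  qed
  moreover have "CT r (\<lambda>T. 1 * Psi k y T - 1 * Psi k (q * y) T) = 1 * CT r (Psi k y) - 1 * CT r (Psi k (q * y))"
    unfolding qy unfolding y by (rule CT_Psi_add[OF z z])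
  ultimately have "CT r (Psi k y) - CT r (Psi k (q * y)) = y * CT r (Psi (k + 1) y)"
    by (simp add: CT_mult)
  then have "pref k * (CT r (Psi k y) - CT r (Psi k (q * y))) = pref k * (y * CT r (Psi (k + 1) y))" by simp
  also have "\<dots> = - q * q powi k * (y * f (k + 1) y)"
    unfolding pref_Suc[of k] f_def using q by (simp add: power_int_add)
  finally show ?thesis by (simp add: f_def right_diff_distrib)
qed

lemma Th_q:
  assumes "T \<noteq> 0"
  shows "Th (q * T) = - s / (q * T) ^ 2 * Th T"
proof -
  have a: "qtheta (v / (q * T)) q = - (v / (q * T)) * qtheta (v / T) q" if "v \<noteq> 0" for v
    using qtheta_mult_q[OF q, of "v / (q * T)"] that assms q by simp
  show ?thesis unfolding Th_def using a[of "-1"] a[of s] s by (simp add: power2_eq_square)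
qed

text \<open>The detour through \<open>Psi'\<close> is needed because \<open>Psi\<close> has
  singularities between the two circles, removable only on paper until cancelled.\<close>

lemma CT_Psi_q:
  assumes z: "z \<in> {-1, s}"
  shows "CT r (\<lambda>T. Psi k (z * q powi i) (q * T)) = CT r (Psi k (z * q powi i))"
proof -
  have "CT r (\<lambda>T. Psi k (z * q powi i) (q * T)) = CT r (\<lambda>T. Psi' z i k (q * T))"
    by (intro CT_cong r Psi_eq z on_circle_q)
  also have "\<dots> = CT r (Psi' z i k)" by (rule CT_q_shift[OF Psi'_holomorphic[OF z] r])
  also have "\<dots> = CT r (Psi k (z * q powi i))"
    by (intro CT_cong r Psi_eq[symmetric] z on_circle_r)
  finally show ?thesis .
qed

text \<open>The combination of integrands minus the claimed multiple of \<open>Psi (k-1)\<close> is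
  a total \<open>q\<close>-difference of \<open>Psi (k-1)\<close> in \<open>T\<close>, whose
  constant term is 0. With the common factor \<open>G\<close> removed this is
  \<open>lower_identity\<close>, where \<open>P\<close> stands for \<open>q powi k\<close>.\<close>

lemma f_lower:
  assumes z: "z \<in> {-1, s}" and y: "y = z * q powi i"
  shows "f k y - (1 - c * y / q) * (1 - d * y / q) * f k (y / q) = - (1 / s) * (1 - (- c * d * s / q) * q powi (- k)) * (y * f (k - 1) y)"
proof -
  define b where "b = (1 - c * y / q) * (1 - d * y / q)"
  define \<kappa> where "\<kappa> = c * d / q + q powi k / s"
  have yq: "y / q = z * q powi (i - 1)" using q by (simp add: y power_int_diff)
  have id: "(Psi k y T - b * Psi k (y / q) T) - \<kappa> * y * Psi (k - 1) y T = y * q powi k / s * (Psi (k - 1) y (q * T) - Psi (k - 1) y T)"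
    if T: "norm T = r" for T
  proof -
    have oT: "on_circle T" using T by (rule on_circle_r)
    have T0: "T \<noteq> 0" by (rule on_circleD(1)[OF oT])
    define G where "G = T powi (- k) * Th T / (qpoch_inf (y / q / T) q * D T)"
    have nz: "qpoch_inf (y / q / T) q \<noteq> 0" unfolding yq by (rule qpoch_inf_node_div[OF oT z])
    have rec: "qpoch_inf (y / q / T) q = (1 - y / (q * T)) * qpoch_inf (y / T) q"
      using qpoch_inf_rec[OF q(1), of "y / q / T"] q by (simp add: mult_ac)
    have p: "1 / qpoch_inf (y / T) q = (1 - y / (q * T)) / qpoch_inf (y / q / T) q"
      using nz unfolding rec by simp
    have g: "Psi l v T = T powi (- l) * Th T / D T * (1 / qpoch_inf (v / T) q)" for l v T
      by (simp add: Psi_def)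
    have G: "G = T powi (- k) * Th T / D T * (1 / qpoch_inf (y / q / T) q)" by (simp add: G_def)
    have e1: "Psi k y T = G * (1 - y / (q * T))" unfolding g G p by simp
    have e2: "Psi k (y / q) T = G" unfolding g G ..
    have tk: "T powi (- (k - 1)) = T powi (- k) * T" using power_int_add[of T "- k" 1] T0 by simp
    have e3: "Psi (k - 1) y T = G * T * (1 - y / (q * T))" unfolding g G p tk by simp
    have Dq: "1 / D (q * T) = (1 - c * T) * (1 - d * T) / D T"
    proof -
      have r': "qpoch_inf (\<delta> * T) q = (1 - \<delta> * T) * qpoch_inf (\<delta> * (q * T)) q" for \<delta>
        using qpoch_inf_rec[OF q(1), of "\<delta> * T"] by (simp add: mult_ac)
      have DT: "D T = (1 - c * T) * (1 - d * T) * D (q * T)"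
        unfolding D_def r'[of c] r'[of d] by (simp only: mult_ac)
      have gen: "1 / v = u / (u * v)" if "u * v \<noteq> 0" for u v :: complex using that by simp
      show ?thesis
        using gen[of "(1 - c * T) * (1 - d * T)" "D (q * T)"] D_nonzero[OF on_circleD(2)[OF oT]] unfolding DT by blast
    qed
    have qTk: "(q * T) powi (- (k - 1)) = q / q powi k * (T powi (- k) * T)"
    proof -
      have "q powi (- (k - 1)) = q / q powi k"
        using power_int_add[of q "- k" 1] q by (simp add: power_int_minus divide_inverse)
      then show ?thesis unfolding power_int_mult_distrib tk by (simp only:)
    qed
    have "Psi (k - 1) y (q * T) = (q * T) powi (- (k - 1)) * Th (q * T) * (1 / D (q * T)) * (1 / qpoch_inf (y / (q * T)) q)"
      by (simp add: Psi_def)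
    also have "\<dots> = G * (- s / (q * q powi k)) * ((1 - c * T) * (1 - d * T) / T)"
      unfolding Th_q[OF T0] Dq qTk G using T0 q by (simp add: power2_eq_square mult_ac)
    finally have e4: "Psi (k - 1) y (q * T) = G * (- s / (q * q powi k)) * ((1 - c * T) * (1 - d * T) / T)" .
    have "(Psi k y T - b * Psi k (y / q) T) - \<kappa> * y * Psi (k - 1) y T
      = G * ((1 - y / (q * T)) - b - \<kappa> * y * T * (1 - y / (q * T)))"
      unfolding e1 e2 e3 by (simp add: algebra_simps)
    also have "(1 - y / (q * T)) - b - \<kappa> * y * T * (1 - y / (q * T)) =
      y * q powi k / s * ((- s / (q * q powi k)) * ((1 - c * T) * (1 - d * T) / T) - T * (1 - y / (q * T)))"
      unfolding b_def \<kappa>_def by (rule lower_identity) (use T0 q s in auto)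
    also have "G * (y * q powi k / s * ((- s / (q * q powi k)) * ((1 - c * T) * (1 - d * T) / T) - T * (1 - y / (q * T)))) =
      y * q powi k / s * (Psi (k - 1) y (q * T) - Psi (k - 1) y T)"
      unfolding e3 e4 by (simp add: right_diff_distrib mult_ac)
    finally show ?thesis .
  qed
  have cont: "continuous_on (sphere 0 r) (Psi l (z * q powi j))" for l j by (rule continuous_on_Psi[OF z])
  have cont_q: "continuous_on (sphere 0 r) (\<lambda>T. Psi l (z * q powi j) (q * T))" for l j
  proof -
    have "continuous_on (sphere 0 r) (\<lambda>T. Psi' z j l (q * T))"
    proof (rule continuous_on_compose2[OF holomorphic_on_imp_continuous_on[OF Psi'_holomorphic[OF z]]])
      show "(\<lambda>T. q * T) ` sphere 0 r \<subseteq> ball 0 R - {0}"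
        using on_circleD(1,2)[OF on_circle_q] by auto
    qed (intro continuous_intros)
    moreover have "Psi l (z * q powi j) (q * T) = Psi' z j l (q * T)" if "T \<in> sphere 0 r" for T
      using that by (intro Psi_eq z on_circle_q) simp
    ultimately show ?thesis
      using continuous_on_cong[of "sphere 0 r" "sphere 0 r" "\<lambda>T. Psi l (z * q powi j) (q * T)" "\<lambda>T. Psi' z j l (q * T)"] by blast
  qed
  have "CT r (\<lambda>T. (Psi k y T - b * Psi k (y / q) T) - \<kappa> * y * Psi (k - 1) y T)
      = CT r (\<lambda>T. y * q powi k / s * (Psi (k - 1) y (q * T) - Psi (k - 1) y T))"
    by (rule CT_cong[OF r(1) id])
  also have "\<dots> = 0"
  proof -
    have "CT r (\<lambda>T. Psi (k - 1) y (q * T) - Psi (k - 1) y T) = 0"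
      unfolding y CT_diff[OF r(1) cont_q cont] CT_Psi_q[OF z] by simp
    then show ?thesis unfolding CT_mult by simp
  qed
  also have "CT r (\<lambda>T. (Psi k y T - b * Psi k (y / q) T) - \<kappa> * y * Psi (k - 1) y T)
     = CT r (Psi k y) - b * CT r (Psi k (y / q)) - \<kappa> * y * CT r (Psi (k - 1) y)"
    unfolding yq unfolding y by (rule CT_diff_linear(2)[OF r(1) cont cont cont])
  finally have "pref k * (CT r (Psi k y) - b * CT r (Psi k (y / q))) = pref k * (\<kappa> * y * CT r (Psi (k - 1) y))" by simp
  moreover have "pref k = - pref (k - 1) / q powi k"
    using pref_Suc[of "k - 1"] q by (simp add: field_simps)
  ultimately have "f k y - b * f k (y / q) = - \<kappa> / q powi k * (y * f (k - 1) y)"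
    unfolding f_def by (simp add: right_diff_distrib mult_ac)
  also have "- \<kappa> / q powi k = - (1 / s) * (1 - (- c * d * s / q) * q powi (- k))"
    unfolding \<kappa>_def power_int_minus using q s by (simp add: field_simps)
  finally show ?thesis by (simp add: b_def)
qed

lemma uniform_limit_node:
  assumes z: "z \<in> {-1, s}"
  shows "uniform_limit (sphere 0 r) (\<lambda>j T. 1 / qpoch_inf (node z 0 j / T) q) (\<lambda>_. 1) sequentially"
proof -
  have "uniform_limit (sphere 0 r) (\<lambda>j T. 1 / qpoch_inf (node z 0 j * (1 / T)) q) (\<lambda>_. 1 / qpoch_inf 0 q) sequentially"
    by (rule uniform_limit_scaled[of "\<lambda>w. 1 / qpoch_inf w q" _ _ "\<lambda>T. 1 / T" "1 / r", OF _ node_tendsto_0])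
      (use q r in \<open>auto intro!: continuous_intros simp: norm_divide\<close>)
  then show ?thesis by simp
qed

lemma Psi_alt: "Psi k y = (\<lambda>T. T powi (- k) * Th T / D T * (1 / qpoch_inf (y / T) q))"
  by (simp add: Psi_def fun_eq_iff)

text \<open>As \<open>y\<close> tends to 0 the product in \<open>y/T\<close> tends to 1 uniformly on
  the circle, so both half-lattices lead to the same constant term.\<close>

lemma regular_f: "regular (f k)"
  unfolding regular_def limit0_def
proof (intro exI ballI)
  fix z assume z: "z \<in> {-1, s}"
  have "(\<lambda>j. CT r (Psi k (node z 0 j))) \<longlonglongrightarrow> CT r (\<lambda>T. T powi (- k) * Th T / D T * 1)"
  proof (rule CT_tendsto[OF r(1)])
    show "continuous_on (sphere 0 r) (Psi k (node z 0 j))" for j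
      unfolding node_powi by (rule continuous_on_Psi[OF z])
    show "uniform_limit (sphere 0 r) (\<lambda>j. Psi k (node z 0 j)) (\<lambda>T. T powi (- k) * Th T / D T * 1) sequentially"
      unfolding Psi_alt by (rule uniform_limit_times[OF uniform_limit_node[OF z] continuous_on_Psi0])
  qed
  then show "(\<lambda>j. f k (node z 0 j)) \<longlonglongrightarrow> pref k * CT r (\<lambda>T. T powi (- k) * Th T / D T * 1)"
    unfolding f_def by (intro tendsto_intros)
qed

text \<open>A geometric bound, uniform on the circle, allows the sum over the nodes to be taken
  inside the constant term. There the integral in \<open>y\<close> is \<open>J_W_E\<close> with
  parameters \<open>1/T\<close> and 0.\<close>

lemma J_W_f:
  assumes "qtheta (- s) q \<noteq> 0"
  shows "J 0 (\<lambda>y. W y * f k y) = pref k * ((1 - q) * qpoch_inf q q * qtheta (- s) q) *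
    CT r (\<lambda>T. T powi (- k) * (qpoch_inf (- q * T) q * qpoch_inf (q * T / s) q / D T))"
proof -
  define H where "H = (\<lambda>T. T powi (- k) * Th T / D T)"
  define g where "g = (\<lambda>z j T. W (node z 0 j) * Psi k (node z 0 j) T * node z 0 j)"
  have contg: "continuous_on (sphere 0 r) (g z j)" if "z \<in> {-1, s}" for z j
    unfolding g_def node_powi by (intro continuous_intros continuous_on_Psi that)
  have sums: "(\<lambda>j. CT r (g z j)) sums CT r (\<lambda>T. \<Sum>j. g z j T)"
    and contS: "continuous_on (sphere 0 r) (\<lambda>T. \<Sum>j. g z j T)" if z: "z \<in> {-1, s}" for z
  proof -
    obtain B where B: "\<And>j T. T \<in> sphere 0 r \<Longrightarrow> norm (1 / qpoch_inf (node z 0 j / T) q) \<le> B"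
    proof (rule uniform_limit_const_imp_bounded[OF uniform_limit_node[OF z]])
      show "continuous_on (sphere 0 r) (\<lambda>T. 1 / qpoch_inf (node z 0 j / T) q)" for j
      proof -
        have "qpoch_inf (node z 0 j / T) q \<noteq> 0" if "norm T = r" for T
          unfolding node_powi by (rule qpoch_inf_node_div[OF on_circle_r[OF that] z])
        then show ?thesis by (intro continuous_intros q) (use r in auto)
      qed
    qed (use that in auto)
    have "bounded (H ` sphere 0 r)"
      unfolding H_def by (intro compact_imp_bounded compact_continuous_image continuous_on_Psi0) simp
    then obtain C where "\<And>w. w \<in> H ` sphere 0 r \<Longrightarrow> norm w \<le> C" unfolding bounded_iff by blast
    then have C: "norm (H T) \<le> C" if "norm T = r" for T using that by simp
    have "(\<lambda>j. W (node z 0 j)) \<longlonglongrightarrow> W 0"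
      by (rule isCont_tendsto_compose[OF isCont_W node_tendsto_0])
    then have "Bseq (\<lambda>j. W (node z 0 j))" by (intro convergent_imp_Bseq convergentI)
    then obtain K where K: "\<And>j. norm (W (node z 0 j)) \<le> K" by (auto simp: Bseq_def)
    have bound: "norm (g z j T) \<le> K * (C * B) * norm z * norm q ^ j" if T: "norm T = r" for j T
    proof -
      have C0: "0 \<le> C" using C[OF T] norm_ge_zero order_trans by blast
      have B0: "0 \<le> B" using B[of T 0] T norm_ge_zero order_trans by (metis mem_sphere_0)
      have K0: "0 \<le> K" using K[of 0] norm_ge_zero order_trans by blast
      have "norm (W (node z 0 j)) * (norm (H T) * norm (1 / qpoch_inf (node z 0 j / T) q)) \<le> K * (C * B)"
        using T by (intro mult_mono K C B mult_nonneg_nonneg C0 B0 K0 norm_ge_zero) auto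
      from mult_right_mono[OF this, of "norm z * norm q ^ j"] show ?thesis
        by (simp add: g_def Psi_alt H_def node_def norm_mult norm_power norm_divide mult_ac)
    qed
    have M: "summable (\<lambda>j. K * (C * B) * norm z * norm q ^ j)"
      using q by (intro summable_mult summable_geometric) auto
    show "(\<lambda>j. CT r (g z j)) sums CT r (\<lambda>T. \<Sum>j. g z j T)"
      by (rule CT_sums[OF r(1) contg[OF z] bound M])
    have "uniform_limit (sphere 0 r) (\<lambda>N T. \<Sum>j<N. g z j T) (\<lambda>T. \<Sum>j. g z j T) sequentially"
      by (rule Weierstrass_m_test[OF _ M]) (use bound in auto)
    then show "continuous_on (sphere 0 r) (\<lambda>T. \<Sum>j. g z j T)"
      by (rule uniform_limit_theorem[rotated]) (auto intro!: always_eventually continuous_intros contg[OF z])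
  qed
  have z1: "-1 \<in> {-1, s}" "s \<in> {-1, s}" by auto
  have "(\<Sum>j. W (node z 0 j) * f k (node z 0 j) * node z 0 j) = pref k * CT r (\<lambda>T. \<Sum>j. g z j T)" if z: "z \<in> {-1, s}" for z
  proof -
    have "CT r (g z j) = W (node z 0 j) * node z 0 j * CT r (Psi k (node z 0 j))" for j
      unfolding g_def CT_mult[symmetric] by (simp add: mult_ac)
    then have "pref k * CT r (g z j) = W (node z 0 j) * f k (node z 0 j) * node z 0 j" for j
      by (simp add: f_def mult_ac)
    moreover have "(\<lambda>j. pref k * CT r (g z j)) sums (pref k * CT r (\<lambda>T. \<Sum>j. g z j T))"
      by (rule sums_mult[OF sums[OF z]])
    ultimately show ?thesis by (simp add: sums_iff)
  qed
  then have "J 0 (\<lambda>y. W y * f k y) = (1 - q) * (pref k * CT r (\<lambda>T. \<Sum>j. g s j T) - pref k * CT r (\<lambda>T. \<Sum>j. g (-1) j T))"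
    unfolding J_eq using z1 by simp
  also have "\<dots> = pref k * ((1 - q) * CT r (\<lambda>T. (\<Sum>j. g s j T) - (\<Sum>j. g (-1) j T)))"
    unfolding CT_diff[OF r(1) contS[OF z1(2)] contS[OF z1(1)]] by (simp add: algebra_simps)
  also have "(1 - q) * CT r (\<lambda>T. (\<Sum>j. g s j T) - (\<Sum>j. g (-1) j T)) =
     CT r (\<lambda>T. (1 - q) * ((\<Sum>j. g s j T) - (\<Sum>j. g (-1) j T)))"
    by (rule CT_mult[symmetric])
  also have "\<dots> = CT r (\<lambda>T. ((1 - q) * qpoch_inf q q * qtheta (- s) q) *
     (T powi (- k) * (qpoch_inf (- q * T) q * qpoch_inf (q * T / s) q / D T)))"
  proof (rule CT_cong[OF r(1)])
    fix T :: complex assume "norm T = r"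
    then have T: "on_circle T" by (rule on_circle_r)
    have adm: "admissible 0 (1 / T)"
      unfolding admissible_def node_powi times_divide_eq_left mult_1_left
      by (intro ballI allI qpoch_inf_node_div[OF T])
    have nz: "qpoch_inf (- 1 / T) q \<noteq> 0" "qpoch_inf (s / T) q \<noteq> 0"
      using qpoch_inf_node_div[OF T z1(1), of 0] qpoch_inf_node_div[OF T z1(2), of 0] by auto
    have g_eq: "g z j T = H T * (W (node z 0 j) * E (1 / T) 0 (node z 0 j) * node z 0 j)" for z j
      by (simp add: g_def Psi_alt H_def E_def)
    have H0: "(\<Sum>j. g z j T) = H T * (\<Sum>j. W (node z 0 j) * E (1 / T) 0 (node z 0 j) * node z 0 j)" if z: "z \<in> {-1, s}" for z
      unfolding g_eq
      by (intro suminf_mult summable_node[OF _ z] isCont_regular continuous_intros isCont_W isCont_E)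
    have "(1 - q) * ((\<Sum>j. g s j T) - (\<Sum>j. g (-1) j T)) = H T * J 0 (\<lambda>y. W y * E (1 / T) 0 y)"
      unfolding J_eq H0[OF z1(1)] H0[OF z1(2)] by (simp add: algebra_simps)
    also have "J 0 (\<lambda>y. W y * E (1 / T) 0 y) = (1 - q) * qpoch_inf q q * qtheta (- s) q / (qpoch_inf (- 1 / T) q * qpoch_inf (s / T) q)"
      using J_W_E[OF assms adm admissible_0] by simp
    \<comment> \<open>The two denominators cancel the first factors of the theta functions in
      \<open>Th\<close>, leaving the numerator of the generating function.\<close>
    also have "H T * \<dots> = ((1 - q) * qpoch_inf q q * qtheta (- s) q) *
     (T powi (- k) * (qpoch_inf (- q * T) q * qpoch_inf (q * T / s) q / D T))"
      unfolding H_def Th_def qtheta_def[of "- 1 / T"] qtheta_def[of "s / T"] using nz by (simp add: mult_ac)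
    finally show "(1 - q) * ((\<Sum>j. g s j T) - (\<Sum>j. g (-1) j T)) = ((1 - q) * qpoch_inf q q * qtheta (- s) q) *
     (T powi (- k) * (qpoch_inf (- q * T) q * qpoch_inf (q * T / s) q / D T))" .
  qed
  finally show ?thesis unfolding CT_mult by (simp add: mult_ac)
qed

lemma CT_coeff_negative:
  assumes "g holomorphic_on ball 0 R" "k < 0"
  shows "CT r (\<lambda>T. T powi (- k) * g T) = 0"
proof -
  have "CT r (\<lambda>T. T powi (- k) * g T) = 0 powi (- k) * g 0"
    by (rule CT_holomorphic[OF _ r]) (use assms in \<open>auto intro!: holomorphic_intros\<close>)
  then show ?thesis using assms(2) by (simp add: power_int_0_left_if)
qed

text \<open>The function \<open>g\<close> is a generating function of Al-Salam--Chihara polynomials.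
  Its first-order \<open>q\<close>-difference equation becomes a three-term recurrence for the
  Taylor coefficients, to be compared with \<open>cdqHahn_recurrence\<close> divided by
  \<open>(q;q)_k\<close>.\<close>

lemma CT_coeff:
  fixes k :: nat
  defines "g \<equiv> \<lambda>T. qpoch_inf (- q * T) q * qpoch_inf (q * T / s) q / D T"
  shows "CT r (\<lambda>T. T powi (- int k) * g T) = \<alpha> ^ k * cdqHahn k x (- q / \<alpha>) (q / (s * \<alpha>)) 0 q / qpoch q q k"
    and "j < 0 \<Longrightarrow> CT r (\<lambda>T. T powi (- j) * g T) = 0"
proof -
  have hol: "g holomorphic_on ball 0 R"
    unfolding g_def by (intro holomorphic_intros holomorphic_D D_nonzero q s) auto
  define \<xi> where "\<xi> = (\<lambda>k. CT r (\<lambda>T. T powi (- k) * g T))"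
  have neg: "\<xi> j = 0" if "j < 0" for j unfolding \<xi>_def by (rule CT_coeff_negative[OF hol that])
  then show "j < 0 \<Longrightarrow> CT r (\<lambda>T. T powi (- j) * g T) = 0" unfolding \<xi>_def by blast
  have \<xi>0: "\<xi> 0 = 1" unfolding \<xi>_def using CT_holomorphic[OF hol r] by (simp add: g_def D_def)
  have hol': "(\<lambda>T. T powi (- k) * g T) holomorphic_on ball 0 R - {0}" for k
    by (intro holomorphic_intros holomorphic_on_subset[OF hol]) auto
  have sub: "sphere 0 r \<subseteq> ball 0 R - {0}" using r by auto
  have cont: "continuous_on (sphere 0 r) (\<lambda>T. T powi (- k) * g T)" for k
    using holomorphic_on_imp_continuous_on[OF hol'] sub by (rule continuous_on_subset)
  have \<xi>q: "CT r (\<lambda>T. T powi (- k) * g (q * T)) = q powi k * \<xi> k" for k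
  proof -
    have "CT r (\<lambda>T. T powi (- k) * g (q * T)) = CT r (\<lambda>T. q powi k * ((q * T) powi (- k) * g (q * T)))"
      using q by (intro CT_cong r) (simp add: power_int_mult_distrib power_int_minus)
    also have "\<dots> = q powi k * \<xi> k"
      unfolding CT_mult CT_q_shift[OF hol' r] \<xi>_def ..
    finally show ?thesis .
  qed
  have contq: "continuous_on (sphere 0 r) (\<lambda>T. T powi (- k) * g (q * T))" for k
  proof -
    have "continuous_on (sphere 0 r) (\<lambda>T. g (q * T))"
    proof (rule continuous_on_compose2[OF holomorphic_on_imp_continuous_on[OF hol]])
      show "(\<lambda>T. q * T) ` sphere 0 r \<subseteq> ball 0 R" using on_circleD(2)[OF on_circle_q] by auto
    qed (intro continuous_intros)
    then show ?thesis by (intro continuous_intros) (use r in auto)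
  qed
  \<comment> \<open>Coefficients of
    \<open>(1 - cT)(1 - dT) g(T) = (1 + qT)(1 - qT/s) g(qT)\<close>.\<close>
  have rec: "(1 - q powi k) * \<xi> k = (c + d + q powi k - q powi k / s) * \<xi> (k - 1) - (c * d + q powi k / s) * \<xi> (k - 2)" for k
  proof -
    have 1: "T powi (- k) * g T - ((c + d) * (T powi (- (k - 1)) * g T) - c * d * (T powi (- (k - 2)) * g T))
      = T powi (- k) * g (q * T) - ((q / s - q) * (T powi (- (k - 1)) * g (q * T)) - (- (q ^ 2 / s)) * (T powi (- (k - 2)) * g (q * T)))"
      if "norm T = r" for T
    proof -
      have T: "on_circle T" using that by (rule on_circle_r)
      have T0: "T \<noteq> 0" by (rule on_circleD(1)[OF T])
      have D: "D T \<noteq> 0" by (rule D_nonzero[OF on_circleD(2)[OF T]])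
      have t: "T powi (- (k - 1)) = T powi (- k) * T" "T powi (- (k - 2)) = T powi (- k) * (T * T)"
        using power_int_add[of T "- k" 1] power_int_add[of T "- k" 2] T0 by (simp_all add: power2_eq_square)
      have r': "qpoch_inf (\<delta> * T) q = (1 - \<delta> * T) * qpoch_inf (\<delta> * (q * T)) q" for \<delta>
        using qpoch_inf_rec[OF q(1), of "\<delta> * T"] by (simp add: mult_ac)
      have DT: "D T = (1 - c * T) * (1 - d * T) * D (q * T)"
        unfolding D_def r'[of c] r'[of d] by (simp only: mult_ac)
      have n: "qpoch_inf (- q * T) q = (1 + q * T) * qpoch_inf (- q * (q * T)) q"
        "qpoch_inf (q * T / s) q = (1 - q * T / s) * qpoch_inf (q * (q * T) / s) q"
        using r'[of "- q"] r'[of "q / s"] by simp_all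
      have gen: "u * (a / (u * v)) = a / v" if "u * v \<noteq> 0" for u v a :: complex using that by simp
      have "(1 - c * T) * (1 - d * T) * g T = (1 + q * T) * qpoch_inf (- q * (q * T)) q * ((1 - q * T / s) * qpoch_inf (q * (q * T) / s) q) / D (q * T)"
        unfolding g_def n DT by (rule gen) (use D DT in simp)
      then have gq: "(1 - c * T) * (1 - d * T) * g T = (1 + q * T) * (1 - q * T / s) * g (q * T)"
        unfolding g_def by (simp only: times_divide_eq_right mult_ac)
      have "T powi (- k) * g T - ((c + d) * (T powi (- (k - 1)) * g T) - c * d * (T powi (- (k - 2)) * g T))
        = T powi (- k) * ((1 - c * T) * (1 - d * T) * g T)" unfolding t by (simp add: algebra_simps)
      also have "\<dots> = T powi (- k) * g (q * T) - ((q / s - q) * (T powi (- (k - 1)) * g (q * T)) - (- (q ^ 2 / s)) * (T powi (- (k - 2)) * g (q * T)))"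
        unfolding gq t using s by (simp add: field_simps power2_eq_square)
      finally show ?thesis .
    qed
    have L: "CT r (\<lambda>T. T powi (- k) * g T - ((c + d) * (T powi (- (k - 1)) * g T) - c * d * (T powi (- (k - 2)) * g T)))
       = \<xi> k - ((c + d) * \<xi> (k - 1) - c * d * \<xi> (k - 2))"
      unfolding \<xi>_def by (rule CT_diff_linear(1)[OF r(1) cont cont cont])
    have Rr: "CT r (\<lambda>T. T powi (- k) * g (q * T) - ((q / s - q) * (T powi (- (k - 1)) * g (q * T)) - (- (q ^ 2 / s)) * (T powi (- (k - 2)) * g (q * T))))
       = q powi k * \<xi> k - ((q / s - q) * (q powi (k - 1) * \<xi> (k - 1)) - (- (q ^ 2 / s)) * (q powi (k - 2) * \<xi> (k - 2)))"
      unfolding \<xi>q[symmetric] by (rule CT_diff_linear(1)[OF r(1) contq contq contq])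
    have "\<xi> k - ((c + d) * \<xi> (k - 1) - c * d * \<xi> (k - 2)) = q powi k * \<xi> k - ((q / s - q) * (q powi (k - 1) * \<xi> (k - 1)) - (- (q ^ 2 / s)) * (q powi (k - 2) * \<xi> (k - 2)))"
      unfolding L[symmetric] Rr[symmetric] by (rule CT_cong[OF r(1) 1])
    moreover have "(q / s - q) * (q powi (k - 1) * X) = (1 / s - 1) * q powi k * X"
      "- (q ^ 2 / s) * (q powi (k - 2) * X) = - (q powi k / s) * X" for X
      using q s by (simp_all add: power_int_diff field_simps)
    ultimately have e: "\<xi> k - ((c + d) * \<xi> (k - 1) - c * d * \<xi> (k - 2)) = q powi k * \<xi> k - ((1 / s - 1) * q powi k * \<xi> (k - 1) - (- (q powi k / s)) * \<xi> (k - 2))"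
      by (simp only:)
    have alg: "(1 - p) * a = (C + p - ps) * b - (m + ps) * e" if "a - (C * b - m * e) = p * a - ((ps - p) * b - (- ps) * e)" for a b C m p ps e :: complex
      using that by (simp add: algebra_simps)
    show ?thesis by (rule alg) (use e in \<open>simp add: left_diff_distrib\<close>)
  qed
  define h where "h = (\<lambda>k. \<alpha> ^ k * cdqHahn k x (- q / \<alpha>) (q / (s * \<alpha>)) 0 q / qpoch q q k)"
  have a0: "- q / \<alpha> \<noteq> 0" using \<alpha> q by simp
  note cr = cdqHahn_recurrence[OF q a0 x, where b = "q / (s * \<alpha>)"]
  have sum: "c + d = \<alpha> * (x + 1 / x)" by (simp add: algebra_simps)
  have ab: "\<alpha> * (- q / \<alpha> + q / (s * \<alpha>)) = q / s - q" and ab': "\<alpha> * \<alpha> * ((- q / \<alpha>) * (q / (s * \<alpha>))) = - (q * q / s)"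
    using \<alpha> s by (simp_all add: field_simps)
  have nzq: "1 - q * q ^ k \<noteq> 0" for k by (rule one_minus_power_neq_0[OF q(1)])
  have "\<xi> (int k) = h k \<and> \<xi> (int (Suc k)) = h (Suc k)"
  proof (induction k)
    case 0
    \<comment> \<open>The coefficient of index -1 is 0 by holomorphy at 0, so
      \<open>\<xi> 0 = 1\<close> alone starts the recurrence.\<close>
    have "(1 - q) * \<xi> 1 = c + d + q - q / s" using rec[of 1] neg[of "-1"] \<xi>0 by simp
    also have "\<dots> = \<alpha> * (x + 1 / x) - (q / s - q)" unfolding sum by simp
    also have "\<dots> = \<alpha> * cdqHahn (Suc 0) x (- q / \<alpha>) (q / (s * \<alpha>)) 0 q"
      unfolding cr(2) ab[symmetric] by (simp only: right_diff_distrib)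
    finally have "\<xi> 1 = h (Suc 0)" using nzq[of 0] by (simp add: h_def qpoch_Suc field_simps)
    then show ?case using \<xi>0 by (simp add: h_def)
  next
    case (Suc k)
    define p where "p = (\<lambda>k. cdqHahn k x (- q / \<alpha>) (q / (s * \<alpha>)) 0 q)"
    have i: "int (Suc (Suc k)) - 1 = int (Suc k)" "int (Suc (Suc k)) - 2 = int k" by simp_all
    have "(1 - q * q ^ Suc k) * \<xi> (int (Suc (Suc k))) = (c + d + q * q ^ Suc k - q * q ^ Suc k / s) * h (Suc k) - (c * d + q * q ^ Suc k / s) * h k"
      using rec[of "int (Suc (Suc k))"] Suc.IH unfolding i power_int_of_nat by simp
    also have "\<dots> = (1 - q * q ^ Suc k) * h (Suc (Suc k))"
    proof -
      define m where "m = \<alpha> ^ k / qpoch q q (Suc k)"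
      have m: "h k = m * (1 - q * q ^ k) * p k" "h (Suc k) = m * \<alpha> * p (Suc k)"
        "(1 - q * q ^ Suc k) * h (Suc (Suc k)) = m * \<alpha> * \<alpha> * p (Suc (Suc k))"
        using nzq[of k] nzq[of "Suc k"] qpoch_q_neq_0[OF q(1), of k] by (simp_all add: h_def m_def p_def qpoch_Suc divide_simps)
      have "\<alpha> * \<alpha> * p (Suc (Suc k)) = \<alpha> * (\<alpha> * (x + 1 / x) - \<alpha> * (- q / \<alpha> + q / (s * \<alpha>)) * q ^ Suc k) * p (Suc k)
         - (1 - q ^ Suc k) * (\<alpha> * \<alpha> - \<alpha> * \<alpha> * ((- q / \<alpha>) * (q / (s * \<alpha>))) * q ^ k) * p k"
        unfolding p_def cr(1) by (simp only: right_diff_distrib left_diff_distrib mult_ac mult_1 mult_1_right)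
      also have "\<dots> = \<alpha> * (c + d + q * q ^ Suc k - q * q ^ Suc k / s) * p (Suc k) - (1 - q * q ^ k) * (c * d + q * q ^ Suc k / s) * p k"
        unfolding ab ab' sum[symmetric] cd power2_eq_square using s by (simp add: field_simps)
      finally have pp: "\<alpha> * \<alpha> * p (Suc (Suc k)) = \<alpha> * (c + d + q * q ^ Suc k - q * q ^ Suc k / s) * p (Suc k) - (1 - q * q ^ k) * (c * d + q * q ^ Suc k / s) * p k" .
      have mm: "m * \<alpha> * \<alpha> * p (Suc (Suc k)) = m * (\<alpha> * \<alpha> * p (Suc (Suc k)))" by (simp only: mult_ac)
      have gen: "v * (m * \<alpha> * p1) - w * (m * u * p0) = m * (\<alpha> * v * p1 - u * w * p0)" for u v w p0 p1
        by (simp add: algebra_simps)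
      show ?thesis unfolding m mm pp by (rule gen)
    qed
    finally have "\<xi> (int (Suc (Suc k))) = h (Suc (Suc k))" using nzq[of "Suc k"] by simp
    then show ?case using Suc.IH by simp
  qed
  then show "CT r (\<lambda>T. T powi (- int k) * g T) = \<alpha> ^ k * cdqHahn k x (- q / \<alpha>) (q / (s * \<alpha>)) 0 q / qpoch q q k"
    unfolding \<xi>_def h_def by blast
qed

end

section \<open>Evaluation of the two integrals\<close>

lemma twice_triangular: "2 * int (m * (m - 1) div 2) = int m * (int m - 1)" "2 * (i * (i - 1) div 2) = i * (i - 1)" for i :: int
proof -
  show 1: "2 * (i * (i - 1) div 2) = i * (i - 1)" for i :: int by simp
  have "int (m * (m - 1) div 2) = int m * (int m - 1) div 2"
    by (cases m) (auto simp: zdiv_int algebra_simps)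
  then show "2 * int (m * (m - 1) div 2) = int m * (int m - 1)" using 1[of "int m"] by simp
qed

context dual_hahn
begin

lemma neg_square_power: "(- (\<alpha> ^ 2)) ^ n = (-1) ^ n * (\<alpha> ^ n * \<alpha> ^ n)"
  unfolding power_minus[of "\<alpha> ^ 2" n] unfolding power2_eq_square power_mult_distrib ..

lemma weighted_eq:
  "cdqHahn n x (- q / \<alpha>) (q / (s * \<alpha>)) (\<alpha> * y) q * U * Q * (qpoch_inf (- y * q ^ (1 + n)) q * qpoch_inf (y * q ^ (1 + n) / s) q * E c d y)
   = 1 / \<alpha> ^ n * (w n y * (U * Q))"
  using \<alpha> by (simp add: w_def)

text \<open>The left side is the exponent of \<open>T\<close> reduced by the triangular number
  contributed by the integral of index \<open>K\<close>; on the right, \<open>-m\<close> is reserved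
  for the factor \<open>(s/q)^m\<close>. Doubling removes every \<open>div\<close> before the
  comparison.\<close>

lemma exponent_eq:
  fixes k :: int and m :: nat
  defines "K \<equiv> int m + k - int n"
  shows "int m * (int m + k - 1) + int (m * (m - 1) div 2) - 2 * int m * int n - k * int n + int (n * (n - 1) div 2)
      - K * (K - 1) div 2 = int m * (int m - int n) - int n - int m - k * (k - 1) div 2"
proof -
  define A where "A = int (m * (m - 1) div 2)"
  define N where "N = int (n * (n - 1) div 2)"
  define u where "u = K * (K - 1) div 2"
  define v where "v = k * (k - 1) div 2"
  have "2 * A = int m * (int m - 1)" "2 * N = int n * (int n - 1)" "2 * u = K * (K - 1)" "2 * v = k * (k - 1)"
    unfolding A_def N_def u_def v_def by (rule twice_triangular)+
  then have "2 * (int m * (int m + k - 1) + A - 2 * int m * int n - k * int n + N - u)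
      = 2 * (int m * (int m - int n) - int n - int m - v)"
    unfolding K_def right_diff_distrib[of 2] distrib_left[of 2] by (simp only:) (simp add: algebra_simps)
  then show ?thesis unfolding A_def[symmetric] N_def[symmetric] u_def[symmetric] v_def[symmetric] by simp
qed

text \<open>The finite products \<open>(-cds;q)_K\<close> and \<open>(q;q)_K\<close> split off from
  the infinite ones and cancel; the tails starting at \<open>-cds q^K\<close> and
  \<open>q^(K+1)\<close> are those of the final formula.\<close>

lemma F_P_eq:
  assumes "qtheta (- s) q \<noteq> 0" and "\<And>k. qpoch (- c * d * s) q k \<noteq> 0"
  shows "F_P (int K) = (-1) ^ K / q ^ (K * (K - 1) div 2) * ((1 - q) * qtheta (- s) q * (qpoch_inf (q ^ Suc K) q * qpoch_inf (- c * d * s * q ^ K) q) /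
     (qpoch_inf (- c) q * qpoch_inf (c * s) q * (qpoch_inf (- d) q * qpoch_inf (d * s) q))) * (\<alpha> ^ K * cdqHahn K x (\<alpha> * s) (- \<alpha>) 0 q)"
proof -
  have adm0: "admissible 0 c" "admissible 0 d" using adm admissible_le by auto
  define t where "t = (-1) ^ K / q ^ (K * (K - 1) div 2)"
  define G where "G = J 0 (\<lambda>y. W y * E c d y * asc2Poly q c d K y)"
  define V where "V = qpoch_inf (- c) q * qpoch_inf (c * s) q * (qpoch_inf (- d) q * qpoch_inf (d * s) q)"
  have reg: "regular (\<lambda>y. W y * E c d y * asc2Poly q c d K y)"
    by (intro isCont_regular continuous_intros isCont_W isCont_E)
  have "J 0 (\<lambda>y. W y * E c d y * P (int K) y) = J 0 (\<lambda>y. t * (W y * E c d y * asc2Poly q c d K y))"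
    unfolding P_int t_def by (simp add: mult_ac)
  also have "\<dots> = t * G" unfolding G_def by (rule J_mult[OF reg])
  finally have 1: "F_P (int K) = t * G / qpoch q q K" by (simp add: F_P_def)
  have "G * qpoch (- c * d * s) q K = (1 - q) * qpoch_inf q q * qtheta (- s) q * qpoch_inf (- c * d * s) q / V * (\<alpha> ^ K * cdqHahn K x (\<alpha> * s) (- \<alpha>) 0 q)"
    unfolding G_def J_W_E_asc2Poly J_W_E[OF assms(1) adm0] V_def ..
  also have "qpoch_inf (- c * d * s) q = qpoch (- c * d * s) q K * qpoch_inf (- c * d * s * q ^ K) q"
    by (rule qpoch_inf_split[OF q(1)])
  also have "qpoch_inf q q = qpoch q q K * qpoch_inf (q ^ Suc K) q"
    using qpoch_inf_split[OF q(1), of q K] by simp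
  finally have "G * qpoch (- c * d * s) q K = (qpoch q q K * ((1 - q) * qtheta (- s) q * (qpoch_inf (q ^ Suc K) q * qpoch_inf (- c * d * s * q ^ K) q) / V)
     * (\<alpha> ^ K * cdqHahn K x (\<alpha> * s) (- \<alpha>) 0 q)) * qpoch (- c * d * s) q K"
    by (simp add: mult_ac)
  then have "G = qpoch q q K * ((1 - q) * qtheta (- s) q * (qpoch_inf (q ^ Suc K) q * qpoch_inf (- c * d * s * q ^ K) q) / V)
     * (\<alpha> ^ K * cdqHahn K x (\<alpha> * s) (- \<alpha>) 0 q)" by (simp only: mult_right_cancel[OF assms(2)[of K]])
  then show ?thesis unfolding 1 t_def[symmetric] V_def[symmetric] using qpoch_q_neq_0[OF q(1), of K] by simp
qed

theorem first_integral:
  fixes k m :: nat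
  assumes "qtheta (- s) q \<noteq> 0" and "\<And>k. qpoch (- c * d * s) q k \<noteq> 0"
  defines "K \<equiv> int m - int n + int k"
  shows "J n (\<lambda>y. cdqHahn n x (- q / \<alpha>) (q / (s * \<alpha>)) (\<alpha> * y) q * ascPoly q (- s) m (- y * q ^ n) * alSalamCarlitz2 k y c d q
       * (qpoch_inf (- y * q ^ (1 + n)) q * qpoch_inf (y * q ^ (1 + n) / s) q * E c d y))
   = qpoch q q k * qtheta (- s) q * ((1 - q) * (-1) ^ k * \<alpha> ^ (m + k) * (s / q) ^ m * q powi (- int n) * q powi (int m * (int m - int n))
       * q powi (- (int k * (int k - 1) div 2))
       * (qpoch_inf (q powi (K + 1)) q * qpoch_inf (- c * d * s * q powi K) q /
         (qpoch_inf (- c) q * qpoch_inf (c * s) q * (qpoch_inf (- d) q * qpoch_inf (d * s) q)))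
       * alSalamChihara K x (\<alpha> * s) (- \<alpha>) q
       * bigqLaguerre_norm m (q ^ Suc k) (q powi (int n - int m)) (- q / (\<alpha> ^ 2 * s) * q powi (int n - int m)) q)"
proof -
  interpret L: ladder q s n w P "{0..}" c d "\<alpha> ^ 2" 1 1 "\<lambda>k. qpoch q q (nat k)" F_P
    "\<lambda>i m k. bigqLaguerre_norm m (q powi (k + 1) / 1) (q powi (int i - int m))
      (- q / (1 * \<alpha> ^ 2 * 1 * s) * q powi (int i - int m)) q"
    by (rule ladder_P)
  define Lm where "Lm = bigqLaguerre_norm m (q ^ Suc k) (q powi (int n - int m)) (- q / (\<alpha> ^ 2 * s) * q powi (int n - int m)) q"
  have "q powi (int k + 1) = q ^ Suc k" using q by (simp add: power_int_add)
  then have Lm: "bigqLaguerre_norm m (q powi (int k + 1) / 1) (q powi (int n - int m)) (- q / (1 * \<alpha> ^ 2 * 1 * s) * q powi (int n - int m)) q = Lm"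
    by (simp add: Lm_def)
  have regX: "regular (\<lambda>y. w n y * (ascPoly q (- s) m (- y * q ^ n) * P (int k) y))"
    by (intro regular_mult regular_w regular_P isCont_regular continuous_intros)
  have "J n (\<lambda>y. cdqHahn n x (- q / \<alpha>) (q / (s * \<alpha>)) (\<alpha> * y) q * ascPoly q (- s) m (- y * q ^ n) * alSalamCarlitz2 k y c d q
       * (qpoch_inf (- y * q ^ (1 + n)) q * qpoch_inf (y * q ^ (1 + n) / s) q * E c d y)) = 1 / \<alpha> ^ n * L.X n m (int k)"
    unfolding weighted_eq P_eq L.X_def J_mult[OF regX] ..
  also have "L.X n m (int k) = qpoch q q k * L.T n m (int k)" using L.X_eq[of n "int k" m] by simp
  finally have main: "J n (\<lambda>y. cdqHahn n x (- q / \<alpha>) (q / (s * \<alpha>)) (\<alpha> * y) q * ascPoly q (- s) m (- y * q ^ n) * alSalamCarlitz2 k y c d q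
       * (qpoch_inf (- y * q ^ (1 + n)) q * qpoch_inf (y * q ^ (1 + n) / s) q * E c d y)) = qpoch q q k * (1 / \<alpha> ^ n * L.T n m (int k))" by simp
  have T: "L.T n m (int k) = (- s) ^ m * (- (\<alpha> ^ 2)) ^ n * q powi (L.expo n m (int k)) * Lm * F_P K"
    unfolding L.T_def Lm K_def by (simp add: algebra_simps)
  show ?thesis
  \<comment> \<open>For negative \<open>K\<close> both sides vanish: \<open>F_P\<close> is 0, and so
    is the Al-Salam--Chihara polynomial of negative degree.\<close>
  proof (cases "K < 0")
    case True
    then show ?thesis unfolding main T by (simp add: F_P_def alSalamChihara_def)
  next
    case False
    then obtain K' where K': "K = int K'" by (metis nonneg_int_cases not_less)
    define V where "V = qpoch_inf (q ^ Suc K') q * qpoch_inf (- c * d * s * q ^ K') q /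
         (qpoch_inf (- c) q * qpoch_inf (c * s) q * (qpoch_inf (- d) q * qpoch_inf (d * s) q))"
    define h where "h = cdqHahn K' x (\<alpha> * s) (- \<alpha>) 0 q"
    have K1: "q powi (K + 1) = q ^ Suc K'" unfolding K' using q by (simp add: power_int_add)
    have asc: "alSalamChihara K x (\<alpha> * s) (- \<alpha>) q = h" by (simp add: alSalamChihara_def K' h_def)
    have FP: "F_P K = (-1) ^ K' / q ^ (K' * (K' - 1) div 2) * ((1 - q) * qtheta (- s) q * V) * (\<alpha> ^ K' * h)"
      unfolding K' F_P_eq[OF assms(1,2)] V_def h_def by simp
    have KK: "m + k = n + K'" using K' unfolding K_def by linarith
    have e: "q powi (L.expo n m (int k)) / q ^ (K' * (K' - 1) div 2) = q powi (- int n) * q powi (int m * (int m - int n)) * q powi (- (int k * (int k - 1) div 2)) / q ^ m"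
    proof -
      have "int (K' * (K' - 1) div 2) = K * (K - 1) div 2"
        using twice_triangular(1)[of K'] twice_triangular(2)[of K] unfolding K' by linarith
      then have "L.expo n m (int k) + - int (K' * (K' - 1) div 2) = - int n + int m * (int m - int n) + - (int k * (int k - 1) div 2) + - int m"
        using exponent_eq[of m "int k"] unfolding L.expo_def K_def by (simp add: algebra_simps)
      then have "q powi (L.expo n m (int k) + - int (K' * (K' - 1) div 2)) = q powi (- int n + int m * (int m - int n) + - (int k * (int k - 1) div 2) + - int m)"
        by (rule arg_cong)
      then show ?thesis unfolding L.q_powi_add power_int_minus[of q "int _"] power_int_of_nat divide_inverse .
    qed
    have sg: "1 / \<alpha> ^ n * ((- s) ^ m * (- (\<alpha> ^ 2)) ^ n * ((-1) ^ K' * \<alpha> ^ K')) = (-1) ^ k * \<alpha> ^ (m + k) * s ^ m"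
    proof -
      have "(- s) ^ m * (- (\<alpha> ^ 2)) ^ n * ((-1) ^ K' * \<alpha> ^ K') = (-1) ^ (m + (n + K')) * s ^ m * \<alpha> ^ n * (\<alpha> ^ (n + K'))"
        unfolding neg_square_power by (simp add: power_minus[of s] power_add)
      also have "(-1) ^ (m + (n + K')) = ((-1) ^ k :: complex)" unfolding KK[symmetric] by (simp add: power_add flip: power_mult_distrib)
      finally show ?thesis unfolding KK using \<alpha> by simp
    qed
    have "1 / \<alpha> ^ n * L.T n m (int k) = (1 / \<alpha> ^ n * ((- s) ^ m * (- (\<alpha> ^ 2)) ^ n * ((-1) ^ K' * \<alpha> ^ K'))) *
        (q powi (L.expo n m (int k)) / q ^ (K' * (K' - 1) div 2)) * ((1 - q) * qtheta (- s) q * V) * h * Lm"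
      unfolding T FP by simp
    then show ?thesis
      unfolding main asc K1 unfolding K' power_int_of_nat V_def[symmetric] Lm_def[symmetric] sg e
      by (simp add: power_divide)
  qed
qed

end

section \<open>The functions \<open>Q_k\<close> as a ladder and the second integral\<close>

context dual_hahn_contour
begin

definition Q :: "int \<Rightarrow> complex \<Rightarrow> complex" where
  "Q k y = Qfun k y c d (-1) s q"

text \<open>With \<open>k\<close> in all integers no finite product can start at 0; the reciprocal
  of the infinite product solves the same recursion \<open>Gam_Suc\<close>.\<close>

definition Gam_Q :: "int \<Rightarrow> complex" where
  "Gam_Q k = 1 / qpoch_inf (q powi (k + 1) / (- c * d * s / q)) q"

definition F_Q :: "int \<Rightarrow> complex" where
  "F_Q k = J 0 (\<lambda>y. W y * E c d y * Q k y) / Gam_Q k"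

lemma Q_node:
  assumes "z \<in> {-1, s}"
  shows "Q k (node z N j) = f k (node z N j) * (qpoch_inf (c * node z N j) q * qpoch_inf (d * node z N j) q)"
  unfolding Q_def by (rule Qfun_eq[OF assms node_powi])

lemma Q_E_node:
  assumes "z \<in> {-1, s}"
  shows "Q k (node z 0 j) * E c d (node z 0 j) = f k (node z 0 j)"
proof -
  have "admissible 0 c" "admissible 0 d" using adm admissible_le by auto
  then show ?thesis unfolding Q_node[OF assms] E_def
    using admissibleD[OF _ assms, of 0 c j] admissibleD[OF _ assms, of 0 d j] by simp
qed

lemma regular_Q: "regular (Q k)"
proof (rule regular_cong)
  show "regular (\<lambda>y. f k y * (qpoch_inf (c * y) q * qpoch_inf (d * y) q))"
    by (intro regular_mult regular_f isCont_regular continuous_intros q)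
qed (simp only: Q_node)

lemma ladder_Q:
  assumes nz: "\<And>k. qpoch_inf (q powi k / (- c * d * s / q)) q \<noteq> 0"
  shows "ladder q s n w Q UNIV c d (- (1 / s)) (- c * d * s / q) q Gam_Q F_Q"
proof unfold_locales
  show "regular (w i)" for i by (rule regular_w)
  show "w (Suc i) (node z (Suc i) j) = (w i (node z (Suc i) j) - w i (node z i j)) / node z (Suc i) j"
    if "i < n" "z \<in> {-1, s}" for i z j
    by (rule w_Suc[OF that])
  show "w i (node z (Suc i) 0) = 0" if "z \<in> {-1, s}" for i z by (rule w_zero[OF that])
  show "w 0 (node z 0 j) = W (node z 0 j) * E c d (node z 0 j)" for z j by (rule w_0)
  show "regular (Q k)" for k by (rule regular_Q)
  show "Q k (node z i j) - Q k (node z (Suc i) j) = - (1 / s) * (1 - - c * d * s / q * q powi - k) * (node z i j * Q (k - 1) (node z i j))"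
    if z: "z \<in> {-1, s}" for k i z j
  proof -
    define y where "y = node z i j"
    \<comment> \<open>At \<open>y/q\<close> the two products supply exactly the factors
      \<open>1 - cy/q\<close> and \<open>1 - dy/q\<close> of \<open>f_lower\<close>.\<close>
    have e: "qpoch_inf (\<delta> * (y / q)) q = (1 - \<delta> * y / q) * qpoch_inf (\<delta> * y) q" for \<delta>
      using qpoch_inf_rec[OF q(1), of "\<delta> * y / q"] q by simp
    have gen: "f1 * (w1 * w2) - f2 * (u1 * w1 * (u2 * w2)) = (f1 - u1 * u2 * f2) * (w1 * w2)" for f1 f2 u1 u2 w1 w2 :: complex
      by (simp add: algebra_simps)
    have "Q k y - Q k (y / q) = (f k y - (1 - c * y / q) * (1 - d * y / q) * f k (y / q)) * (qpoch_inf (c * y) q * qpoch_inf (d * y) q)"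
      unfolding y_def node_div Q_node[OF z] unfolding node_div[symmetric] y_def[symmetric] e[of c] e[of d]
      by (rule gen)
    also have "\<dots> = - (1 / s) * (1 - - c * d * s / q * q powi - k) * (y * Q (k - 1) y)"
      unfolding f_lower[OF z y_def[unfolded node_powi]] unfolding y_def Q_node[OF z] by (simp only: mult_ac)
    finally show ?thesis unfolding y_def node_div .
  qed
  show "Q k (node z 0 j) * E c d (node z 0 j) - Q k (node z 0 (Suc j)) * E c d (node z 0 (Suc j))
    = - q * q powi k * (node z 0 j * (Q (k + 1) (node z 0 j) * E c d (node z 0 j)))" if z: "z \<in> {-1, s}" for k z j
    unfolding Q_E_node[OF z] unfolding q_node[symmetric] by (rule f_raise[OF z node_powi])
  show "Gam_Q (k + 1) = Gam_Q k * (1 - q powi (k + 1) / (- c * d * s / q))" for k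
  proof -
    have e: "q powi (k + 1) / (- c * d * s / q) * q = q powi (k + 1 + 1) / (- c * d * s / q)"
      by (simp only: times_divide_eq_left power_int_add[OF disjI1[OF q(2)], of "k + 1" 1] power_int_1_right)
    have "qpoch_inf (q powi (k + 1) / (- c * d * s / q)) q = (1 - q powi (k + 1) / (- c * d * s / q)) * qpoch_inf (q powi (k + 1 + 1) / (- c * d * s / q)) q"
      using qpoch_inf_rec[OF q(1), of "q powi (k + 1) / (- c * d * s / q)"] by (simp only: e)
    moreover have gen: "1 / v = 1 / (u * v) * u" if "u * v \<noteq> 0" for u v :: complex using that by simp
    ultimately show ?thesis unfolding Gam_Q_def using nz[of "k + 1"] by metis
  qed
  show "J 0 (\<lambda>y. W y * E c d y * Q k y) = Gam_Q k * F_Q k" for k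
    using nz[of "k + 1"] by (simp add: F_Q_def Gam_Q_def)
  show "- (1 / s) \<noteq> 0" "q \<noteq> 0" using s q by simp_all
  show "- c * d * s / q \<noteq> 0" using s q nonzero by simp
qed simp_all

lemma J_W_E_Q:
  assumes "qtheta (- s) q \<noteq> 0"
  shows "J 0 (\<lambda>y. W y * E c d y * Q k y) = (if k < 0 then 0 else pref k * ((1 - q) * qpoch_inf q q * qtheta (- s) q)
     * (\<alpha> ^ nat k * cdqHahn (nat k) x (- q / \<alpha>) (q / (s * \<alpha>)) 0 q / qpoch q q (nat k)))"
proof -
  have "J 0 (\<lambda>y. W y * E c d y * Q k y) = J 0 (\<lambda>y. W y * f k y)"
  proof (rule J_cong)
    fix z j assume "z \<in> {-1, s}"
    from Q_E_node[OF this, of k j]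
    show "W (node z 0 j) * E c d (node z 0 j) * Q k (node z 0 j) = W (node z 0 j) * f k (node z 0 j)"
      by (simp only: mult_ac)
  qed
  also have "\<dots> = pref k * ((1 - q) * qpoch_inf q q * qtheta (- s) q) *
    CT r (\<lambda>T. T powi (- k) * (qpoch_inf (- q * T) q * qpoch_inf (q * T / s) q / D T))"
    by (rule J_W_f[OF assms])
  finally show ?thesis using CT_coeff(1)[of "nat k"] CT_coeff(2)[of k] by auto
qed

theorem second_integral:
  fixes k :: int and m :: nat
  assumes th: "qtheta (- s) q \<noteq> 0" and nz: "\<And>k. qpoch_inf (q powi k / (- c * d * s / q)) q \<noteq> 0"
  defines "K \<equiv> int m - int n + k"
  shows "J n (\<lambda>y. cdqHahn n x (- q / \<alpha>) (q / (s * \<alpha>)) (\<alpha> * y) q * ascPoly q (- s) m (- y * q ^ n) * Qfun k y c d (-1) s q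
       * (qpoch_inf (- y * q ^ (1 + n)) q * qpoch_inf (y * q ^ (1 + n) / s) q * E c d y))
   = (-1) powi k * qpoch_inf q q * qtheta (- s) q * ((1 - q) * (\<alpha> * s / q) ^ m * (\<alpha> / q) powi k * q powi (- int n) * q powi (int m * (int m - int n))
       * q powi (- (k * (k - 1) div 2))
       * (qpoch_inf (q powi (K + 1)) q * qpoch_inf (q powi (K + 1) / (- c * d * s / q)) q / qpoch_inf (q powi (k + 1) / (- c * d * s / q)) q)
       * alSalamChihara K x (- q / \<alpha>) (q / (s * \<alpha>)) q
       * bigqLaguerre_norm m (q powi (k + 1) / (- c * d * s / q)) (q powi (int n - int m)) (- q / (\<alpha> ^ 2 * s) * q powi (int n - int m)) q)"
proof -
  interpret L: ladder q s n w Q UNIV c d "- (1 / s)" "- c * d * s / q" q Gam_Q F_Q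
    "\<lambda>i m k. bigqLaguerre_norm m (q powi (k + 1) / (- c * d * s / q)) (q powi (int i - int m))
      (- q / (q * - (1 / s) * (- c * d * s / q) * s) * q powi (int i - int m)) q"
    by (rule ladder_Q[OF nz])
  define B where "B = - c * d * s / q"
  define Lm where "Lm = bigqLaguerre_norm m (q powi (k + 1) / B) (q powi (int n - int m)) (- q / (\<alpha> ^ 2 * s) * q powi (int n - int m)) q"
  have "q * - (1 / s) * (- c * d * s / q) * s = c * d * s" using q s by simp
  then have Lm: "bigqLaguerre_norm m (q powi (k + 1) / (- c * d * s / q)) (q powi (int n - int m)) (- q / (q * - (1 / s) * (- c * d * s / q) * s) * q powi (int n - int m)) q = Lm"
    unfolding cd Lm_def B_def by simp
  have AB: "- (- (1 / s)) * (- c * d * s / q) = - (\<alpha> ^ 2 / q)"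
    unfolding cd[symmetric] using s by simp
  have regX: "regular (\<lambda>y. w n y * (ascPoly q (- s) m (- y * q ^ n) * Q k y))"
    by (intro regular_mult regular_w regular_Q isCont_regular continuous_intros)
  have "J n (\<lambda>y. cdqHahn n x (- q / \<alpha>) (q / (s * \<alpha>)) (\<alpha> * y) q * ascPoly q (- s) m (- y * q ^ n) * Qfun k y c d (-1) s q
       * (qpoch_inf (- y * q ^ (1 + n)) q * qpoch_inf (y * q ^ (1 + n) / s) q * E c d y)) = 1 / \<alpha> ^ n * L.X n m k"
    unfolding weighted_eq Q_def[symmetric] L.X_def J_mult[OF regX] ..
  also have "L.X n m k = Gam_Q k * L.T n m k" using L.X_eq[of n k m] by simp
  finally have main: "J n (\<lambda>y. cdqHahn n x (- q / \<alpha>) (q / (s * \<alpha>)) (\<alpha> * y) q * ascPoly q (- s) m (- y * q ^ n) * Qfun k y c d (-1) s q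
       * (qpoch_inf (- y * q ^ (1 + n)) q * qpoch_inf (y * q ^ (1 + n) / s) q * E c d y)) = Gam_Q k * (1 / \<alpha> ^ n * L.T n m k)" by simp
  have Ki: "int m + k - int n = K" by (simp add: K_def)
  have T: "L.T n m k = (- s * q) ^ m * (- (\<alpha> ^ 2 / q)) ^ n * q powi (L.expo n m k) * Lm * F_Q K"
    unfolding L.T_def Lm Ki AB ..
  show ?thesis
  proof (cases "K < 0")
    case True
    then have "F_Q K = 0" by (simp add: F_Q_def J_W_E_Q[OF th])
    then show ?thesis unfolding main T using True by (simp add: alSalamChihara_def)
  next
    case False
    then obtain K' where K': "K = int K'" by (metis nonneg_int_cases not_less)
    define h where "h = cdqHahn K' x (- q / \<alpha>) (q / (s * \<alpha>)) 0 q"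
    have K1: "q powi (K + 1) = q ^ Suc K'" unfolding K' using q by (simp add: power_int_add)
    have asc: "alSalamChihara K x (- q / \<alpha>) (q / (s * \<alpha>)) q = h" by (simp add: alSalamChihara_def K' h_def)
    have qi: "qpoch_inf q q = qpoch q q K' * qpoch_inf (q ^ Suc K') q"
      using qpoch_inf_split[OF q(1), of q K'] by simp
    have FQ: "F_Q K = (-1) ^ K' * q powi (- (K * (K + 1) div 2)) * (qpoch_inf q q * (1 - q) * qtheta (- s) q) * (\<alpha> ^ K' * h) * (qpoch_inf (q ^ Suc K') q * qpoch_inf (q ^ Suc K' / B) q)"
    proof -
      have "F_Q K = pref K * ((1 - q) * qpoch_inf q q * qtheta (- s) q) * (\<alpha> ^ K' * h / qpoch q q K') * qpoch_inf (q ^ Suc K' / B) q"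
        using K1 by (simp add: F_Q_def J_W_E_Q[OF th] Gam_Q_def K' h_def B_def)
      also have "pref K = (-1) ^ K' * q powi (- (K * (K + 1) div 2)) * (qpoch q q K' * qpoch_inf (q ^ Suc K') q)"
        unfolding pref_def qi K' power_int_of_nat ..
      finally show ?thesis using qpoch_q_neq_0[OF q(1), of K'] by (simp add: mult_ac)
    qed
    have KK: "int m + k = int n + int K'" using K' unfolding K_def by linarith
    have e: "q ^ m / q ^ n * q powi (L.expo n m k) * q powi (- (K * (K + 1) div 2)) = q powi (- int n) * q powi (int m * (int m - int n)) * q powi (- (k * (k - 1) div 2)) / q ^ m / q powi k"
    proof -
      have "K * (K + 1) div 2 = K * (K - 1) div 2 + K"
        using twice_triangular(2)[of K] twice_triangular(2)[of "K + 1"] by (simp add: algebra_simps)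
      then have "int m + - int n + L.expo n m k + - (K * (K + 1) div 2) = - int n + int m * (int m - int n) + - (k * (k - 1) div 2) + - int m + - k"
        using exponent_eq[of m k] unfolding L.expo_def K_def by (simp add: algebra_simps)
      then have "q powi (int m + - int n + L.expo n m k + - (K * (K + 1) div 2)) = q powi (- int n + int m * (int m - int n) + - (k * (k - 1) div 2) + - int m + - k)"
        by (rule arg_cong)
      then show ?thesis unfolding L.q_powi_add power_int_minus[of q "int _"] power_int_minus[of q k] power_int_of_nat divide_inverse .
    qed
    have sg: "1 / \<alpha> ^ n * ((- s) ^ m * (- (\<alpha> ^ 2)) ^ n * ((-1) ^ K' * \<alpha> ^ K')) = (-1) powi k * \<alpha> ^ m * \<alpha> powi k * s ^ m"
    proof -
      have "(- s) ^ m * (- (\<alpha> ^ 2)) ^ n * ((-1) ^ K' * \<alpha> ^ K') = ((-1) ^ m * (-1) powi (int n + int K')) * s ^ m * \<alpha> ^ n * \<alpha> powi (int n + int K')"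
        unfolding neg_square_power using \<alpha> by (simp add: power_minus[of s] power_int_add)
      also have "\<alpha> powi (int n + int K') = \<alpha> ^ m * \<alpha> powi k" unfolding KK[symmetric] using \<alpha> by (simp add: power_int_add)
      also have "(-1) ^ m * (-1) powi (int n + int K') = ((-1) powi k :: complex)"
        unfolding KK[symmetric] by (simp add: power_int_add flip: power_mult_distrib mult.assoc)
      finally show ?thesis using \<alpha> by simp
    qed
    have "1 / \<alpha> ^ n * L.T n m k = (1 / \<alpha> ^ n * ((- s) ^ m * (- (\<alpha> ^ 2)) ^ n * ((-1) ^ K' * \<alpha> ^ K'))) *
        (q ^ m / q ^ n * q powi (L.expo n m k) * q powi (- (K * (K + 1) div 2))) * (qpoch_inf q q * (1 - q) * qtheta (- s) q) * h * Lm
        * (qpoch_inf (q ^ Suc K') q * qpoch_inf (q ^ Suc K' / B) q)"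
    proof -
      have "(- (\<alpha> ^ 2 / q)) ^ n = (- (\<alpha> ^ 2)) ^ n / q ^ n" unfolding minus_divide_left power_divide ..
      then show ?thesis unfolding T FQ power_mult_distrib by (simp only: divide_inverse mult_ac)
    qed
    then show ?thesis
      unfolding main asc K1 B_def[symmetric] Lm_def[symmetric] sg e Gam_Q_def
      by (simp add: power_divide power_mult_distrib power_int_divide_distrib mult_ac)
  qed
qed

end

section \<open>Specialisation to the parameters of the theorem\<close>

lemma bigqLaguerre_norm_commute: "bigqLaguerre_norm m z a b q = bigqLaguerre_norm m z b a q"
  unfolding bigqLaguerre_norm_def by (simp only: mult.commute)

lemma powr_half: "0 < a \<Longrightarrow> a powr (real m / 2) = sqrt a ^ m" "0 < a \<Longrightarrow> a powr (real_of_int k / 2) = sqrt a powi k"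
proof -
  have 1: "a powr (real_of_int k / 2) = sqrt a powi k" if "0 < a" for k
  proof -
    have "a powr (real_of_int k / 2) = (a powr (1 / 2)) powr real_of_int k" unfolding powr_powr by simp
    also have "\<dots> = sqrt a powi k" using that unfolding powr_half_sqrt[OF less_imp_le[OF that]] by (simp add: powr_real_of_int')
    finally show ?thesis .
  qed
  show "0 < a \<Longrightarrow> a powr (real_of_int k / 2) = sqrt a powi k" by (rule 1)
  show "0 < a \<Longrightarrow> a powr (real m / 2) = sqrt a ^ m" using 1[of "int m"] by simp
qed

lemma (in q_lattice) qpoch_inf_negative_real_neq_0:
  assumes "q = of_real p" "0 < p" "a < 0"
  shows "qpoch_inf (of_real a) q \<noteq> 0"
proof
  assume "qpoch_inf (of_real a) q = 0"
  then obtain j where "of_real a * q ^ j = (1 :: complex)" unfolding qpoch_inf_eq_0_iff[OF q(1)] by blast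
  then have "of_real (a * p ^ j) = (of_real 1 :: complex)" using assms(1) by simp
  then have "a * p ^ j = 1" by (simp only: of_real_eq_iff)
  moreover have "a * p ^ j < 0" using assms by (simp add: mult_neg_pos)
  ultimately show False by simp
qed

lemma (in q_lattice) node_in_jackson_nodes:
  assumes "z \<in> {-1, s}"
  shows "node z N j \<in> jackson_nodes (node (-1) N 0) (node s N 0) q"
proof -
  have "node z N j = node z N 0 * q ^ j" for z by (simp add: node_def)
  then show ?thesis using assms unfolding jackson_nodes_def by (metis (no_types, lifting) UnI1 UnI2 insertE rangeI singletonD)
qed

text \<open>No node is 0, so the value of \<open>alSalamCarlitz\<close> at 0, where
  \<open>inverse 0 = 0\<close> distorts it, is never met.\<close>

lemma (in dual_hahn) J_alSalamCarlitz:
  "jackson (\<lambda>y. p y * alSalamCarlitz m (- s) (- y * q ^ n) q * g y * (v y / qpoch_inf_pm (\<alpha> * y) x q)) (node (-1) n 0) (node s n 0) q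
   = J n (\<lambda>y. p y * ascPoly q (- s) m (- y * q ^ n) * g y * (v y * E c d y))"
  unfolding J_def[symmetric]
proof (rule J_cong)
  fix z j assume z: "z \<in> {-1, s}"
  define y where "y = node z n j"
  have "- y * q ^ n \<noteq> 0" using node_nonzero[OF z] q unfolding y_def by simp
  then have 1: "alSalamCarlitz m (- s) (- y * q ^ n) q = ascPoly q (- s) m (- y * q ^ n)"
    by (rule alSalamCarlitz_eq_ascPoly[OF q(2)])
  have 2: "v y / qpoch_inf_pm (\<alpha> * y) x q = v y * E c d y"
  proof -
    have "\<alpha> * y * x = c * y" "\<alpha> * y / x = d * y" by simp_all
    then show ?thesis by (simp only: qpoch_inf_pm_def E_def times_divide_eq_right mult_1_right)
  qed
  show "p y * alSalamCarlitz m (- s) (- y * q ^ n) q * g y * (v y / qpoch_inf_pm (\<alpha> * y) x q)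
     = p y * ascPoly q (- s) m (- y * q ^ n) * g y * (v y * E c d y)"
    unfolding 1 2 ..
qed

lemma first_identity:
  fixes q s t \<nu> :: real and x :: complex and m n k :: nat
  assumes "0 < q" and "q < 1" and "norm x = 1" and "0 < s" and "0 < t" and "\<nu> \<in> {-1, t}"
    and nz: "\<forall>y\<in>jackson_nodes (- (q powi (- int n))) (s * q powi (- int n)) q.
         qpoch_inf_pm (- y * \<nu> * sqrt (q / (s * t))) x q \<noteq> 0"
  shows "jackson (\<lambda>y.
            cdqHahn n x (sqrt (q * s * t) / \<nu>) (- sqrt (q * t / s) / \<nu>)
              (- \<nu> * y * sqrt (q / (s * t))) q
          * alSalamCarlitz m (- s) (- y * q ^ n) q
          * alSalamCarlitz2 k y (- \<nu> * x * sqrt (q / (s * t))) (- (\<nu> / x) * sqrt (q / (s * t))) q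
          * (qpoch_inf (- y * q ^ (1 + n)) q * qpoch_inf (y * q ^ (1 + n) / s) q
             / qpoch_inf_pm (- y * \<nu> * sqrt (q / (s * t))) x q))
          (- (q powi (- int n))) (s * q powi (- int n)) q
      = qpoch q q k * qtheta (- s) q *
        ((1 - q) * (-1) ^ m * \<nu> ^ (m + k)
          * (q / (s * t)) powr (real k / 2) * (s / (q * t)) powr (real m / 2)
          * q powi (- int n) * q powi (int m * (int m - int n))
          * q powi (- (int k * (int k - 1) div 2))
          * (qpoch_inf (q powi (int m - int n + int k + 1)) q
             * qpoch_inf (- (\<nu> ^ 2) * q powi (int m - int n + int k + 1) / t) q
             / (qpoch_inf_pm (- \<nu> * sqrt (q * s / t)) x q
                * qpoch_inf_pm (\<nu> * sqrt (q / (s * t))) x q))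
          * alSalamChihara (int m - int n + int k) x
              (- \<nu> * sqrt (q * s / t)) (\<nu> * sqrt (q / (s * t))) q
          * bigqLaguerre_norm m (q ^ (k + 1))
              (t * q powi (int n - int m) / \<nu>) (- (q powi (int n - int m)) / \<nu>) q)"
proof -
  define Q S where "Q = complex_of_real q" and "S = complex_of_real s"
  define a where "a = sqrt (q / (s * t))"
  \<comment> \<open>Read off from the third dual Hahn parameter, which must be
    \<open>\<alpha> y\<close>; the first two are then \<open>-q/\<alpha>\<close> and
    \<open>q/(s\<alpha>)\<close>.\<close>
  define al where "al = - \<nu> * a"
  define \<alpha> where "\<alpha> = complex_of_real al"
  have \<nu>: "\<nu> \<noteq> 0" using assms by auto
  have a: "0 < a" using assms by (simp add: a_def)
  have aa: "a * a = q / (s * t)" using assms by (simp add: a_def)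
  interpret q_lattice Q S by unfold_locales (use assms in \<open>auto simp: Q_def S_def\<close>)
  have sq: "sqrt (q * s * t) = q / a" "sqrt (q * t / s) = q / (s * a)" "sqrt (q * s / t) = s * a" "sqrt (s / (q * t)) = s / q * a"
    by (rule real_sqrt_unique; use assms a aa in \<open>simp add: power2_eq_square field_simps\<close>)+
  have pm: "- y * complex_of_real \<nu> * complex_of_real (sqrt (q / (s * t))) = \<alpha> * y" for y
    by (simp add: \<alpha>_def al_def a_def)
  have ends: "complex_of_real (- (q powi - int n)) = node (- 1) n 0" "complex_of_real (s * q powi - int n) = node S n 0"
    by (simp_all add: node_def power_int_minus divide_inverse flip: Q_def S_def)
  have "qpoch_inf (\<alpha> * x * node z n j) Q \<noteq> 0 \<and> qpoch_inf (\<alpha> / x * node z n j) Q \<noteq> 0" if "z \<in> {-1, S}" for z j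
  proof -
    from that have "qpoch_inf_pm (\<alpha> * node z n j) x Q \<noteq> 0"
      using nz node_in_jackson_nodes unfolding ends pm Q_def[symmetric] S_def[symmetric] by blast
    moreover have "\<alpha> * node z n j * x = \<alpha> * x * node z n j" "\<alpha> * node z n j / x = \<alpha> / x * node z n j" by simp_all
    ultimately show ?thesis unfolding qpoch_inf_pm_def by (simp only: mult_eq_0_iff de_Morgan_disj simp_thms)
  qed
  then have adm: "admissible n (\<alpha> * x)" "admissible n (\<alpha> / x)"
    unfolding admissible_def by blast+
  interpret dual_hahn Q S \<alpha> x n by unfold_locales (use \<nu> a assms(3) adm in \<open>auto simp: \<alpha>_def al_def\<close>)
  have arg: "complex_of_real (sqrt (q * s * t) / \<nu>) = - Q / \<alpha>" "complex_of_real (- sqrt (q * t / s) / \<nu>) = Q / (S * \<alpha>)"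
      "complex_of_real (- \<nu>) * y * complex_of_real (sqrt (q / (s * t))) = \<alpha> * y"
      "complex_of_real (- \<nu>) * x * complex_of_real (sqrt (q / (s * t))) = \<alpha> * x"
      "- (complex_of_real \<nu> / x) * complex_of_real (sqrt (q / (s * t))) = \<alpha> / x"
      "complex_of_real (- s) = - S" "complex_of_real (q ^ l) = Q ^ l" "complex_of_real (q powi i) = Q powi i"
      "complex_of_real (- \<nu> * sqrt (q * s / t)) = \<alpha> * S" "complex_of_real (\<nu> * sqrt (q / (s * t))) = - \<alpha>" for y l i
    using a \<nu> unfolding sq a_def[symmetric] \<alpha>_def al_def by (simp_all add: mult_ac flip: Q_def S_def)
  \<comment> \<open>The value is negative, so all factors \<open>1 + cds q^j\<close> are nonzero, as
    \<open>first_integral\<close> requires.\<close>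
  have cdS: "- c * d * S = complex_of_real (- (\<nu> ^ 2 * q / t))"
  proof -
    have "- c * d * S = complex_of_real (- (\<nu> ^ 2 * (a * a) * s))"
      unfolding mult_minus_left cd by (simp add: \<alpha>_def al_def S_def power2_eq_square mult_ac)
    also have "\<nu> ^ 2 * (a * a) * s = \<nu> ^ 2 * q / t" unfolding aa using assms by simp
    finally show ?thesis .
  qed
  have neg: "qpoch_inf (complex_of_real z) Q \<noteq> 0" if "z < 0" for z
    by (rule qpoch_inf_negative_real_neq_0[OF Q_def assms(1) that])
  have theta: "qtheta (- S) Q \<noteq> 0"
    using assms neg[of "- s"] neg[of "- (q / s)"] by (simp add: qtheta_def flip: Q_def S_def)
  have cdS_nz: "qpoch (- c * d * S) Q j \<noteq> 0" for j
    using neg[of "- (\<nu> ^ 2 * q / t)"] qpoch_inf_split[OF q(1), of "- c * d * S" j] \<nu> assms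
    unfolding cdS by auto
  have L: "bigqLaguerre_norm m (Q ^ (k + 1)) (complex_of_real (t * q powi (int n - int m) / \<nu>)) (complex_of_real (- (q powi (int n - int m)) / \<nu>)) Q
      = bigqLaguerre_norm m (Q ^ Suc k) (Q powi (int n - int m)) (- Q / (\<alpha> ^ 2 * S) * Q powi (int n - int m)) Q"
  proof -
    have "- Q / (\<alpha> ^ 2 * S) = Q / (- c * d * S)" unfolding cd[symmetric] by simp
    also have "\<dots> = complex_of_real (- (t / \<nu> ^ 2))" unfolding cdS using assms by (simp add: Q_def)
    finally have B: "- Q / (\<alpha> ^ 2 * S) = complex_of_real (- (t / \<nu> ^ 2))" .
    \<comment> \<open>For \<open>\<nu> = t\<close> the two Laguerre parameters agree in order, for
      \<open>\<nu> = -1\<close> they are exchanged.\<close>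
    from assms(6) consider "\<nu> = - 1" | "\<nu> = t" by auto
    then show ?thesis
    proof cases
      case 1
      then show ?thesis unfolding B by (subst bigqLaguerre_norm_commute) (simp add: Q_def)
    next
      case 2
      then show ?thesis using assms unfolding B by (simp add: Q_def power2_eq_square)
    qed
  qed
  have scal: "complex_of_real ((1 - q) * (-1) ^ m * \<nu> ^ (m + k)
          * (q / (s * t)) powr (real k / 2) * (s / (q * t)) powr (real m / 2)
          * q powi (- int n) * q powi (int m * (int m - int n))
          * q powi (- (int k * (int k - 1) div 2)))
      = (1 - Q) * (-1) ^ k * \<alpha> ^ (m + k) * (S / Q) ^ m * Q powi (- int n) * Q powi (int m * (int m - int n))
       * Q powi (- (int k * (int k - 1) div 2))"
  proof -
    have pw: "(q / (s * t)) powr (real k / 2) = a ^ k" "(s / (q * t)) powr (real m / 2) = (s / q * a) ^ m"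
      using assms by (simp_all add: powr_half(1) sq a_def)
    have sgn: "(-1) ^ m * \<nu> ^ (m + k) * a ^ k * (u * a) ^ m = (-1) ^ k * al ^ (m + k) * u ^ m" for u
    proof -
      have "(- \<nu> * a) ^ i = (-1) ^ i * (\<nu> ^ i * a ^ i)" for i
        by (simp add: power_minus[of "\<nu> * a"] power_mult_distrib)
      then show ?thesis unfolding al_def by (simp add: power_mult_distrib power_add mult_ac)
    qed
    have "(1 - q) * (-1) ^ m * \<nu> ^ (m + k) * a ^ k * (s / q * a) ^ m * X * Y * Z
        = (1 - q) * ((-1) ^ m * \<nu> ^ (m + k) * a ^ k * (s / q * a) ^ m) * X * Y * Z" for X Y Z
      by (simp only: mult.assoc)
    then have "(1 - q) * (-1) ^ m * \<nu> ^ (m + k) * a ^ k * (s / q * a) ^ m * X * Y * Z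
        = (1 - q) * (-1) ^ k * al ^ (m + k) * (s / q) ^ m * X * Y * Z" for X Y Z
      unfolding sgn by (simp only: mult.assoc)
    note e = this
    show ?thesis unfolding pw e by (simp add: \<alpha>_def Q_def S_def)
  qed
  have V: "complex_of_real (- (\<nu> ^ 2) * q powi (int m - int n + int k + 1) / t) = - c * d * S * Q powi (int m - int n + int k)"
    using assms(1) unfolding cdS by (simp add: power_int_add[of q "_ + _" 1] Q_def)
  have den: "qpoch_inf_pm (\<alpha> * S) x Q * qpoch_inf_pm (- \<alpha>) x Q = qpoch_inf (- c) Q * qpoch_inf (c * S) Q * (qpoch_inf (- d) Q * qpoch_inf (d * S) Q)"
  proof -
    have "\<alpha> * S * x = c * S" "\<alpha> * S / x = d * S" "- \<alpha> * x = - c" "- \<alpha> / x = - d" by simp_all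
    then show ?thesis unfolding qpoch_inf_pm_def by (simp only: mult_ac)
  qed
  show ?thesis
    unfolding ends pm scal V
    unfolding arg unfolding J_alSalamCarlitz Q_def[symmetric] S_def[symmetric] den
    unfolding L by (rule first_integral[OF theta cdS_nz])
qed

text \<open>The moduli of the lattice points form a countable set, while an interval is
  uncountable.\<close>

lemma exists_radius:
  fixes q s :: complex and R :: real
  assumes "0 < R"
  obtains r where "0 < r" "r < R" "\<forall>z\<in>{-1, s}. \<forall>i. norm (z * q powi i) \<noteq> r"
proof -
  define A where "A = range (\<lambda>i. norm (- 1 * q powi i)) \<union> range (\<lambda>i. norm (s * q powi i))"
  have "countable A" unfolding A_def by simp
  moreover have "uncountable {0<..<R}" using assms by (simp add: uncountable_open_interval)
  ultimately obtain r where "r \<in> {0<..<R} - A" by (metis Diff_eq_empty_iff countable_subset equals0I)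
  then show ?thesis by (intro that[of r]) (auto simp: A_def)
qed

lemma qtheta_eq_0:
  assumes "norm q < 1" "q \<noteq> 0" "a * q powi i = 1"
  shows "qtheta a q = 0"
proof -
  have "qpoch_inf 1 q = 0" using qpoch_inf_eq_0_iff[OF assms(1), of 1] by (auto intro: exI[of _ 0])
  then have "qtheta 1 q = 0" by (simp add: qtheta_def)
  moreover have "a \<noteq> 0" using assms(3) by auto
  ultimately show ?thesis using qtheta_powi[OF assms(1,2), of a i] assms(3) by simp
qed

lemma second_identity:
  fixes q s t \<nu> :: real and x :: complex and m n :: nat and k :: int
  assumes "0 < q" and "q < 1" and "norm x = 1" and "0 < s" and "0 < t" and "\<nu> \<in> {-1, t}"
    and nz: "qtheta (- (sqrt (q * t / s) / (\<nu> * x))) q * qtheta (s * (sqrt (q * t / s) / (\<nu> * x))) q \<noteq> 0"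
  shows "jackson (\<lambda>y.
            cdqHahn n x (- \<nu> * sqrt (q * s / t)) (\<nu> * sqrt (q / (s * t)))
              (y / \<nu> * sqrt (q * t / s)) q
          * alSalamCarlitz m (- s) (- y * q ^ n) q
          * Qfun k y (x / \<nu> * sqrt (q * t / s)) (1 / (\<nu> * x) * sqrt (q * t / s)) (-1) s q
          * (qpoch_inf (- y * q ^ (1 + n)) q * qpoch_inf (y * q ^ (1 + n) / s) q
             / qpoch_inf_pm (y / \<nu> * sqrt (q * t / s)) x q))
          (- (q powi (- int n))) (s * q powi (- int n)) q
      = (-1) powi k * qpoch_inf q q * qtheta (- s) q *
        ((1 - q) * \<nu> powi (- int m - k)
          * (t / (q * s)) powr (real_of_int k / 2) * (s * t / q) powr (real m / 2)
          * q powi (- int n) * q powi (int m * (int m - int n))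
          * q powi (- (k * (k - 1) div 2))
          * (qpoch_inf (q powi (int m - int n + k + 1)) q
             * qpoch_inf (- (\<nu> ^ 2) * q powi (int m - int n + k + 1) / t) q
             / qpoch_inf (- (\<nu> ^ 2) * q powi (k + 1) / t) q)
          * alSalamChihara (int m - int n + k) x
              (- \<nu> * sqrt (q * s / t)) (\<nu> * sqrt (q / (s * t))) q
          * bigqLaguerre_norm m (- (\<nu> ^ 2) * q powi (k + 1) / t)
              (- \<nu> * q powi (int n - int m)) (\<nu> * q powi (int n - int m) / t) q)"
proof -
  define qc sc where "qc = complex_of_real q" and "sc = complex_of_real s"
  define b where "b = sqrt (q * t / s)"
  define al where "al = b / \<nu>"
  define \<alpha> where "\<alpha> = complex_of_real al"
  have \<nu>: "\<nu> \<noteq> 0" using assms by auto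
  have x0: "x \<noteq> 0" using assms(3) by auto
  have b: "0 < b" using assms by (simp add: b_def)
  have bb: "b * b = q * t / s" using assms by (simp add: b_def)
  have \<alpha>0: "\<alpha> \<noteq> 0" using \<nu> b by (simp add: \<alpha>_def al_def)
  interpret q_lattice qc sc by unfold_locales (use assms in \<open>auto simp: qc_def sc_def\<close>)
  have sq: "sqrt (q / (s * t)) = q / (s * b)" "sqrt (q * s / t) = q / b" "sqrt (t / (q * s)) = b / q" "sqrt (s * t / q) = s / q * b"
    by (rule real_sqrt_unique; use assms b bb in \<open>simp add: power2_eq_square field_simps\<close>)+
  have pm: "y / complex_of_real \<nu> * complex_of_real (sqrt (q * t / s)) = \<alpha> * y" for y
    by (simp add: \<alpha>_def al_def flip: b_def)
  have ends: "complex_of_real (- (q powi - int n)) = node (- 1) n 0" "complex_of_real (s * q powi - int n) = node sc n 0"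
    by (simp_all add: node_def power_int_minus divide_inverse flip: qc_def sc_def)
  have theta: "qtheta (- \<alpha> / x) qc \<noteq> 0" "qtheta (\<alpha> / x * sc) qc \<noteq> 0"
  proof -
    have e: "- (complex_of_real (sqrt (q * t / s)) / (complex_of_real \<nu> * x)) = - \<alpha> / x"
      "complex_of_real s * (complex_of_real (sqrt (q * t / s)) / (complex_of_real \<nu> * x)) = \<alpha> / x * sc"
      by (simp_all add: \<alpha>_def al_def flip: b_def sc_def)
    from nz[unfolded e] show "qtheta (- \<alpha> / x) qc \<noteq> 0" "qtheta (\<alpha> / x * sc) qc \<noteq> 0"
      unfolding qc_def[symmetric] by (simp_all only: mult_eq_0_iff de_Morgan_disj simp_thms)
  qed
  have d_ne: "\<alpha> / x * (z * qc powi i) \<noteq> 1" if "z \<in> {-1, sc}" for z i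
  proof
    assume "\<alpha> / x * (z * qc powi i) = 1"
    then have "qtheta (\<alpha> / x * z) qc = 0" by (intro qtheta_eq_0[OF q, of _ i]) (simp only: mult.assoc)
    then show False using theta that by auto
  qed
  \<comment> \<open>The theta hypothesis only concerns \<open>\<alpha>/x\<close>. Since
    \<open>norm x = 1\<close> and the lattice is real, \<open>\<alpha> x\<close> is its complex
    conjugate, and conjugation transfers the nonvanishing.\<close>
  have c_ne: "\<alpha> * x * (z * qc powi i) \<noteq> 1" if z: "z \<in> {-1, sc}" for z i
  proof
    assume "\<alpha> * x * (z * qc powi i) = 1"
    then have "cnj (\<alpha> * x * (z * qc powi i)) = 1" by (simp only: complex_cnj_one)
    moreover have "cnj z = z" using z by (auto simp: sc_def)
    moreover have "cnj x = 1 / x"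
    proof -
      have "x * cnj x = 1" unfolding complex_norm_square[symmetric] assms(3) by simp
      then show ?thesis using x0 by (simp add: eq_divide_eq mult.commute)
    qed
    moreover have "cnj qc = qc" "cnj \<alpha> = \<alpha>" by (simp_all add: qc_def \<alpha>_def)
    ultimately have "\<alpha> * (1 / x) * (z * qc powi i) = 1" by (simp only: complex_cnj_mult complex_cnj_power_int)
    then have "\<alpha> / x * (z * qc powi i) = 1" by simp
    then show False using d_ne[OF z] by simp
  qed
  have node: "node z n j * qc ^ l = z * qc powi (int j - int n + int l)" for z j l
    using q by (simp add: node_def power_int_diff power_int_add)
  have adm: "admissible n a" if ne: "\<And>z i. z \<in> {-1, sc} \<Longrightarrow> a * (z * qc powi i) \<noteq> 1" for a
    unfolding admissible_def qpoch_inf_eq_0_iff[OF q(1)]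
  proof (intro ballI allI notI, elim exE)
    fix z j l assume z: "z \<in> {-1, sc}" and 1: "a * node z n j * qc ^ l = 1"
    show False using ne[OF z] 1 unfolding mult.assoc node by (rule notE)
  qed
  \<comment> \<open>As \<open>norm x = 1\<close>, both \<open>c\<close> and \<open>d\<close> have
    modulus \<open>norm \<alpha>\<close>, so one radius serves both products.\<close>
  define R where "R = 1 / norm \<alpha>"
  have "0 < R" using \<alpha>0 by (simp add: R_def)
  then obtain r where r: "0 < r" "r < R" and gen: "\<forall>z\<in>{-1, sc}. \<forall>i. norm (z * qc powi i) \<noteq> r"
    by (rule exists_radius[where q = qc and s = sc])
  have generic: "norm (z * qc powi i) \<noteq> r" if "z \<in> {-1, sc}" for z i
    by (rule spec[OF bspec[OF gen that]])
  have adm_c: "admissible n (\<alpha> * x)" and adm_d: "admissible n (\<alpha> / x)"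
    by (rule adm, erule c_ne) (rule adm, erule d_ne)
  have cR: "norm (\<alpha> * x) * R \<le> 1" "norm (\<alpha> / x) * R \<le> 1"
    using assms(3) \<alpha>0 by (simp_all add: R_def norm_mult norm_divide)
  have qc_real: "qc = of_real (norm qc)" using assms(1) by (simp add: qc_def)
  interpret dual_hahn_contour qc sc \<alpha> x n r R
    by unfold_locales (fact q \<alpha>0 x0 adm_c adm_d qc_real r cR theta | erule generic)+
  have arg: "complex_of_real (- \<nu> * sqrt (q * s / t)) = - qc / \<alpha>" "complex_of_real (\<nu> * sqrt (q / (s * t))) = qc / (sc * \<alpha>)"
      "x / complex_of_real \<nu> * complex_of_real (sqrt (q * t / s)) = \<alpha> * x"
      "1 / (complex_of_real \<nu> * x) * complex_of_real (sqrt (q * t / s)) = \<alpha> / x"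
      "complex_of_real (- s) = - sc" "complex_of_real (q ^ l) = qc ^ l" for l
    using b \<nu> unfolding sq b_def[symmetric] \<alpha>_def al_def by (simp_all add: mult_ac flip: qc_def sc_def)
  have neg: "qpoch_inf (complex_of_real z) qc \<noteq> 0" if "z < 0" for z
    by (rule qpoch_inf_negative_real_neq_0[OF qc_def assms(1) that])
  have B: "- c * d * sc / qc = complex_of_real (- (t / \<nu> ^ 2))"
  proof -
    have "- c * d * sc / qc = complex_of_real (- (b * b * s / q / \<nu> ^ 2))"
      unfolding mult_minus_left cd by (simp add: \<alpha>_def al_def sc_def qc_def power2_eq_square mult_ac)
    also have "b * b * s / q = t" unfolding bb using assms by simp
    finally show ?thesis .
  qed
  have powi_B: "qc powi i / (- c * d * sc / qc) = complex_of_real (- (\<nu> ^ 2) * q powi i / t)" for i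
    unfolding B using \<nu> assms(5) by (simp add: qc_def)
  have B_nz: "qpoch_inf (qc powi i / (- c * d * sc / qc)) qc \<noteq> 0" for i
    unfolding powi_B using \<nu> assms by (intro neg) (simp add: divide_neg_pos mult_neg_pos)
  have theta_s: "qtheta (- sc) qc \<noteq> 0"
    using assms neg[of "- s"] neg[of "- (q / s)"] by (simp add: qtheta_def flip: qc_def sc_def)
  have L: "bigqLaguerre_norm m z (complex_of_real (- \<nu> * q powi (int n - int m))) (complex_of_real (\<nu> * q powi (int n - int m) / t)) qc
      = bigqLaguerre_norm m z (qc powi (int n - int m)) (- qc / (\<alpha> ^ 2 * sc) * qc powi (int n - int m)) qc" for z
  proof -
    have "- qc / (\<alpha> ^ 2 * sc) = 1 / (- c * d * sc / qc)" unfolding cd[symmetric] by simp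
    also have "\<dots> = complex_of_real (- (\<nu> ^ 2 / t))" unfolding B using assms by simp
    finally have B': "- qc / (\<alpha> ^ 2 * sc) = complex_of_real (- (\<nu> ^ 2 / t))" .
    from assms(6) consider "\<nu> = - 1" | "\<nu> = t" by auto
    then show ?thesis
    proof cases
      case 1
      then show ?thesis unfolding B' by (simp add: qc_def)
    next
      case 2
      then show ?thesis using assms unfolding B' by (subst bigqLaguerre_norm_commute) (simp add: qc_def power2_eq_square)
    qed
  qed
  have scal: "complex_of_real ((1 - q) * \<nu> powi (- int m - k)
          * (t / (q * s)) powr (real_of_int k / 2) * (s * t / q) powr (real m / 2)
          * q powi (- int n) * q powi (int m * (int m - int n))
          * q powi (- (k * (k - 1) div 2)))
      = (1 - qc) * (\<alpha> * sc / qc) ^ m * (\<alpha> / qc) powi k * qc powi (- int n) * qc powi (int m * (int m - int n))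
       * qc powi (- (k * (k - 1) div 2))"
  proof -
    have pw: "(t / (q * s)) powr (real_of_int k / 2) = (b / q) powi k" "(s * t / q) powr (real m / 2) = (s / q * b) ^ m"
      using assms by (simp_all add: powr_half sq)
    have sgn: "\<nu> powi (- int m - k) * (b / q) powi k * (u * b) ^ m = (u * al) ^ m * (al / q) powi k" for u
      using \<nu> unfolding al_def
      by (simp add: power_int_diff power_int_minus power_mult_distrib power_int_divide_distrib power_int_mult_distrib power_divide field_simps)
    have "(1 - q) * \<nu> powi (- int m - k) * (b / q) powi k * (s / q * b) ^ m * X * Y * Z
        = (1 - q) * (\<nu> powi (- int m - k) * (b / q) powi k * (s / q * b) ^ m) * X * Y * Z" for X Y Z
      by (simp only: mult.assoc)
    then have "(1 - q) * \<nu> powi (- int m - k) * (b / q) powi k * (s / q * b) ^ m * X * Y * Z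
        = (1 - q) * (s / q * al) ^ m * (al / q) powi k * X * Y * Z" for X Y Z
      unfolding sgn by (simp only: mult.assoc)
    note e = this
    show ?thesis unfolding pw e by (simp add: \<alpha>_def qc_def sc_def mult_ac)
  qed
  have powi_qc: "complex_of_real (q powi i) = qc powi i" for i by (simp add: qc_def)
  show ?thesis
    unfolding ends pm scal qc_def[symmetric] L
    unfolding arg unfolding J_alSalamCarlitz qc_def[symmetric] sc_def[symmetric] powi_B[symmetric] powi_qc
    by (rule second_integral[OF theta_s B_nz])
qed

theorem theorem5p5:
  fixes q s t \<nu> :: real and x :: complex and m n :: nat
  assumes "0 < q" and "q < 1" and "norm x = 1" and "0 < s" and "0 < t" and "\<nu> \<in> {-1, t}"
  shows
    "((\<forall>y\<in>jackson_nodes (- (q powi (- int n))) (s * q powi (- int n)) q.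
         qpoch_inf_pm (- y * \<nu> * sqrt (q / (s * t))) x q \<noteq> 0) \<longrightarrow>
      (\<forall>k::nat.
        jackson (\<lambda>y.
            cdqHahn n x (sqrt (q * s * t) / \<nu>) (- sqrt (q * t / s) / \<nu>)
              (- \<nu> * y * sqrt (q / (s * t))) q
          * alSalamCarlitz m (- s) (- y * q ^ n) q
          * alSalamCarlitz2 k y (- \<nu> * x * sqrt (q / (s * t))) (- (\<nu> / x) * sqrt (q / (s * t))) q
          * (qpoch_inf (- y * q ^ (1 + n)) q * qpoch_inf (y * q ^ (1 + n) / s) q
             / qpoch_inf_pm (- y * \<nu> * sqrt (q / (s * t))) x q))
          (- (q powi (- int n))) (s * q powi (- int n)) q
      = qpoch q q k * qtheta (- s) q *
        ((1 - q) * (-1) ^ m * \<nu> ^ (m + k)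
          * (q / (s * t)) powr (real k / 2) * (s / (q * t)) powr (real m / 2)
          * q powi (- int n) * q powi (int m * (int m - int n))
          * q powi (- (int k * (int k - 1) div 2))
          * (qpoch_inf (q powi (int m - int n + int k + 1)) q
             * qpoch_inf (- (\<nu> ^ 2) * q powi (int m - int n + int k + 1) / t) q
             / (qpoch_inf_pm (- \<nu> * sqrt (q * s / t)) x q
                * qpoch_inf_pm (\<nu> * sqrt (q / (s * t))) x q))
          * alSalamChihara (int m - int n + int k) x
              (- \<nu> * sqrt (q * s / t)) (\<nu> * sqrt (q / (s * t))) q
          * bigqLaguerre_norm m (q ^ (k + 1))
              (t * q powi (int n - int m) / \<nu>) (- (q powi (int n - int m)) / \<nu>) q)))
   \<and>
     (qtheta (- (sqrt (q * t / s) / (\<nu> * x))) q * qtheta (s * (sqrt (q * t / s) / (\<nu> * x))) q \<noteq> 0 \<longrightarrow>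
      (\<forall>k::int.
        jackson (\<lambda>y.
            cdqHahn n x (- \<nu> * sqrt (q * s / t)) (\<nu> * sqrt (q / (s * t)))
              (y / \<nu> * sqrt (q * t / s)) q
          * alSalamCarlitz m (- s) (- y * q ^ n) q
          * Qfun k y (x / \<nu> * sqrt (q * t / s)) (1 / (\<nu> * x) * sqrt (q * t / s)) (-1) s q
          * (qpoch_inf (- y * q ^ (1 + n)) q * qpoch_inf (y * q ^ (1 + n) / s) q
             / qpoch_inf_pm (y / \<nu> * sqrt (q * t / s)) x q))
          (- (q powi (- int n))) (s * q powi (- int n)) q
      = (-1) powi k * qpoch_inf q q * qtheta (- s) q *
        ((1 - q) * \<nu> powi (- int m - k)
          * (t / (q * s)) powr (real_of_int k / 2) * (s * t / q) powr (real m / 2)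
          * q powi (- int n) * q powi (int m * (int m - int n))
          * q powi (- (k * (k - 1) div 2))
          * (qpoch_inf (q powi (int m - int n + k + 1)) q
             * qpoch_inf (- (\<nu> ^ 2) * q powi (int m - int n + k + 1) / t) q
             / qpoch_inf (- (\<nu> ^ 2) * q powi (k + 1) / t) q)
          * alSalamChihara (int m - int n + k) x
              (- \<nu> * sqrt (q * s / t)) (\<nu> * sqrt (q / (s * t))) q
          * bigqLaguerre_norm m (- (\<nu> ^ 2) * q powi (k + 1) / t)
              (- \<nu> * q powi (int n - int m)) (\<nu> * q powi (int n - int m) / t) q)))"
  using first_identity[OF assms] second_identity[OF assms] by blast

end
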